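(* Let $k\in\mathbb{Z}$ and $r>0$. If $0<r\le 1$, then $$\inf_{\mathbf{n}\in\mathcal{M}_k}E_r[\mathbf{n}]=\begin{cases}4\pi|k|(1-2r^2) & (k<0),\\ 4\pi k & (k\ge 0).\end{cases}$$ If $r>1$, then $\inf_{\mathbf{n}\in\mathcal{M}_k}E_r[\mathbf{n}]=-\infty$ for every $k\in\mathbb{Z}$.
   Context: Maps $\mathbf{n}=(n_1,n_2,n_3):\mathbb{R}^2\to\mathbb{S}^2\subset\mathbb{R}^3$ (with weak derivatives in $L^2_{loc}$); $\mathbf{e}_1,\mathbf{e}_2,\mathbf{e}_3$ is the canonical basis of $\mathbb{R}^3$. Define $D[\mathbf{n}]=\frac12\int_{\mathbb{R}^2}|\nabla\mathbf{n}|^2dx$, $H[\mathbf{n}]=\int_{\mathbb{R}^2}(\mathbf{n}-\mathbf{e}_3)\cdot(\nabla\times\mathbf{n})dx$ where $\nabla\times\mathbf{n}=(\partial_1,\partial_2,0)\times(n_1,n_2,n_3)=(\partial_2 n_3,-\partial_1 n_3,\partial_1 n_2-\partial_2 n_1)$, $V[\mathbf{n}]=\frac18\int_{\mathbb{R}^2}|\mathbf{n}-\mathbf{e}_3|^4dx=\frac12\int_{\mathbb{R}^2}(1-n_3)^2dx$, and for $r>0$, $E_r[\mathbf{n}]=D[\mathbf{n}]+rH[\mathbf{n}]+V[\mathbf{n}]$. The energy space is $\mathcal{M}=\{\mathbf{n}:\mathbb{R}^2\to\mathbb{S}^2\mid D[\mathbf{n}]+V[\mathbf{n}]<\infty\}$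 with metric $d_{\mathcal{M}}(\mathbf{n},\mathbf{m})=\|\mathbf{n}-\mathbf{m}\|_{L^4(\mathbb{R}^2)}+\|\nabla(\mathbf{n}-\mathbf{m})\|_{L^2(\mathbb{R}^2)}$; all terms of $E_r$ are finite on $\mathcal{M}$. The topological degree is $Q[\mathbf{n}]=\frac1{4\pi}\int_{\mathbb{R}^2}\mathbf{n}\cdot(\partial_1\mathbf{n}\times\partial_2\mathbf{n})dx$, which is an integer for $\mathbf{n}\in\mathcal{M}$, and $\mathcal{M}_k=\{\mathbf{n}\in\mathcal{M}\mid Q[\mathbf{n}]=k\}$ for $k\in\mathbb{Z}$. *)

theory Defs
  imports "HOL-Analysis.Analysis" "HOL-Analysis.Cross3"
begin

text \<open>Points of the plane are vectors in real^2 (components 1, 2); maps take values in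
  real^3 (components 1, 2, 3). A map n comes together with a family Dn of its weak partial
  derivatives: Dn i is the weak derivative of n in direction e_i.\<close>

definition e3 :: "real^3" where "e3 = vector [0, 0, 1]"

definition pderiv2 :: "(real^2 \<Rightarrow> real) \<Rightarrow> 2 \<Rightarrow> real^2 \<Rightarrow> real" where
  "pderiv2 \<phi> i x = frechet_derivative \<phi> (at x) (axis i 1)"

definition test_fun :: "(real^2 \<Rightarrow> real) \<Rightarrow> bool" where
  "test_fun \<phi> \<longleftrightarrow> (\<forall>x. \<phi> differentiable (at x))
     \<and> (\<forall>i. continuous_on UNIV (pderiv2 \<phi> i))
     \<and> bounded {x. \<phi> x \<noteq> 0}"

definition weak_pderiv :: "(real^2 \<Rightarrow> real^3) \<Rightarrow> 2 \<Rightarrow> (real^2 \<Rightarrow> real^3) \<Rightarrow> bool" where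
  "weak_pderiv n i g \<longleftrightarrow> g \<in> borel_measurable lborel \<and>
     (\<forall>\<phi>. test_fun \<phi> \<longrightarrow>
        (\<integral>x. pderiv2 \<phi> i x *\<^sub>R n x \<partial>lborel) = - (\<integral>x. \<phi> x *\<^sub>R g x \<partial>lborel))"

text \<open>Energy space: sphere-valued measurable maps with weak derivatives Dn such that
  D[n] + V[n] is finite (i.e. |grad n|^2 and (1-n_3)^2 are integrable).\<close>
definition energy_space :: "(real^2 \<Rightarrow> real^3) \<Rightarrow> (2 \<Rightarrow> real^2 \<Rightarrow> real^3) \<Rightarrow> bool" where
  "energy_space n Dn \<longleftrightarrow> n \<in> borel_measurable lborel \<and> (\<forall>x. norm (n x) = 1)
     \<and> (\<forall>i. weak_pderiv n i (Dn i))
     \<and> integrable lborel (\<lambda>x. \<Sum>i\<in>UNIV. (norm (Dn i x))\<^sup>2)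
     \<and> integrable lborel (\<lambda>x. (1 - n x $ 3)\<^sup>2)"

definition Dir :: "(2 \<Rightarrow> real^2 \<Rightarrow> real^3) \<Rightarrow> real" where
  "Dir Dn = (1/2) * (\<integral>x. (\<Sum>i\<in>UNIV. (norm (Dn i x))\<^sup>2) \<partial>lborel)"

definition curl :: "(2 \<Rightarrow> real^2 \<Rightarrow> real^3) \<Rightarrow> real^2 \<Rightarrow> real^3" where
  "curl Dn x = vector [Dn 2 x $ 3, - (Dn 1 x $ 3), Dn 1 x $ 2 - Dn 2 x $ 1]"

definition Helic :: "(real^2 \<Rightarrow> real^3) \<Rightarrow> (2 \<Rightarrow> real^2 \<Rightarrow> real^3) \<Rightarrow> real" where
  "Helic n Dn = (\<integral>x. (n x - e3) \<bullet> curl Dn x \<partial>lborel)"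

definition Pot :: "(real^2 \<Rightarrow> real^3) \<Rightarrow> real" where
  "Pot n = (1/2) * (\<integral>x. (1 - n x $ 3)\<^sup>2 \<partial>lborel)"

definition Energy :: "real \<Rightarrow> (real^2 \<Rightarrow> real^3) \<Rightarrow> (2 \<Rightarrow> real^2 \<Rightarrow> real^3) \<Rightarrow> real" where
  "Energy r n Dn = Dir Dn + r * Helic n Dn + Pot n"

definition degree :: "(real^2 \<Rightarrow> real^3) \<Rightarrow> (2 \<Rightarrow> real^2 \<Rightarrow> real^3) \<Rightarrow> real" where
  "degree n Dn = (1 / (4 * pi)) * (\<integral>x. n x \<bullet> cross3 (Dn 1 x) (Dn 2 x) \<partial>lborel)"

definition inf_energy :: "real \<Rightarrow> int \<Rightarrow> ereal" where
  "inf_energy r k = (INF (n, Dn) \<in> {(n, Dn). energy_space n Dn \<and> degree n Dn = real_of_int k}.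
                       ereal (Energy r n Dn))"

end

theory Submission
  imports Defs
begin

text \<open>Lower bound: since |n| = 1, the partial derivatives of n are tangential almost everywhere, and
  completing the square in the helical derivatives r Dn_i - e_i \<open>\<times>\<close> n gives
  r^2 D + r H + V \<open>\<ge>\<close> 4 pi r^2 Q; together with D \<open>\<ge>\<close> 4 pi |Q| this bounds
  E_r = (1 - r^2) D + (r^2 D + r H + V).

  Upper bound: a truncated Belavin-Polyakov skyrmion of degree -1 and size 2r has energy close to
  4 pi (1 - 2 r^2), and a shrinking one of degree 1 has energy close to 4 pi. Both equal e3 outside a
  disc, so p copies of the second and q copies of the first placed far apart have degree p - q and
  energy close to 4 pi (p + q (1 - 2 r^2)). For r > 1 adding further pairs of opposite degree drives
  the energy to minus infinity.\<close>

text \<open>The completed square is a pointwise inequality that needs n orthogonal to its partial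
  derivatives, but these are known only through integrals against C^1 test functions. Orthogonality
  is read off from translations: as |n| = 1, the product n(x) . (n(x + h e_i) - n(x)) equals -|n(x +
  h e_i) - n(x)|^2 / 2. Tested and integrated, the right side is O(h^2), while the left side is h
  times the tested integral of n . Dn_i, up to O(h^2).

  The two lower bounds add up to 4 pi ((1 - r^2) |Q| + r^2 Q), that is 4 pi Q for Q \<ge> 0 and 4 pi
  |Q| (1 - 2 r^2) for Q < 0; r \<le> 1 makes the weight 1 - r^2 nonnegative.

  The size 2r comes from minimizing over a: a skyrmion of size a has D near 4 pi, H near -8 pi a and
  V near 2 pi a^2, and 4 pi - 8 pi r a + 2 pi a^2 is least at a = 2r, with value 4 pi (1 - 2 r^2).
  Truncation is what allows gluing: the exact profile reaches e3 only at infinity, whereas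
  superposed fields must equal e3 wherever the other one varies. A pair of opposite degree costs 8
  pi (1 - r^2), which is negative exactly for r > 1.\<close>

section \<open>Continuously differentiable functions and weak derivatives\<close>

lemma lborel_distr_shift: "distr lborel borel (\<lambda>x. x + c) = (lborel :: 'a::euclidean_space measure)"
  using lborel_distr_plus[of c] by (simp add: add.commute cong: distr_cong)

text \<open>Measurability suffices: translation also preserves non-integrability, in which case both
  Bochner integrals are 0.\<close>

lemma integral_shift:
  fixes f :: "'a::euclidean_space \<Rightarrow> 'b::{banach, second_countable_topology}"
  assumes "f \<in> borel_measurable borel"
  shows "(\<integral>x. f (x + c) \<partial>lborel) = (\<integral>x. f x \<partial>lborel)"
  by (subst (2) lborel_distr_shift[of c, symmetric], subst integral_distr) (use assms in auto)

lemma nn_integral_shift: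
  assumes "f \<in> borel_measurable (borel :: 'a::euclidean_space measure)"
  shows "(\<integral>\<^sup>+x. f (x + c) \<partial>lborel) = (\<integral>\<^sup>+x. f x \<partial>lborel)"
  by (subst (2) lborel_distr_shift[of c, symmetric], subst nn_integral_distr) (use assms in auto)

lemma integrable_shift:
  fixes f :: "'a::euclidean_space \<Rightarrow> 'b::{banach, second_countable_topology}"
  assumes "integrable lborel f"
  shows "integrable lborel (\<lambda>x. f (x + c))"
proof -
  have [measurable]: "f \<in> borel_measurable borel"
    using assms by (simp add: borel_measurable_integrable)
  show ?thesis
    using assms by (subst (asm) lborel_distr_shift[of c, symmetric], subst (asm) integrable_distr_eq) auto
qed

text \<open>Carries the partial derivatives explicitly, so that sums, products, compositions and
  translations compute them along with the function.\<close>

definition C1_deriv :: "(real^2 \<Rightarrow> real) \<Rightarrow> (2 \<Rightarrow> real^2 \<Rightarrow> real) \<Rightarrow> bool" where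
  "C1_deriv f D \<longleftrightarrow> (\<forall>x. (f has_derivative (\<lambda>h. D 1 x * h$1 + D 2 x * h$2)) (at x))
     \<and> (\<forall>i. continuous_on UNIV (D i))"

lemma C1_deriv_has_derivative:
  "C1_deriv f D \<Longrightarrow> (f has_derivative (\<lambda>h. D 1 x * h$1 + D 2 x * h$2)) (at x)"
  by (simp add: C1_deriv_def)

lemma C1_deriv_continuous_deriv: "C1_deriv f D \<Longrightarrow> continuous_on S (D i)"
  by (auto simp: C1_deriv_def intro: continuous_on_subset)

lemma C1_deriv_continuous: "C1_deriv f D \<Longrightarrow> continuous_on S f"
  by (rule has_derivative_continuous_on) (rule has_derivative_at_withinI, rule C1_deriv_has_derivative)

lemma C1_deriv_const: "C1_deriv (\<lambda>x. c) (\<lambda>i x. 0)"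
  by (simp add: C1_deriv_def)

lemma C1_deriv_coord: "C1_deriv (\<lambda>x. x $ k) (\<lambda>i x. if i = k then 1 else 0)"
proof -
  have eq: "(\<lambda>h::real^2. h $ k) = (\<lambda>h. (if 1 = k then 1 else 0) * h$1 + (if 2 = k then 1 else 0) * h$2)"
    using exhaust_2[of k] by auto
  show ?thesis
    unfolding C1_deriv_def eq[symmetric]
    by (auto intro: bounded_linear_imp_has_derivative[OF bounded_linear_vec_nth])
qed

lemma C1_deriv_add:
  assumes "C1_deriv f D" "C1_deriv g E"
  shows "C1_deriv (\<lambda>x. f x + g x) (\<lambda>i x. D i x + E i x)"
  unfolding C1_deriv_def
proof (intro conjI allI)
  fix x
  show "((\<lambda>x. f x + g x) has_derivative
      (\<lambda>h. (D 1 x + E 1 x) * h$1 + (D 2 x + E 2 x) * h$2)) (at x)"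
    by (rule has_derivative_eq_rhs[OF has_derivative_add[OF
          C1_deriv_has_derivative[OF assms(1)] C1_deriv_has_derivative[OF assms(2)]]])
      (auto simp: algebra_simps)
qed (intro continuous_intros C1_deriv_continuous_deriv[OF assms(1)] C1_deriv_continuous_deriv[OF assms(2)])

lemma C1_deriv_mult:
  assumes "C1_deriv f D" "C1_deriv g E"
  shows "C1_deriv (\<lambda>x. f x * g x) (\<lambda>i x. f x * E i x + D i x * g x)"
  unfolding C1_deriv_def
proof (intro conjI allI)
  fix x
  show "((\<lambda>x. f x * g x) has_derivative
      (\<lambda>h. (f x * E 1 x + D 1 x * g x) * h$1 + (f x * E 2 x + D 2 x * g x) * h$2)) (at x)"
    by (rule has_derivative_eq_rhs[OF has_derivative_mult[OF
          C1_deriv_has_derivative[OF assms(1)] C1_deriv_has_derivative[OF assms(2)]]])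
      (auto simp: algebra_simps)
qed (intro continuous_intros C1_deriv_continuous_deriv[OF assms(1)] C1_deriv_continuous_deriv[OF assms(2)]
    C1_deriv_continuous[OF assms(1)] C1_deriv_continuous[OF assms(2)])

text \<open>Differentiability of \<open>g\<close> is asked only at values of \<open>f\<close>: the
  bubble profiles are composed with |x|^2, and their derivatives are available only for s \<ge>
  0.\<close>

lemma C1_deriv_compose:
  assumes "C1_deriv f D" "\<And>x. (g has_real_derivative g' (f x)) (at (f x))"
    and "continuous_on UNIV (\<lambda>x. g' (f x))"
  shows "C1_deriv (\<lambda>x. g (f x)) (\<lambda>i x. g' (f x) * D i x)"
  unfolding C1_deriv_def
proof (intro conjI allI)
  fix x
  show "((\<lambda>x. g (f x)) has_derivative
      (\<lambda>h. g' (f x) * D 1 x * h$1 + g' (f x) * D 2 x * h$2)) (at x)"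
    by (rule has_derivative_eq_rhs[OF has_derivative_compose[OF
          C1_deriv_has_derivative[OF assms(1)] assms(2)[unfolded has_field_derivative_def]]])
      (auto simp: algebra_simps)
qed (intro continuous_intros C1_deriv_continuous_deriv[OF assms(1)] assms(3))

lemma C1_deriv_shift:
  assumes "C1_deriv f D"
  shows "C1_deriv (\<lambda>x. f (x + c)) (\<lambda>i x. D i (x + c))"
  unfolding C1_deriv_def
proof (intro conjI allI)
  fix x
  have "((\<lambda>x. x + c) has_derivative (\<lambda>h. h)) (at x)"
    by (auto intro!: derivative_eq_intros)
  from has_derivative_compose[OF this C1_deriv_has_derivative[OF assms]]
  show "((\<lambda>x. f (x + c)) has_derivative
      (\<lambda>h. D 1 (x + c) * h$1 + D 2 (x + c) * h$2)) (at x)" .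
next
  fix i show "continuous_on UNIV (\<lambda>x. D i (x + c))"
    by (intro continuous_on_compose2[OF C1_deriv_continuous_deriv[OF assms]] continuous_intros) auto
qed

lemma C1_deriv_test_fun:
  assumes "C1_deriv f D" "bounded {x. f x \<noteq> 0}"
  shows "test_fun f" "pderiv2 f i = D i"
proof -
  have eq: "pderiv2 f i = D i" for i
    unfolding pderiv2_def frechet_derivative_at[OF C1_deriv_has_derivative[OF assms(1)], symmetric]
    using exhaust_2[of i] by (auto simp: axis_def)
  show "pderiv2 f i = D i" by fact
  show "test_fun f"
    unfolding test_fun_def eq using assms by (auto simp: differentiable_def C1_deriv_def)
qed

lemma test_fun_C1_deriv:
  assumes "test_fun f"
  shows "C1_deriv f (pderiv2 f)"
  unfolding C1_deriv_def
proof (intro conjI allI)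
  fix x
  have d: "(f has_derivative frechet_derivative f (at x)) (at x)"
    using assms by (auto simp: test_fun_def frechet_derivative_works)
  then interpret bounded_linear "frechet_derivative f (at x)"
    by (rule has_derivative_bounded_linear)
  have "frechet_derivative f (at x) h = pderiv2 f 1 x * h$1 + pderiv2 f 2 x * h$2" for h
  proof -
    have "h = h$1 *\<^sub>R axis 1 1 + h$2 *\<^sub>R axis 2 1"
      by (auto simp: vec_eq_iff axis_def forall_2)
    then have "frechet_derivative f (at x) h
        = frechet_derivative f (at x) (h$1 *\<^sub>R axis 1 1 + h$2 *\<^sub>R axis 2 1)" by metis
    then show ?thesis by (simp add: add scaleR pderiv2_def)
  qed
  then have "frechet_derivative f (at x) = (\<lambda>h. pderiv2 f 1 x * h$1 + pderiv2 f 2 x * h$2)"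
    by (rule ext)
  then show "(f has_derivative (\<lambda>h. pderiv2 f 1 x * h$1 + pderiv2 f 2 x * h$2)) (at x)"
    using d by simp
next
  fix i show "continuous_on UNIV (pderiv2 f i)" using assms by (auto simp: test_fun_def)
qed

lemma C1_deriv_DERIV_line:
  assumes "C1_deriv f D"
  shows "((\<lambda>t. f (x + t *\<^sub>R axis i 1)) has_real_derivative D i (x + t *\<^sub>R axis i 1)) (at t)"
proof -
  have "((\<lambda>t. x + t *\<^sub>R axis i 1) has_derivative (\<lambda>h. h *\<^sub>R axis i 1)) (at t)"
    by (auto intro!: derivative_eq_intros)
  from has_derivative_compose[OF this C1_deriv_has_derivative[OF assms]]
  show ?thesis
    unfolding has_field_derivative_def
    by (rule has_derivative_eq_rhs) (use exhaust_2[of i] in \<open>auto simp: axis_def\<close>)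
qed

text \<open>The difference quotients of \<open>f\<close> have integral 0 by translation invariance
  and converge dominatedly to \<open>D i\<close>.\<close>

lemma integral_C1_deriv_eq_0:
  assumes C: "C1_deriv f D" and b: "bounded {x. f x \<noteq> 0}"
  shows "(\<integral>x. D i x \<partial>lborel) = 0"
proof -
  let ?e = "axis i (1::real) :: real^2"
  obtain R where R: "\<And>x. f x \<noteq> 0 \<Longrightarrow> norm x \<le> R"
    using b by (auto simp: bounded_iff)
  \<comment> \<open>Steps are at most 1: the quotients vanish off the ball of radius R + 1, and mean
    value points of x in that ball lie within radius R + 2.\<close>
  have "compact (D i ` cball 0 (R + 2))"
    by (intro compact_continuous_image C1_deriv_continuous_deriv[OF C]) auto
  then obtain M where M: "\<And>x. norm x \<le> R + 2 \<Longrightarrow> \<bar>D i x\<bar> \<le> M"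
    by (fastforce dest!: compact_imp_bounded simp: bounded_iff)
  define h where "h n = inverse (real (Suc n))" for n
  define s where "s n x = (f (x + h n *\<^sub>R ?e) - f x) / h n" for n x
  have h: "0 < h n" "h n \<le> 1" for n by (auto simp: h_def field_simps)
  have h0: "h \<longlonglongrightarrow> 0" unfolding h_def by (rule LIMSEQ_inverse_real_of_nat)
  have [measurable]: "f \<in> borel_measurable borel" "D i \<in> borel_measurable borel"
    by (auto intro!: borel_measurable_continuous_onI C1_deriv_continuous[OF C] C1_deriv_continuous_deriv[OF C])
  have int: "integrable lborel f"
  proof -
    have "integrable lborel (\<lambda>x. indicator (cball 0 R) x *\<^sub>R f x)"
      by (intro borel_integrable_compact C1_deriv_continuous[OF C]) auto
    also have "(\<lambda>x. indicator (cball 0 R) x *\<^sub>R f x) = f"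
      using R by (auto simp: indicator_def fun_eq_iff)
    finally show ?thesis .
  qed
  have "(\<lambda>n. \<integral>x. s n x \<partial>lborel) \<longlonglongrightarrow> (\<integral>x. D i x \<partial>lborel)"
  proof (rule integral_dominated_convergence[where w = "\<lambda>x. indicator (cball 0 (R + 1)) x *\<^sub>R M"])
    show "D i \<in> borel_measurable lborel" "\<And>n. s n \<in> borel_measurable lborel"
      unfolding s_def by measurable
    show "integrable lborel (\<lambda>x. indicator (cball 0 (R + 1)) x *\<^sub>R M)"
      by (intro borel_integrable_compact) auto
    show "AE x in lborel. (\<lambda>n. s n x) \<longlonglongrightarrow> D i x"
    proof (rule AE_I2)
      fix x
      have "((\<lambda>t. (f (x + (0 + t) *\<^sub>R ?e) - f (x + 0 *\<^sub>R ?e)) / t) \<longlongrightarrow> D i (x + 0 *\<^sub>R ?e)) (at 0)"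
        using C1_deriv_DERIV_line[OF C, of x i 0] unfolding DERIV_def by simp
      moreover have "filterlim h (at 0) sequentially"
        using h0 h(1) by (auto simp: filterlim_at intro!: always_eventually) (metis less_irrefl)
      ultimately have "((\<lambda>n. (f (x + (0 + h n) *\<^sub>R ?e) - f (x + 0 *\<^sub>R ?e)) / h n) \<longlongrightarrow> D i (x + 0 *\<^sub>R ?e)) sequentially"
        by (rule filterlim_compose)
      then show "(\<lambda>n. s n x) \<longlonglongrightarrow> D i x" by (simp add: s_def)
    qed
    fix n
    show "AE x in lborel. norm (s n x) \<le> indicator (cball 0 (R + 1)) x *\<^sub>R M"
    proof (rule AE_I2)
      fix x :: "real^2"
      have nh: "norm (t *\<^sub>R ?e) \<le> 1" if "0 \<le> t" "t \<le> h n" for t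
        using that h[of n] by (simp add: norm_axis_1)
      show "norm (s n x) \<le> indicator (cball 0 (R + 1)) x *\<^sub>R M"
      proof (cases "norm x \<le> R + 1")
        case False
        have "R < norm (x + h n *\<^sub>R ?e)"
          using norm_triangle_ineq2[of x "- (h n *\<^sub>R ?e)"] nh[of "h n"] h[of n] False by auto
        then have "f (x + h n *\<^sub>R ?e) = 0" "f x = 0"
          using R[of x] R[of "x + h n *\<^sub>R ?e"] False by fastforce+
        then show ?thesis using False by (simp add: s_def)
      next
        case True
        obtain z where z: "0 < z" "z < h n"
          "f (x + h n *\<^sub>R ?e) - f (x + 0 *\<^sub>R ?e) = (h n - 0) * D i (x + z *\<^sub>R ?e)"
          using MVT2[of 0 "h n" "\<lambda>t. f (x + t *\<^sub>R ?e)" "\<lambda>t. D i (x + t *\<^sub>R ?e)"] h[of n]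
            C1_deriv_DERIV_line[OF C, of x i] by metis
        have "norm (x + z *\<^sub>R ?e) \<le> R + 2"
          using norm_triangle_ineq[of x "z *\<^sub>R ?e"] nh[of z] z True by linarith
        then have "\<bar>D i (x + z *\<^sub>R ?e)\<bar> \<le> M" by (rule M)
        moreover have "s n x = D i (x + z *\<^sub>R ?e)"
          using z h[of n] by (simp add: s_def)
        ultimately show ?thesis using True by simp
      qed
    qed
  qed
  moreover have "(\<integral>x. s n x \<partial>lborel) = 0" for n
    unfolding s_def using int integrable_shift[OF int] by (simp add: integral_shift)
  ultimately show ?thesis
    using LIMSEQ_unique[OF _ tendsto_const] by simp
qed

text \<open>For each component j, integration by parts is the vanishing integral of the derivative
  of the compactly supported product \<open>\<phi> x * n x $ j\<close>.\<close>

lemma weak_pderiv_C1: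
  assumes C: "\<And>j. C1_deriv (\<lambda>x. n x $ j) (\<lambda>i x. Dn i x $ j)"
  shows "weak_pderiv n i (Dn i)"
  unfolding weak_pderiv_def
proof (intro conjI allI impI)
  have cn: "continuous_on UNIV (\<lambda>x. n x)" "continuous_on UNIV (\<lambda>x. Dn i x)" for i
    by (auto simp: continuous_on_componentwise[where f = n]  continuous_on_componentwise[where f = "Dn i"]
       Basis_vec_def inner_axis intro!: C1_deriv_continuous[OF C] C1_deriv_continuous_deriv[OF C])
  show "Dn i \<in> borel_measurable lborel"
    using cn by (simp add: borel_measurable_continuous_onI)
  fix \<phi> assume T: "test_fun \<phi>"
  note CT = test_fun_C1_deriv[OF T]
  obtain R where R: "\<And>x. \<phi> x \<noteq> 0 \<Longrightarrow> norm x \<le> R"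
    using T by (auto simp: bounded_iff test_fun_def)
  have R': "pderiv2 \<phi> i x = 0" if "norm x > R" for x
  proof -
    have "open {x::real^2. norm x > R}" by (intro open_Collect_less continuous_intros)
    then have "(\<phi> has_derivative (\<lambda>_. 0)) (at x)"
      using R that by (intro has_derivative_transform_within_open[OF has_derivative_const[of 0]]) force+
    from frechet_derivative_at[OF this] have "frechet_derivative \<phi> (at x) = (\<lambda>_. 0)" by simp
    then show ?thesis by (simp add: pderiv2_def)
  qed
  have supp: "integrable lborel f" if "continuous_on UNIV f" "\<And>x. norm x > R \<Longrightarrow> f x = 0" for f :: "real^2 \<Rightarrow> real^3"
  proof -
    have "integrable lborel (\<lambda>x. indicator (cball 0 R) x *\<^sub>R f x)"
      by (intro borel_integrable_compact continuous_on_subset[OF that(1)]) auto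
    also have "(\<lambda>x. indicator (cball 0 R) x *\<^sub>R f x) = f"
      using that(2) by (auto simp: indicator_def fun_eq_iff)
    finally show ?thesis .
  qed
  have i1: "integrable lborel (\<lambda>x. pderiv2 \<phi> i x *\<^sub>R n x)"
    by (intro supp continuous_intros cn C1_deriv_continuous_deriv[OF CT]) (auto simp: R')
  have i2: "integrable lborel (\<lambda>x. \<phi> x *\<^sub>R Dn i x)"
    by (intro supp continuous_intros cn C1_deriv_continuous[OF CT]) (use R in fastforce)
  have "(\<integral>x. \<phi> x *\<^sub>R Dn i x + pderiv2 \<phi> i x *\<^sub>R n x \<partial>lborel) = 0"
    unfolding vec_eq_iff
  proof
    fix j
    have "(\<integral>x. \<phi> x *\<^sub>R Dn i x + pderiv2 \<phi> i x *\<^sub>R n x \<partial>lborel) $ j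
        = (\<integral>x. (\<phi> x *\<^sub>R Dn i x + pderiv2 \<phi> i x *\<^sub>R n x) $ j \<partial>lborel)"
      by (rule integral_bounded_linear[OF bounded_linear_vec_nth, symmetric])
        (intro Bochner_Integration.integrable_add i1 i2)
    also have "\<dots> = (\<integral>x. \<phi> x * Dn i x $ j + pderiv2 \<phi> i x * n x $ j \<partial>lborel)" by simp
    also have "\<dots> = 0"
      by (rule integral_C1_deriv_eq_0[OF C1_deriv_mult[OF CT C]])
        (rule bounded_subset[of "{x. \<phi> x \<noteq> 0}"], use T in \<open>auto simp: test_fun_def\<close>)
    finally show "(\<integral>x. \<phi> x *\<^sub>R Dn i x + pderiv2 \<phi> i x *\<^sub>R n x \<partial>lborel) $ j = 0 $ j" by simp
  qed
  then show "(\<integral>x. pderiv2 \<phi> i x *\<^sub>R n x \<partial>lborel) = - (\<integral>x. \<phi> x *\<^sub>R Dn i x \<partial>lborel)"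
    using i1 i2 by (simp add: eq_neg_iff_add_eq_0 add.commute)
qed

section \<open>Fundamental lemma of the calculus of variations\<close>

text \<open>Squaring makes the positive part continuously differentiable. This one function supplies
  both the box bumps and the cutoff of the bubble profile.\<close>

lemma DERIV_pos_part_power2: "((\<lambda>t. (max 0 t)\<^sup>2) has_real_derivative 2 * max 0 t) (at (t::real))"
proof (cases t "0::real" rule: linorder_cases)
  case less
  then have "((\<lambda>_. 0) has_real_derivative 2 * max 0 t) (at t)" by simp
  then show ?thesis
    by (rule has_field_derivative_transform_within_open[where S = "{..<0}"]) (use less in auto)
next
  case greater
  then have "((\<lambda>t. t\<^sup>2) has_real_derivative 2 * max 0 t) (at t)"
    by (auto intro!: derivative_eq_intros simp: max_def)
  then show ?thesis
    by (rule has_field_derivative_transform_within_open[where S = "{0<..}"]) (use greater in auto)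
next
  case equal
  have "((\<lambda>h. (max 0 h)\<^sup>2 / h) \<longlongrightarrow> 0) (at (0::real))"
  proof (rule Lim_null_comparison)
    show "\<forall>\<^sub>F h in at (0::real). norm ((max 0 h)\<^sup>2 / h) \<le> \<bar>h\<bar>"
      by (intro always_eventually allI) (simp add: max_def power2_eq_square)
    show "((\<lambda>h. \<bar>h\<bar>) \<longlongrightarrow> 0) (at (0::real))" by (auto intro!: tendsto_eq_intros)
  qed
  then show ?thesis using equal by (simp add: DERIV_def)
qed

text \<open>A product of four squared positive parts, one for each side of the box; C^1 regularity
  is all that \<open>test_fun\<close> asks for.\<close>

lemma obtain_box_bump:
  fixes a b :: "real^2"
  obtains w D where "C1_deriv w D" "\<And>x. 0 \<le> w x" "\<And>x. 0 < w x \<longleftrightarrow> x \<in> box a b"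
proof -
  let ?P = "\<lambda>t::real. (max 0 t)\<^sup>2"
  have lin: "\<exists>D. C1_deriv (\<lambda>x. c + s * x $ k) D" for c s :: real and k
    using C1_deriv_add[OF C1_deriv_const C1_deriv_mult[OF C1_deriv_const C1_deriv_coord]] by blast
  have P: "\<exists>D. C1_deriv (\<lambda>x. ?P (f x)) D" if "\<exists>D. C1_deriv f D" for f
  proof -
    from that obtain D where D: "C1_deriv f D" by blast
    have "C1_deriv (\<lambda>x. ?P (f x)) (\<lambda>i x. 2 * max 0 (f x) * D i x)"
      by (rule C1_deriv_compose[OF D DERIV_pos_part_power2])
        (intro continuous_intros C1_deriv_continuous[OF D])
    then show ?thesis by blast
  qed
  have M: "\<exists>D. C1_deriv (\<lambda>x. f x * g x) D" if "\<exists>D. C1_deriv f D" "\<exists>D. C1_deriv g D" for f g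
    using that C1_deriv_mult by blast
  let ?w = "\<lambda>x::real^2. (?P (- a$1 + 1 * x$1) * ?P (b$1 + (-1) * x$1)) * (?P (- a$2 + 1 * x$2) * ?P (b$2 + (-1) * x$2))"
  obtain D where D: "C1_deriv ?w D"
    using M[OF M[OF P[OF lin] P[OF lin]] M[OF P[OF lin] P[OF lin]]] by blast
  show ?thesis
  proof (rule that[OF D])
    fix x
    show "0 \<le> ?w x" by simp
    have P: "0 < ?P t \<longleftrightarrow> 0 < t" for t by (auto simp: max_def)
    have m: "0 < u * v \<longleftrightarrow> 0 < u \<and> 0 < v" if "0 \<le> u" "0 \<le> v" for u v :: real
      using that by (auto simp: zero_less_mult_iff)
    have "0 < ?w x \<longleftrightarrow> (0 < - a$1 + 1 * x$1 \<and> 0 < b$1 + (-1) * x$1) \<and> (0 < - a$2 + 1 * x$2 \<and> 0 < b$2 + (-1) * x$2)"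
      by (simp only: m P mult_nonneg_nonneg zero_le_power2)
    then show "0 < ?w x \<longleftrightarrow> x \<in> box a b"
      by (auto simp: mem_box_cart forall_2)
  qed
qed

text \<open>With w positive exactly on the box, the functions k w / (1 + k w) are test functions
  with values in [0, 1) converging pointwise to the indicator of the box.\<close>

lemma integral_box_eq_0_if_test_integrals:
  fixes F :: "real^2 \<Rightarrow> real"
  assumes [measurable]: "F \<in> borel_measurable borel"
    and loc: "\<And>R. integrable lborel (\<lambda>x. indicator (cball 0 R) x * F x)"
    and test: "\<And>\<phi>. test_fun \<phi> \<Longrightarrow> (\<integral>x. \<phi> x * F x \<partial>lborel) = 0"
  shows "(\<integral>x. indicator (box a b) x * F x \<partial>lborel) = 0"
proof -
  obtain w D where w: "C1_deriv w D" "\<And>x. 0 \<le> w x" "\<And>x. 0 < w x \<longleftrightarrow> x \<in> box a b"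
    using obtain_box_bump by blast
  define s where "s k x = real k * w x / (1 + real k * w x)" for k x
  have nz: "1 + real k * w x > 0" for k x using w(2)[of x] by (simp add: add_pos_nonneg)
  have supp: "{x. w x \<noteq> 0} = box a b" using w(2,3) by (auto simp: less_le)
  obtain R where R: "box a b \<subseteq> cball 0 R"
    using bounded_box[of a b] by (auto simp: bounded_iff subset_iff)
  have s: "test_fun (s k)" for k
  proof (rule C1_deriv_test_fun(1))
    show "C1_deriv (s k) (\<lambda>i x. real k / (1 + real k * w x)\<^sup>2 * D i x)"
      unfolding s_def
    proof (rule C1_deriv_compose[OF w(1)])
      fix x show "((\<lambda>t. real k * t / (1 + real k * t)) has_real_derivative real k / (1 + real k * w x)\<^sup>2) (at (w x))"
        using nz[of k x] by (auto intro!: derivative_eq_intros simp: power2_eq_square field_simps)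
    next
      show "continuous_on UNIV (\<lambda>x. real k / (1 + real k * w x)\<^sup>2)"
        using nz[of k] by (intro continuous_intros C1_deriv_continuous[OF w(1)]) (auto simp: less_le)
    qed
    have "{x. s k x \<noteq> 0} \<subseteq> box a b" using supp by (auto simp: s_def)
    then show "bounded {x. s k x \<noteq> 0}" using bounded_box bounded_subset by blast
  qed
  have bound: "0 \<le> s k x" "s k x \<le> indicator (cball 0 R) x" for k x
  proof -
    show "0 \<le> s k x" using w(2)[of x] nz[of k x] by (auto simp: s_def)
    show "s k x \<le> indicator (cball 0 R) x"
      using nz[of k x] w(2,3)[of x] R by (cases "w x = 0") (auto simp: s_def indicator_def less_le)
  qed
  have [measurable]: "w \<in> borel_measurable borel"
    by (intro borel_measurable_continuous_onI C1_deriv_continuous[OF w(1)])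
  have "(\<lambda>k. \<integral>x. s k x * F x \<partial>lborel) \<longlonglongrightarrow> (\<integral>x. indicator (box a b) x * F x \<partial>lborel)"
  proof (rule integral_dominated_convergence)
    show "(\<lambda>x. indicator (box a b) x * F x) \<in> borel_measurable lborel"
      "(\<lambda>x. s k x * F x) \<in> borel_measurable lborel" for k
      unfolding s_def by measurable
    show "integrable lborel (\<lambda>x. norm (indicator (cball 0 R) x * F x))"
      by (intro integrable_norm loc)
    show "AE x in lborel. (\<lambda>k. s k x * F x) \<longlonglongrightarrow> indicator (box a b) x * F x"
    proof (intro AE_I2 tendsto_mult tendsto_const)
      fix x
      show "(\<lambda>k. s k x) \<longlonglongrightarrow> indicator (box a b) x"
      proof (cases "x \<in> box a b")
        case True
        then have pos: "w x > 0" using w(3) by simp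
        have "filterlim (\<lambda>k. 1 + w x * real k) at_infinity sequentially"
          using pos by (intro filterlim_at_top_imp_at_infinity filterlim_tendsto_add_at_top[OF tendsto_const]
            filterlim_tendsto_pos_mult_at_top[OF tendsto_const] filterlim_real_sequentially)
        then have "(\<lambda>k. 1 - 1 / (1 + w x * real k)) \<longlonglongrightarrow> 1 - 0"
          by (intro tendsto_intros tendsto_divide_0[OF tendsto_const])
        moreover have "1 - 1 / (1 + w x * real k) = s k x" for k
          using nz[of k x] by (simp add: s_def field_simps)
        ultimately show ?thesis using True by simp
      next
        case False
        then have "w x = 0" using supp by blast
        then show ?thesis using False by (simp add: s_def)
      qed
    qed
    show "AE x in lborel. norm (s k x * F x) \<le> norm (indicator (cball 0 R) x * F x)" for k
      using bound[of k] by (auto simp: abs_mult intro!: mult_right_mono)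
  qed
  then show ?thesis
    using test[OF s] LIMSEQ_unique[OF _ tendsto_const] by simp
qed

text \<open>Boxes generate the Borel sets and are closed under intersection, so vanishing integrals
  over boxes pass to all Borel sets by Dynkin's theorem. Since \<open>F\<close> is only locally
  integrable, this is done for \<open>F\<close> restricted to one box at a time.\<close>

lemma AE_eq_0_if_test_integrals:
  fixes F :: "real^2 \<Rightarrow> real"
  assumes [measurable]: "F \<in> borel_measurable borel"
    and loc: "\<And>R. integrable lborel (\<lambda>x. indicator (cball 0 R) x * F x)"
    and test: "\<And>\<phi>. test_fun \<phi> \<Longrightarrow> (\<integral>x. \<phi> x * F x \<partial>lborel) = 0"
  shows "AE x in lborel. F x = 0"
proof -
  note box0 = integral_box_eq_0_if_test_integrals[OF assms]
  have "AE x in lborel. indicator (box a b) x * F x = 0" for a b :: "real^2"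
  proof (rule sigma_finite_measure.density_zero[OF sigma_finite_lborel])
    obtain R where R: "box a b \<subseteq> cball 0 R"
      using bounded_box[of a b] by (auto simp: bounded_iff subset_iff)
    show int: "integrable lborel (\<lambda>x. indicator (box a b) x * F x)"
      by (rule Bochner_Integration.integrable_bound[OF loc[of R]])
        (use R in \<open>auto simp: indicator_def subset_iff intro!: AE_I2\<close>)
    let ?f = "\<lambda>x. indicator (box a b) x * F x"
    have tot: "(\<integral>x. ?f x \<partial>lborel) = 0" by (rule box0)
    fix A :: "(real^2) set" assume "A \<in> sets lborel"
    then have A: "A \<in> sigma_sets UNIV (range (\<lambda>(a, b). box a b))"
      by (simp add: borel_eq_box)
    have "Int_stable (range (\<lambda>(a, b). box a b :: (real^2) set))"
      by (auto simp: Int_stable_def box_Int_box)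
    moreover have "(range (\<lambda>(a, b). box a b :: (real^2) set)) \<subseteq> Pow UNIV" by auto
    moreover note A
    ultimately show "set_lebesgue_integral lborel A ?f = 0"
      unfolding set_lebesgue_integral_def
    proof (induction rule: sigma_sets_induct_disjoint)
      case (basic A)
      then obtain c d where A: "A = box c d" by auto
      obtain p q where "box c d \<inter> box a b = box p q"
        by (auto simp: box_Int_box)
      then have "indicator A x *\<^sub>R ?f x = indicator (box p q) x * F x" for x
        unfolding A by (metis indicator_inter_arith mult.assoc real_scaleR_def)
      then show ?case by (simp only: box0)
    next
      case empty then show ?case by simp
    next
      case (compl A)
      then have [measurable]: "A \<in> sets borel" by (simp add: borel_eq_box)
      have iA: "integrable lborel (\<lambda>x. indicator A x *\<^sub>R ?f x)"
        by (intro integrable_mult_indicator int) simp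
      have "indicator (UNIV - A) x *\<^sub>R ?f x = ?f x - indicator A x *\<^sub>R ?f x" for x
        by (auto simp: indicator_def)
      then show ?case using compl int iA tot by simp
    next
      case (union A)
      then have [measurable]: "\<And>i. A i \<in> sets borel" by (auto simp: borel_eq_box)
      have "set_lebesgue_integral lborel (\<Union>i. A i) ?f = (\<Sum>i. set_lebesgue_integral lborel (A i) ?f)"
      proof (rule lebesgue_integral_countable_add)
        show "i \<noteq> j \<Longrightarrow> A i \<inter> A j = {}" for i j
          using union(1) by (auto simp: disjoint_family_on_def)
        show "set_integrable lborel (\<Union>i. A i) ?f"
          unfolding set_integrable_def by (intro integrable_mult_indicator int) simp
      qed simp
      then show ?case using union(3) by (simp add: set_lebesgue_integral_def)
    qed
  qed
  \<comment> \<open>Countably many boxes exhaust the plane, so the exceptional null sets can be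
    united.\<close>
  then have "AE x in lborel. \<forall>k::nat. indicator (box (\<chi> i. - real k) (\<chi> i. real k)) x * F x = 0"
    by (subst AE_all_countable) auto
  then show ?thesis
  proof eventually_elim
    case (elim x)
    obtain k :: nat where "norm x < real k" using reals_Archimedean2 by blast
    then have "x \<in> box (\<chi> i. - real k) (\<chi> i. real k)"
      using component_le_norm_cart[of x 1] component_le_norm_cart[of x 2] by (auto simp: mem_box_cart forall_2)
    then show ?case using elim by (metis indicator_simps(1) mult_1)
  qed
qed

section \<open>Increments of weakly differentiable functions\<close>

text \<open>One radius and one bound serve \<open>\<phi>\<close> and both derivatives; the
  derivatives vanish off the closed ball because its complement is open.\<close>

lemma test_fun_bounds:
  assumes "test_fun \<phi>"
  obtains R M where "0 \<le> R" "0 \<le> M" "\<And>x. \<bar>\<phi> x\<bar> \<le> M * indicator (cball 0 R) x"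
    "\<And>i x. \<bar>pderiv2 \<phi> i x\<bar> \<le> M * indicator (cball 0 R) x"
proof -
  note C = test_fun_C1_deriv[OF assms]
  obtain R0 where R0: "\<And>x. \<phi> x \<noteq> 0 \<Longrightarrow> norm x \<le> R0"
    using assms by (auto simp: bounded_iff test_fun_def)
  define R where "R = max 0 R0"
  have R: "\<phi> x = 0" if "norm x > R" for x using R0[of x] that by (auto simp: R_def)
  have D0: "pderiv2 \<phi> i x = 0" if "norm x > R" for i x
  proof -
    have "((\<lambda>_. 0) has_derivative (\<lambda>_. 0)) (at x)" by simp
    then have "(\<phi> has_derivative (\<lambda>_. 0)) (at x)"
      by (rule has_derivative_transform_within_open[where s = "{x. norm x > R}"])
        (use R that in \<open>auto intro!: open_Collect_less continuous_intros\<close>)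
    from frechet_derivative_at[OF this] have "frechet_derivative \<phi> (at x) = (\<lambda>_. 0)" by simp
    then show ?thesis by (simp add: pderiv2_def)
  qed
  have "\<exists>B. \<forall>x. norm x \<le> R \<longrightarrow> \<bar>f x\<bar> \<le> B" if "continuous_on UNIV f" for f :: "real^2 \<Rightarrow> real"
  proof -
    have "compact (f ` cball 0 R)"
      by (intro compact_continuous_image continuous_on_subset[OF that]) auto
    then show ?thesis by (fastforce dest!: compact_imp_bounded simp: bounded_iff)
  qed
  from this[OF C1_deriv_continuous[OF C]] this[OF C1_deriv_continuous_deriv[OF C]]
  obtain B0 B where B: "\<And>x. norm x \<le> R \<Longrightarrow> \<bar>\<phi> x\<bar> \<le> B0" "\<And>i x. norm x \<le> R \<Longrightarrow> \<bar>pderiv2 \<phi> i x\<bar> \<le> B i"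
    by metis
  define M where "M = Max {B0, B 1, B 2}"
  have M: "B0 \<le> M" "B i \<le> M" for i using exhaust_2[of i] by (auto simp: M_def)
  have "0 \<le> M" using B(1)[of 0] M(1) by (auto simp: R_def)
  show ?thesis
  proof (rule that[of R M])
    show "\<bar>\<phi> x\<bar> \<le> M * indicator (cball 0 R) x" for x
      using R[of x] B(1)[of x] M(1) by (cases "norm x \<le> R") auto
    show "\<bar>pderiv2 \<phi> i x\<bar> \<le> M * indicator (cball 0 R) x" for i x
      using D0[of x] B(2)[of x i] M(2)[of i] by (cases "norm x \<le> R") auto
  qed (use \<open>0 \<le> M\<close> in \<open>auto simp: R_def\<close>)
qed

lemma test_fun_measurable:
  assumes "test_fun \<phi>"
  shows "\<phi> \<in> borel_measurable borel" "pderiv2 \<phi> i \<in> borel_measurable borel"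
  using C1_deriv_continuous[OF test_fun_C1_deriv[OF assms]] C1_deriv_continuous_deriv[OF test_fun_C1_deriv[OF assms]]
  by (auto intro: borel_measurable_continuous_onI)

section \<open>Bounded compactly supported factors against square integrable ones\<close>

lemma integrable_indicator_cball: "integrable lborel (\<lambda>x::real^2. c * indicator (cball 0 R) x :: real)"
proof -
  have "integrable lborel (\<lambda>x::real^2. indicator (cball 0 R) x *\<^sub>R c)"
    by (intro borel_integrable_compact) auto
  then show ?thesis by (simp add: mult.commute)
qed

lemma abs_le_1_plus_power2: "\<bar>y\<bar> \<le> 1 + y\<^sup>2" for y :: real
proof -
  have "0 \<le> (\<bar>y\<bar> - 1)\<^sup>2" by simp
  then show ?thesis unfolding power2_diff by (simp add: algebra_simps)
qed

text \<open>The crude bound |y| \<le> 1 + y^2 replaces Cauchy-Schwarz. What matters is that the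
  estimate is linear in \<open>C\<close>, which is later proportional to a translation
  length.\<close>

lemma integrable_compact_mult_L2:
  fixes w \<gamma> :: "real^2 \<Rightarrow> real"
  assumes [measurable]: "w \<in> borel_measurable borel" "\<gamma> \<in> borel_measurable borel"
    and w: "\<And>x. \<bar>w x\<bar> \<le> C * indicator (cball 0 R) x"
    and \<gamma>: "integrable lborel (\<lambda>x. (\<gamma> x)\<^sup>2)"
  shows "integrable lborel (\<lambda>x. w x * \<gamma> x)"
    and "(\<integral>x. \<bar>w x * \<gamma> x\<bar> \<partial>lborel)
      \<le> \<bar>C\<bar> * ((\<integral>x. indicator (cball 0 R) (x::real^2) \<partial>lborel) + (\<integral>x. (\<gamma> x)\<^sup>2 \<partial>lborel))"
proof -
  have bd: "\<bar>w x * \<gamma> x\<bar> \<le> \<bar>C\<bar> * indicator (cball 0 R) x + \<bar>C\<bar> * (\<gamma> x)\<^sup>2" for x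
  proof -
    have "\<bar>w x * \<gamma> x\<bar> \<le> (\<bar>C\<bar> * indicator (cball 0 R) x) * (1 + (\<gamma> x)\<^sup>2)"
      unfolding abs_mult
      by (intro mult_mono abs_le_1_plus_power2 order_trans[OF w mult_right_mono[OF abs_ge_self]]) auto
    also have "\<dots> \<le> \<bar>C\<bar> * indicator (cball 0 R) x + \<bar>C\<bar> * (\<gamma> x)\<^sup>2"
      by (auto simp: indicator_def algebra_simps)
    finally show ?thesis .
  qed
  note ib = integrable_indicator_cball[of "\<bar>C\<bar>" R] integrable_mult_right[OF \<gamma>, of "\<bar>C\<bar>"]
  show i: "integrable lborel (\<lambda>x. w x * \<gamma> x)"
    by (rule Bochner_Integration.integrable_bound[OF Bochner_Integration.integrable_add[OF ib]])
      (simp, unfold real_norm_def, intro AE_I2 order_trans[OF bd abs_ge_self])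
  have "(\<integral>x. \<bar>w x * \<gamma> x\<bar> \<partial>lborel) \<le> (\<integral>x. \<bar>C\<bar> * indicator (cball 0 R) x + \<bar>C\<bar> * (\<gamma> x)\<^sup>2 \<partial>lborel)"
    by (intro integral_mono integrable_abs i Bochner_Integration.integrable_add ib bd)
  also have "\<dots> = \<bar>C\<bar> * ((\<integral>x. indicator (cball 0 R) (x::real^2) \<partial>lborel) + (\<integral>x. (\<gamma> x)\<^sup>2 \<partial>lborel))"
    by (subst Bochner_Integration.integral_add[OF ib]) (simp add: algebra_simps)
  finally show "(\<integral>x. \<bar>w x * \<gamma> x\<bar> \<partial>lborel)
      \<le> \<bar>C\<bar> * ((\<integral>x. indicator (cball 0 R) (x::real^2) \<partial>lborel) + (\<integral>x. (\<gamma> x)\<^sup>2 \<partial>lborel))" .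
qed

text \<open>The hypothesis of Fubini's theorem for averages over translations: the inner integral of
  the absolute value is bounded uniformly in t, because translating \<open>\<gamma>\<close> keeps
  its L^2 norm.\<close>

lemma integrable_pair_shift:
  fixes w \<gamma> :: "real^2 \<Rightarrow> real" and v :: "real^2" and h :: real
  assumes [measurable]: "w \<in> borel_measurable borel" "\<gamma> \<in> borel_measurable borel"
    and w: "\<And>x. \<bar>w x\<bar> \<le> C * indicator (cball 0 R) x"
    and \<gamma>: "integrable lborel (\<lambda>x. (\<gamma> x)\<^sup>2)"
  shows "integrable (lborel \<Otimes>\<^sub>M lborel) (\<lambda>(t, x). indicator {0..h} t * (w x * \<gamma> (x + t *\<^sub>R v)))"
proof (rule lborel_pair.Fubini_integrable)
  let ?f = "\<lambda>(t, x). indicator {0..h} t * (w x * \<gamma> (x + t *\<^sub>R v)) :: real"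
  let ?B = "\<bar>C\<bar> * ((\<integral>x. indicator (cball 0 R) (x::real^2) \<partial>lborel) + (\<integral>x. (\<gamma> x)\<^sup>2 \<partial>lborel))"
  show m[measurable]: "?f \<in> borel_measurable (lborel \<Otimes>\<^sub>M lborel)" by measurable
  have sh: "integrable lborel (\<lambda>x. (\<gamma> (x + t *\<^sub>R v))\<^sup>2)" for t
    by (rule integrable_shift[OF \<gamma>])
  have sh2: "(\<integral>x. (\<gamma> (x + t *\<^sub>R v))\<^sup>2 \<partial>lborel) = (\<integral>x. (\<gamma> x)\<^sup>2 \<partial>lborel)" for t
    by (rule integral_shift) measurable
  have i: "integrable lborel (\<lambda>x. w x * \<gamma> (x + t *\<^sub>R v))" for t
    by (rule integrable_compact_mult_L2(1)[OF _ _ w sh]) measurable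
  have b: "(\<integral>x. \<bar>w x * \<gamma> (x + t *\<^sub>R v)\<bar> \<partial>lborel) \<le> ?B" for t
    using integrable_compact_mult_L2(2)[OF _ _ w sh[of t]] unfolding sh2 by simp
  have "0 \<le> ?B"
    using b[of 0] by (rule order_trans[rotated]) (rule Bochner_Integration.integral_nonneg, simp)
  show "AE t in lborel. integrable lborel (\<lambda>x. ?f (t, x))"
    using i by auto
  show "integrable lborel (\<lambda>t. \<integral>x. norm (?f (t, x)) \<partial>lborel)"
  proof (rule Bochner_Integration.integrable_bound)
    show "integrable lborel (\<lambda>t::real. indicator {0..h} t * ?B)"
      by (intro integrable_mult_left integrable_real_indicator) (auto simp: emeasure_lborel_Icc_eq)
    have "(\<lambda>t. \<integral>x. norm (case (t, x) of (t, x) \<Rightarrow> indicator {0..h} t * (w x * \<gamma> (x + t *\<^sub>R v))) \<partial>lborel) \<in> borel_measurable lborel"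
      by measurable
    then show "(\<lambda>t. \<integral>x. norm (?f (t, x)) \<partial>lborel) \<in> borel_measurable lborel" .
    show "AE t in lborel. norm (\<integral>x. norm (?f (t, x)) \<partial>lborel) \<le> norm (indicator {0..h} t * ?B)"
    proof (rule AE_I2)
      fix t :: real
      show "norm (\<integral>x. norm (?f (t, x)) \<partial>lborel) \<le> norm (indicator {0..h} t * ?B)"
        using b[of t] by (cases "t \<in> {0..h}") (auto intro: order_trans[OF _ abs_ge_self])
    qed
  qed
qed

text \<open>Scalar counterpart of \<open>weak_pderiv\<close> for single components; measurability
  and square integrability of \<open>\<gamma>\<close> are separate hypotheses of the lemmas.\<close>

definition weak_deriv :: "(real^2 \<Rightarrow> real) \<Rightarrow> 2 \<Rightarrow> (real^2 \<Rightarrow> real) \<Rightarrow> bool" where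
  "weak_deriv u i \<gamma> \<longleftrightarrow> (\<forall>\<phi>. test_fun \<phi> \<longrightarrow>
     (\<integral>x. pderiv2 \<phi> i x * u x \<partial>lborel) = - (\<integral>x. \<phi> x * \<gamma> x \<partial>lborel))"

text \<open>A fundamental theorem of calculus along lines. Testing the right side against
  \<open>\<phi>\<close> and exchanging integrals moves the translation onto \<open>\<phi>\<close>;
  there the weak derivative applies for each t, and the classical theorem applies in t.\<close>

lemma weak_deriv_increment:
  fixes u \<gamma> :: "real^2 \<Rightarrow> real" and h :: real
  assumes [measurable]: "u \<in> borel_measurable borel" "\<gamma> \<in> borel_measurable borel"
    and u: "\<And>x. \<bar>u x\<bar> \<le> 1"
    and \<gamma>: "integrable lborel (\<lambda>x. (\<gamma> x)\<^sup>2)"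
    and wd: "weak_deriv u i \<gamma>" and h: "0 \<le> h"
  shows "AE x in lborel. u (x + h *\<^sub>R axis i 1) - u x
           = (\<integral>t. indicator {0..h} t * \<gamma> (x + t *\<^sub>R axis i 1) \<partial>lborel)"
proof -
  let ?e = "axis i (1::real) :: real^2"
  define G where "G x = (\<integral>t. indicator {0..h} t * \<gamma> (x + t *\<^sub>R ?e) \<partial>lborel)" for x
  have [measurable]: "G \<in> borel_measurable borel"
    unfolding G_def by measurable
  let ?F = "\<lambda>x. (u (x + h *\<^sub>R ?e) - u x) - G x"
  have wG: "integrable lborel (\<lambda>x. w x * G x)"
    "(\<integral>x. w x * G x \<partial>lborel) = (\<integral>t. indicator {0..h} t * (\<integral>x. w x * \<gamma> (x + t *\<^sub>R ?e) \<partial>lborel) \<partial>lborel)"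
    if [measurable]: "w \<in> borel_measurable borel" and w: "\<And>x. \<bar>w x\<bar> \<le> C * indicator (cball 0 R) x" for w C R
  proof -
    have I: "integrable (lborel \<Otimes>\<^sub>M lborel) (\<lambda>(t, x). indicator {0..h} t * (w x * \<gamma> (x + t *\<^sub>R ?e)))"
      by (rule integrable_pair_shift[OF _ _ w \<gamma>]) auto
    have eq: "(\<integral>t. indicator {0..h} t * (w x * \<gamma> (x + t *\<^sub>R ?e)) \<partial>lborel) = w x * G x" for x
      unfolding G_def by (subst integral_mult_right_zero[symmetric]) (simp add: ac_simps)
    show "integrable lborel (\<lambda>x. w x * G x)"
      using lborel_pair.integrable_snd[OF I] by (simp add: eq)
    show "(\<integral>x. w x * G x \<partial>lborel) = (\<integral>t. indicator {0..h} t * (\<integral>x. w x * \<gamma> (x + t *\<^sub>R ?e) \<partial>lborel) \<partial>lborel)"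
      using lborel_pair.Fubini_integral[OF I] by (simp add: eq)
  qed
  have wu: "integrable lborel (\<lambda>x. w x * f x)"
    if [measurable]: "w \<in> borel_measurable borel" "f \<in> borel_measurable borel"
      and w: "\<And>x. \<bar>w x\<bar> \<le> C * indicator (cball 0 R) x" and f: "\<And>x. \<bar>f x\<bar> \<le> 1" for w f :: "real^2 \<Rightarrow> real" and C R
  proof (rule Bochner_Integration.integrable_bound[OF integrable_indicator_cball[of C R]])
    show "AE x in lborel. norm (w x * f x) \<le> norm (C * indicator (cball 0 R) x)"
    proof (rule AE_I2)
      fix x show "norm (w x * f x) \<le> norm (C * indicator (cball 0 R) x)"
        using mult_mono[OF w[of x] f[of x]] order_trans[OF abs_ge_zero w[of x]]
        unfolding real_norm_def by (intro order_trans[OF _ abs_ge_self]) (simp only: abs_mult abs_ge_zero mult_1_right)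
    qed
  qed simp
  have "AE x in lborel. ?F x = 0"
  proof (rule AE_eq_0_if_test_integrals)
    show "?F \<in> borel_measurable borel" by measurable
    fix R :: real
    let ?w = "\<lambda>x. indicator (cball 0 R) x :: real"
    have "integrable lborel (\<lambda>x. ?w x * u (x + h *\<^sub>R ?e) - ?w x * u x - ?w x * G x)"
      by (intro Bochner_Integration.integrable_diff wu[of _ _ 1 R] wG(1)[of _ 1 R] u) (auto simp: indicator_def)
    then show "integrable lborel (\<lambda>x. ?w x * ?F x)" by (simp add: algebra_simps)
  next
    fix \<phi> assume T: "test_fun \<phi>"
    note [measurable] = test_fun_measurable[OF T]
    obtain R M where R: "0 \<le> R" "0 \<le> M" "\<And>x. \<bar>\<phi> x\<bar> \<le> M * indicator (cball 0 R) x"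
      "\<And>i x. \<bar>pderiv2 \<phi> i x\<bar> \<le> M * indicator (cball 0 R) x"
      using test_fun_bounds[OF T] by metis
    note C = test_fun_C1_deriv[OF T]
    let ?I = "indicator (cball 0 (R + h)) :: real^2 \<Rightarrow> real"
    have zero: "norm (x - t *\<^sub>R ?e) > R" if "t \<in> {0..h}" "norm x > R + h" for t x
    proof -
      have "norm (t *\<^sub>R ?e) \<le> h" using that by (simp add: norm_axis_1)
      then show ?thesis using norm_triangle_ineq2[of x "t *\<^sub>R ?e"] that by linarith
    qed
    have \<phi>0: "\<phi> (x - t *\<^sub>R ?e) = 0" "pderiv2 \<phi> i (x - t *\<^sub>R ?e) = 0" if "t \<in> {0..h}" "norm x > R + h" for t x
      using R(3)[of "x - t *\<^sub>R ?e"] R(4)[of i "x - t *\<^sub>R ?e"] zero[OF that] by auto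
    have d2: "integrable lborel (\<lambda>x. (pderiv2 \<phi> i x)\<^sup>2)"
    proof (rule Bochner_Integration.integrable_bound[OF integrable_indicator_cball[of "M\<^sup>2" R]])
      show "AE x in lborel. norm ((pderiv2 \<phi> i x)\<^sup>2) \<le> norm (M\<^sup>2 * indicator (cball 0 R) x)"
      proof (rule AE_I2)
        fix x show "norm ((pderiv2 \<phi> i x)\<^sup>2) \<le> norm (M\<^sup>2 * indicator (cball 0 R) x)"
          using power_mono[OF R(4)[of i x] abs_ge_zero, of 2] by (auto simp: indicator_def power_mult_distrib)
      qed
    qed simp
    \<comment> \<open>Here the roles are swapped: the translated derivative of \<open>\<phi>\<close>
      is the L^2 factor and \<open>u\<close> the bounded one. The cutoff \<open>?I\<close> makes
      \<open>u\<close> compactly supported and is harmless, since for t in [0, h] the translates of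
      \<open>\<phi>\<close> live in the ball of radius R + h.\<close>
    have I2: "integrable (lborel \<Otimes>\<^sub>M lborel) (\<lambda>(t, x). indicator {0..h} t * ((?I x * u x) * pderiv2 \<phi> i (x + t *\<^sub>R (- ?e))))"
      by (rule integrable_pair_shift[OF _ _ _ d2, where C = 1 and R = "R + h"]) (use u in \<open>auto simp: indicator_def\<close>)
    have shift: "(\<integral>x. \<phi> x * \<gamma> (x + t *\<^sub>R ?e) \<partial>lborel) = - (\<integral>x. (?I x * u x) * pderiv2 \<phi> i (x + t *\<^sub>R (- ?e)) \<partial>lborel)"
      if t: "t \<in> {0..h}" for t
    proof -
      have "(\<integral>x. \<phi> x * \<gamma> (x + t *\<^sub>R ?e) \<partial>lborel) = (\<integral>x. \<phi> (x - t *\<^sub>R ?e) * \<gamma> x \<partial>lborel)"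
        using integral_shift[of "\<lambda>x. \<phi> x * \<gamma> (x + t *\<^sub>R ?e)" "- (t *\<^sub>R ?e)"] by simp
      also have "\<dots> = - (\<integral>x. pderiv2 \<phi> i (x - t *\<^sub>R ?e) * u x \<partial>lborel)"
      proof -
        have C': "C1_deriv (\<lambda>x. \<phi> (x - t *\<^sub>R ?e)) (\<lambda>i x. pderiv2 \<phi> i (x - t *\<^sub>R ?e))"
          using C1_deriv_shift[OF C, of "- (t *\<^sub>R ?e)"] by simp
        have "{x. \<phi> (x - t *\<^sub>R ?e) \<noteq> 0} \<subseteq> cball 0 (R + h)"
          using \<phi>0(1)[OF t] by (force simp: not_le)
        then have B': "bounded {x. \<phi> (x - t *\<^sub>R ?e) \<noteq> 0}"
          using bounded_cball bounded_subset by blast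
        show ?thesis
          using wd C1_deriv_test_fun[OF C' B'] unfolding weak_deriv_def by force
      qed
      also have "(\<integral>x. pderiv2 \<phi> i (x - t *\<^sub>R ?e) * u x \<partial>lborel)
          = (\<integral>x. (?I x * u x) * pderiv2 \<phi> i (x + t *\<^sub>R (- ?e)) \<partial>lborel)"
        by (intro Bochner_Integration.integral_cong refl) (use \<phi>0(2)[OF t] in \<open>auto simp: indicator_def\<close>)
      finally show ?thesis .
    qed
    have FTC: "(\<integral>t. indicator {0..h} t * pderiv2 \<phi> i (x + t *\<^sub>R (- ?e)) \<partial>lborel) = \<phi> x - \<phi> (x - h *\<^sub>R ?e)" for x
    proof -
      have "(\<integral>t. pderiv2 \<phi> i (x + t *\<^sub>R (- ?e)) * indicator {0..h} t \<partial>lborel)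
        = (- \<phi> (x - h *\<^sub>R ?e)) - (- \<phi> (x - 0 *\<^sub>R ?e))"
      proof (rule integral_FTC_Icc_real[OF h])
        fix t
        have "((\<lambda>t. \<phi> (x + (- t) *\<^sub>R ?e)) has_real_derivative - pderiv2 \<phi> i (x + (- t) *\<^sub>R ?e)) (at t)"
          using DERIV_mirror[THEN iffD1, OF C1_deriv_DERIV_line[OF C, of x i "- t"]] by simp
        then show "((\<lambda>t. - \<phi> (x - t *\<^sub>R ?e)) has_real_derivative pderiv2 \<phi> i (x + t *\<^sub>R - ?e)) (at t)"
          using DERIV_minus by fastforce
        have "continuous_on UNIV (\<lambda>t. pderiv2 \<phi> i (x + t *\<^sub>R - ?e))"
          by (intro continuous_on_compose2[OF C1_deriv_continuous_deriv[OF C]] continuous_intros) auto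
        then show "isCont (\<lambda>t. pderiv2 \<phi> i (x + t *\<^sub>R - ?e)) t"
          by (simp add: continuous_on_eq_continuous_at)
      qed
      then show ?thesis by (simp add: mult.commute)
    qed
    have "(\<integral>x. \<phi> x * G x \<partial>lborel) = (\<integral>t. indicator {0..h} t * (\<integral>x. \<phi> x * \<gamma> (x + t *\<^sub>R ?e) \<partial>lborel) \<partial>lborel)"
      by (rule wG(2)[OF _ R(3)]) measurable
    also have "\<dots> = (\<integral>t. - (\<integral>x. indicator {0..h} t * ((?I x * u x) * pderiv2 \<phi> i (x + t *\<^sub>R (- ?e))) \<partial>lborel) \<partial>lborel)"
      by (intro Bochner_Integration.integral_cong refl) (auto simp: shift indicator_def)
    also have "\<dots> = - (\<integral>x. (\<integral>t. indicator {0..h} t * ((?I x * u x) * pderiv2 \<phi> i (x + t *\<^sub>R (- ?e))) \<partial>lborel) \<partial>lborel)"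
      using lborel_pair.Fubini_integral[OF I2] by simp
    also have "\<dots> = - (\<integral>x. \<phi> x * u x - \<phi> (x - h *\<^sub>R ?e) * u x \<partial>lborel)"
    proof (intro arg_cong[where f = uminus] Bochner_Integration.integral_cong refl)
      fix x
      have "(\<integral>t. indicator {0..h} t * ((?I x * u x) * pderiv2 \<phi> i (x + t *\<^sub>R (- ?e))) \<partial>lborel)
        = (?I x * u x) * (\<phi> x - \<phi> (x - h *\<^sub>R ?e))"
        unfolding FTC[symmetric] by (subst integral_mult_right_zero[symmetric]) (simp add: ac_simps)
      also have "\<dots> = \<phi> x * u x - \<phi> (x - h *\<^sub>R ?e) * u x"
        using \<phi>0(1)[of 0 x] \<phi>0(1)[of h x] h by (cases "norm x \<le> R + h") (auto simp: algebra_simps)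
      finally show "(\<integral>t. indicator {0..h} t * ((?I x * u x) * pderiv2 \<phi> i (x + t *\<^sub>R (- ?e))) \<partial>lborel)
        = \<phi> x * u x - \<phi> (x - h *\<^sub>R ?e) * u x" .
    qed
    also have "\<dots> = (\<integral>x. \<phi> (x - h *\<^sub>R ?e) * u x \<partial>lborel) - (\<integral>x. \<phi> x * u x \<partial>lborel)"
    proof -
      have a: "integrable lborel (\<lambda>x. \<phi> (x - h *\<^sub>R ?e) * u x)"
        using integrable_shift[OF wu[OF _ _ R(3), of "\<lambda>x. u (x + h *\<^sub>R ?e)"], of "- (h *\<^sub>R ?e)"] u by simp
      show ?thesis using a wu[OF _ _ R(3), of u] u by simp
    qed
    also have "(\<integral>x. \<phi> (x - h *\<^sub>R ?e) * u x \<partial>lborel) = (\<integral>x. \<phi> x * u (x + h *\<^sub>R ?e) \<partial>lborel)"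
      using integral_shift[of "\<lambda>x. \<phi> (x - h *\<^sub>R ?e) * u x" "h *\<^sub>R ?e"] by simp
    finally have "(\<integral>x. \<phi> x * G x \<partial>lborel) = (\<integral>x. \<phi> x * u (x + h *\<^sub>R ?e) \<partial>lborel) - (\<integral>x. \<phi> x * u x \<partial>lborel)" .
    moreover have "(\<integral>x. \<phi> x * ?F x \<partial>lborel)
      = (\<integral>x. \<phi> x * u (x + h *\<^sub>R ?e) \<partial>lborel) - (\<integral>x. \<phi> x * u x \<partial>lborel) - (\<integral>x. \<phi> x * G x \<partial>lborel)"
      using wu[OF _ _ R(3), of u] wu[OF _ _ R(3), of "\<lambda>x. u (x + h *\<^sub>R ?e)"] wG(1)[OF _ R(3)] u
      by (simp add: right_diff_distrib)
    ultimately show "(\<integral>x. \<phi> x * ?F x \<partial>lborel) = 0" by simp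
  qed
  then show ?thesis by (auto simp: G_def)
qed

text \<open>Expand the integral of (f - m / h)^2 over [0, h], where m / h is the mean of f. The
  right side is extended-valued because the lemma is applied on every line, and square integrability
  on each of them is not given.\<close>

lemma nn_integral_indicator_Cauchy_Schwarz:
  fixes f :: "real \<Rightarrow> real" and h :: real
  assumes [measurable]: "f \<in> borel_measurable borel" and h: "0 < h"
  shows "ennreal ((\<integral>t. indicator {0..h} t * f t \<partial>lborel)\<^sup>2)
      \<le> h * (\<integral>\<^sup>+t. ennreal (indicator {0..h} t * (f t)\<^sup>2) \<partial>lborel)"
proof (cases "(\<integral>\<^sup>+t. ennreal (indicator {0..h} t * (f t)\<^sup>2) \<partial>lborel) = \<infinity>")
  case True
  then show ?thesis using h by (simp add: ennreal_mult_top)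
next
  case False
  have i2: "integrable lborel (\<lambda>t. indicator {0..h} t * (f t)\<^sup>2)"
    using False by (intro integrableI_nonneg) (auto simp: top.not_eq_extremum)
  have i0: "integrable lborel (\<lambda>t::real. indicator {0..h} t :: real)"
    by (intro integrable_real_indicator) (auto simp: emeasure_lborel_Icc_eq)
  have i1: "integrable lborel (\<lambda>t. indicator {0..h} t * f t)"
    by (rule Bochner_Integration.integrable_bound[OF Bochner_Integration.integrable_add[OF i0 i2]])
      (auto simp: indicator_def intro!: AE_I2 abs_le_1_plus_power2)
  define m where "m = (\<integral>t. indicator {0..h} t * f t \<partial>lborel)"
  have "0 \<le> (\<integral>t. indicator {0..h} t * (f t - m / h)\<^sup>2 \<partial>lborel)"
    by (rule Bochner_Integration.integral_nonneg) auto
  also have "\<dots> = (\<integral>t. indicator {0..h} t * (f t)\<^sup>2 - (2 * (m / h)) * (indicator {0..h} t * f t)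
      + (m / h)\<^sup>2 * indicator {0..h} t \<partial>lborel)"
    by (intro Bochner_Integration.integral_cong) (auto simp: power2_eq_square algebra_simps)
  also have "\<dots> = (\<integral>t. indicator {0..h} t * (f t)\<^sup>2 \<partial>lborel) - 2 * (m / h) * m + (m / h)\<^sup>2 * h"
    using h by (simp add: i0 i1 i2 m_def)
  also have "\<dots> = (\<integral>t. indicator {0..h} t * (f t)\<^sup>2 \<partial>lborel) - m\<^sup>2 / h"
    using h by (simp add: power2_eq_square field_simps)
  finally have "m\<^sup>2 \<le> h * (\<integral>t. indicator {0..h} t * (f t)\<^sup>2 \<partial>lborel)"
    using h by (simp add: field_simps)
  then have "ennreal (m\<^sup>2) \<le> ennreal h * ennreal (\<integral>t. indicator {0..h} t * (f t)\<^sup>2 \<partial>lborel)"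
    using h by (subst ennreal_mult[symmetric]) (auto intro!: ennreal_leI)
  also have "ennreal (\<integral>t. indicator {0..h} t * (f t)\<^sup>2 \<partial>lborel) = (\<integral>\<^sup>+t. ennreal (indicator {0..h} t * (f t)\<^sup>2) \<partial>lborel)"
    by (rule nn_integral_eq_integral[OF i2, symmetric]) auto
  finally show ?thesis by (simp add: m_def)
qed

text \<open>Cauchy-Schwarz on [0, h] gives one factor h; Tonelli and translation invariance give the
  other.\<close>

lemma weak_deriv_increment_L2:
  fixes u \<gamma> :: "real^2 \<Rightarrow> real" and h :: real
  assumes [measurable]: "u \<in> borel_measurable borel" "\<gamma> \<in> borel_measurable borel"
    and u: "\<And>x. \<bar>u x\<bar> \<le> 1"
    and \<gamma>: "integrable lborel (\<lambda>x. (\<gamma> x)\<^sup>2)"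
    and wd: "weak_deriv u i \<gamma>" and h: "0 < h"
  shows "integrable lborel (\<lambda>x. (u (x + h *\<^sub>R axis i 1) - u x)\<^sup>2)"
    and "(\<integral>x. (u (x + h *\<^sub>R axis i 1) - u x)\<^sup>2 \<partial>lborel) \<le> h\<^sup>2 * (\<integral>x. (\<gamma> x)\<^sup>2 \<partial>lborel)"
proof -
  let ?e = "axis i (1::real) :: real^2"
  let ?d = "\<lambda>x. (u (x + h *\<^sub>R ?e) - u x)\<^sup>2"
  have "(\<integral>\<^sup>+x. ?d x \<partial>lborel) = (\<integral>\<^sup>+x. ennreal ((\<integral>t. indicator {0..h} t * \<gamma> (x + t *\<^sub>R ?e) \<partial>lborel)\<^sup>2) \<partial>lborel)"
    by (intro nn_integral_cong_AE, use weak_deriv_increment[OF assms(1-5) less_imp_le[OF h]] in eventually_elim) simp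
  also have "\<dots> \<le> (\<integral>\<^sup>+x. h * (\<integral>\<^sup>+t. ennreal (indicator {0..h} t * (\<gamma> (x + t *\<^sub>R ?e))\<^sup>2) \<partial>lborel) \<partial>lborel)"
    by (intro nn_integral_mono nn_integral_indicator_Cauchy_Schwarz h) measurable
  also have "\<dots> = h * (\<integral>\<^sup>+x. (\<integral>\<^sup>+t. ennreal (indicator {0..h} t * (\<gamma> (x + t *\<^sub>R ?e))\<^sup>2) \<partial>lborel) \<partial>lborel)"
    by (rule nn_integral_cmult) measurable
  also have "(\<integral>\<^sup>+x. (\<integral>\<^sup>+t. ennreal (indicator {0..h} t * (\<gamma> (x + t *\<^sub>R ?e))\<^sup>2) \<partial>lborel) \<partial>lborel)
      = (\<integral>\<^sup>+t. (\<integral>\<^sup>+x. ennreal (indicator {0..h} t * (\<gamma> (x + t *\<^sub>R ?e))\<^sup>2) \<partial>lborel) \<partial>lborel)"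
    by (rule lborel_pair.Fubini') measurable
  also have "\<dots> = (\<integral>\<^sup>+t. (\<integral>\<^sup>+x. (\<gamma> x)\<^sup>2 \<partial>lborel) * indicator {0..h} t \<partial>lborel)"
  proof (intro nn_integral_cong)
    fix t :: real
    have "(\<integral>\<^sup>+x. ennreal ((\<gamma> (x + t *\<^sub>R ?e))\<^sup>2) \<partial>lborel) = (\<integral>\<^sup>+x. (\<gamma> x)\<^sup>2 \<partial>lborel)"
      by (rule nn_integral_shift) measurable
    then show "(\<integral>\<^sup>+x. ennreal (indicator {0..h} t * (\<gamma> (x + t *\<^sub>R ?e))\<^sup>2) \<partial>lborel)
       = (\<integral>\<^sup>+x. (\<gamma> x)\<^sup>2 \<partial>lborel) * indicator {0..h} t" by (simp add: indicator_def)
  qed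
  also have "\<dots> = (\<integral>\<^sup>+x. (\<gamma> x)\<^sup>2 \<partial>lborel) * h"
    using h by (subst nn_integral_cmult_indicator) auto
  also have "(\<integral>\<^sup>+x. (\<gamma> x)\<^sup>2 \<partial>lborel) = ennreal (\<integral>x. (\<gamma> x)\<^sup>2 \<partial>lborel)"
    by (rule nn_integral_eq_integral[OF \<gamma>]) auto
  also have "h * (ennreal (\<integral>x. (\<gamma> x)\<^sup>2 \<partial>lborel) * h) = ennreal (h\<^sup>2 * (\<integral>x. (\<gamma> x)\<^sup>2 \<partial>lborel))"
    using h by (simp add: ennreal_mult[symmetric] power2_eq_square ac_simps)
  finally have le: "(\<integral>\<^sup>+x. ?d x \<partial>lborel) \<le> ennreal (h\<^sup>2 * (\<integral>x. (\<gamma> x)\<^sup>2 \<partial>lborel))" .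
  show i: "integrable lborel ?d"
    by (intro integrableI_nonneg) (auto intro: le_less_trans[OF le])
  have "ennreal (\<integral>x. ?d x \<partial>lborel) \<le> ennreal (h\<^sup>2 * (\<integral>x. (\<gamma> x)\<^sup>2 \<partial>lborel))"
    using le nn_integral_eq_integral[OF i] by simp
  then show "(\<integral>x. ?d x \<partial>lborel) \<le> h\<^sup>2 * (\<integral>x. (\<gamma> x)\<^sup>2 \<partial>lborel)"
    by (subst (asm) ennreal_le_iff) (auto intro!: mult_nonneg_nonneg Bochner_Integration.integral_nonneg)
qed

lemma test_fun_increment:
  assumes "test_fun \<phi>" and M: "\<And>x. \<bar>pderiv2 \<phi> i x\<bar> \<le> M" and t: "0 \<le> t"
  shows "\<bar>\<phi> (x + t *\<^sub>R axis i 1) - \<phi> x\<bar> \<le> M * t"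
proof (cases "t = 0")
  case False
  let ?e = "axis i (1::real) :: real^2"
  obtain z where "\<phi> (x + t *\<^sub>R ?e) - \<phi> (x + 0 *\<^sub>R ?e) = (t - 0) * pderiv2 \<phi> i (x + z *\<^sub>R ?e)"
    using MVT2[of 0 t "\<lambda>t. \<phi> (x + t *\<^sub>R ?e)" "\<lambda>t. pderiv2 \<phi> i (x + t *\<^sub>R ?e)"] t False
      C1_deriv_DERIV_line[OF test_fun_C1_deriv[OF assms(1)], of x i] by force
  then show ?thesis
    using mult_left_mono[OF M t, of "x + z *\<^sub>R ?e"] t by (simp add: abs_mult mult.commute)
qed simp

lemma abs_mult_le_weighted_squares:
  fixes a b t :: real
  assumes "0 < t"
  shows "\<bar>a * b\<bar> \<le> a\<^sup>2 / (2 * t) + t / 2 * b\<^sup>2"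
proof -
  have "0 \<le> (\<bar>a\<bar> - t * \<bar>b\<bar>)\<^sup>2" by simp
  also have "\<dots> = a\<^sup>2 + t\<^sup>2 * b\<^sup>2 - 2 * t * \<bar>a * b\<bar>"
    unfolding power2_diff by (simp add: power_mult_distrib abs_mult)
  finally show ?thesis using assms by (simp add: field_simps power2_eq_square)
qed

text \<open>The first integral equals the integral of \<open>\<kappa>\<close> over [0, h], so an
  error of order h^2 amounts to |\<kappa>(t) - \<kappa>(0)| \<le> K t. Translates of an L^2 function
  \<open>\<gamma>\<close> converge without such a rate; the increment is therefore moved onto
  \<open>\<phi> x * u x\<close>, where \<open>\<phi>\<close> is Lipschitz and \<open>u\<close> has
  increments of order t in L^2.\<close>

lemma weak_deriv_first_order:
  fixes u \<gamma> \<phi> :: "real^2 \<Rightarrow> real"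
  assumes [measurable]: "u \<in> borel_measurable borel" "\<gamma> \<in> borel_measurable borel"
    and u: "\<And>x. \<bar>u x\<bar> \<le> 1"
    and \<gamma>: "integrable lborel (\<lambda>x. (\<gamma> x)\<^sup>2)"
    and wd: "weak_deriv u i \<gamma>" and T: "test_fun \<phi>"
  obtains K where "0 \<le> K" "\<And>h. 0 < h \<Longrightarrow> h \<le> 1 \<Longrightarrow>
    \<bar>(\<integral>x. \<phi> x * u x * (u (x + h *\<^sub>R axis i 1) - u x) \<partial>lborel) - h * (\<integral>x. \<phi> x * u x * \<gamma> x \<partial>lborel)\<bar> \<le> K * h\<^sup>2"
proof -
  let ?e = "axis i (1::real) :: real^2"
  note [measurable] = test_fun_measurable[OF T]
  obtain R M where R: "0 \<le> R" "0 \<le> M" "\<And>x. \<bar>\<phi> x\<bar> \<le> M * indicator (cball 0 R) x"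
    "\<And>i x. \<bar>pderiv2 \<phi> i x\<bar> \<le> M * indicator (cball 0 R) x"
    using test_fun_bounds[OF T] by metis
  have M: "\<bar>\<phi> x\<bar> \<le> M" "\<bar>pderiv2 \<phi> i x\<bar> \<le> M" for x
    using R(2) R(3)[of x] R(4)[of i x] by (cases "norm x \<le> R"; simp)+
  define \<psi> where "\<psi> x = \<phi> x * u x" for x
  have [measurable]: "\<psi> \<in> borel_measurable borel" unfolding \<psi>_def by measurable
  have \<psi>: "\<bar>\<psi> x\<bar> \<le> M * indicator (cball 0 R) x" for x
    using mult_mono[OF R(3)[of x] u[of x]] order_trans[OF abs_ge_zero R(3)[of x]] by (simp add: \<psi>_def abs_mult)
  define A where "A = (\<integral>x. indicator (cball 0 (R + 1)) (x::real^2) \<partial>lborel :: real)"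
  define g where "g = (\<integral>x. (\<gamma> x)\<^sup>2 \<partial>lborel)"
  have A: "0 \<le> A" "0 \<le> g" by (auto simp: A_def g_def intro!: Bochner_Integration.integral_nonneg)
  have sh: "integrable lborel (\<lambda>x. (\<gamma> (x + t *\<^sub>R ?e))\<^sup>2)" for t
    by (rule integrable_shift[OF \<gamma>])
  have sh2: "(\<integral>x. (\<gamma> (x + t *\<^sub>R ?e))\<^sup>2 \<partial>lborel) = g" for t
    unfolding g_def by (rule integral_shift) measurable
  define \<kappa> where "\<kappa> t = (\<integral>x. \<psi> x * \<gamma> (x + t *\<^sub>R ?e) \<partial>lborel)" for t
  have i\<kappa>: "integrable lborel (\<lambda>x. \<psi> x * \<gamma> (x + t *\<^sub>R ?e))" for t
    by (rule integrable_compact_mult_L2(1)[OF _ _ \<psi> sh]) measurable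
  have [measurable]: "\<kappa> \<in> borel_measurable borel"
    unfolding \<kappa>_def by measurable
  define K where "K = M * (A + g) + M * g"
  have K0: "0 \<le> K" using A R(2) by (simp add: K_def)
  have \<kappa>: "\<bar>\<kappa> t - \<kappa> 0\<bar> \<le> K * t" if t: "0 < t" "t \<le> 1" for t
  proof -
    let ?y = "\<lambda>x. x + t *\<^sub>R ?e"
    \<comment> \<open>Translating the whole integrand puts the same factor
      \<open>\<gamma> (?y x)\<close> into both integrals.\<close>
    have "\<kappa> 0 = (\<integral>x. \<psi> (?y x) * \<gamma> (?y x) \<partial>lborel)"
      unfolding \<kappa>_def by (subst integral_shift[where f = "\<lambda>x. \<psi> x * \<gamma> x"]) simp_all
    moreover have iy: "integrable lborel (\<lambda>x. \<psi> (?y x) * \<gamma> (?y x))"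
      using integrable_shift[OF i\<kappa>[of 0], of "t *\<^sub>R ?e"] by simp
    ultimately have eq: "\<kappa> t - \<kappa> 0 = (\<integral>x. \<psi> x * \<gamma> (?y x) - \<psi> (?y x) * \<gamma> (?y x) \<partial>lborel)"
      unfolding \<kappa>_def using i\<kappa>[of t] by simp
    let ?w = "\<lambda>x. (\<phi> x - \<phi> (?y x)) * u (?y x)"
    let ?d = "\<lambda>x. (u (?y x) - u x)\<^sup>2"
    have w: "\<bar>?w x\<bar> \<le> M * t * indicator (cball 0 (R + 1)) x" for x
    proof (cases "norm x \<le> R + 1")
      case True
      have "\<bar>?w x\<bar> \<le> M * t * 1"
        unfolding abs_mult using test_fun_increment[OF T M(2), of t x] t u[of "?y x"]
        by (intro mult_mono) auto
      then show ?thesis using True by simp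
    next
      case False
      have "norm (t *\<^sub>R ?e) \<le> 1" using t by (simp add: norm_axis_1)
      then have "norm (?y x) > R"
        using norm_triangle_ineq2[of x "- (t *\<^sub>R ?e)"] False by simp
      then show ?thesis using R(3)[of x] R(3)[of "?y x"] False by simp
    qed
    have [measurable]: "?w \<in> borel_measurable borel" by measurable
    have iw: "integrable lborel (\<lambda>x. ?w x * \<gamma> (?y x))"
      by (rule integrable_compact_mult_L2(1)[OF _ _ w sh]) measurable
    have bw: "(\<integral>x. \<bar>?w x * \<gamma> (?y x)\<bar> \<partial>lborel) \<le> M * t * (A + g)"
      using integrable_compact_mult_L2(2)[OF _ _ w sh[of t]] abs_of_nonneg[of "M * t"] R(2) t
      unfolding sh2 A_def by simp
    note id = weak_deriv_increment_L2[OF assms(1-5) t(1)]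
    \<comment> \<open>The weight t in Young's inequality balances the two terms: the squared
      increment integrates to at most t^2 g, so both contributions are of order t.\<close>
    have pt: "\<bar>\<psi> x * \<gamma> (?y x) - \<psi> (?y x) * \<gamma> (?y x)\<bar>
      \<le> \<bar>?w x * \<gamma> (?y x)\<bar> + (M / (2 * t) * ?d x + M * t / 2 * (\<gamma> (?y x))\<^sup>2)" for x
    proof -
      have "\<psi> x * \<gamma> (?y x) - \<psi> (?y x) * \<gamma> (?y x) = ?w x * \<gamma> (?y x) - \<phi> x * ((u (?y x) - u x) * \<gamma> (?y x))"
        by (simp add: \<psi>_def algebra_simps)
      then have "\<bar>\<psi> x * \<gamma> (?y x) - \<psi> (?y x) * \<gamma> (?y x)\<bar> \<le> \<bar>?w x * \<gamma> (?y x)\<bar> + \<bar>\<phi> x\<bar> * \<bar>(u (?y x) - u x) * \<gamma> (?y x)\<bar>"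
        using abs_triangle_ineq4[of "?w x * \<gamma> (?y x)" "\<phi> x * ((u (?y x) - u x) * \<gamma> (?y x))"] by (simp only: abs_mult)
      also have "\<bar>\<phi> x\<bar> * \<bar>(u (?y x) - u x) * \<gamma> (?y x)\<bar> \<le> M * (?d x / (2 * t) + t / 2 * (\<gamma> (?y x))\<^sup>2)"
      proof (intro mult_mono M)
        show "\<bar>(u (?y x) - u x) * \<gamma> (?y x)\<bar> \<le> ?d x / (2 * t) + t / 2 * (\<gamma> (?y x))\<^sup>2"
          by (rule abs_mult_le_weighted_squares[OF t(1)])
      qed (use R(2) in auto)
      finally show ?thesis by (simp add: algebra_simps)
    qed
    have "\<bar>\<kappa> t - \<kappa> 0\<bar> \<le> (\<integral>x. \<bar>\<psi> x * \<gamma> (?y x) - \<psi> (?y x) * \<gamma> (?y x)\<bar> \<partial>lborel)"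
      unfolding eq by (rule integral_abs_bound)
    also have "\<dots> \<le> (\<integral>x. \<bar>?w x * \<gamma> (?y x)\<bar> + (M / (2 * t) * ?d x + M * t / 2 * (\<gamma> (?y x))\<^sup>2) \<partial>lborel)"
      by (intro integral_mono pt integrable_abs Bochner_Integration.integrable_diff Bochner_Integration.integrable_add
         i\<kappa> iy iw integrable_mult_right id sh)
    also have "\<dots> = (\<integral>x. \<bar>?w x * \<gamma> (?y x)\<bar> \<partial>lborel) + (M / (2 * t) * (\<integral>x. ?d x \<partial>lborel) + M * t / 2 * g)"
      using iw id(1) sh[of t] by (simp add: sh2)
    also have "\<dots> \<le> M * t * (A + g) + (M / (2 * t) * (t\<^sup>2 * g) + M * t / 2 * g)"
      using id(2) R(2) t unfolding g_def[symmetric] by (intro add_mono bw mult_left_mono) auto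
    also have "\<dots> = K * t"
      using t by (simp add: K_def power2_eq_square field_simps)
    finally show ?thesis .
  qed
  show ?thesis
  proof (rule that[OF K0])
    fix h :: real assume h: "0 < h" "h \<le> 1"
    have I: "integrable (lborel \<Otimes>\<^sub>M lborel) (\<lambda>(t, x). indicator {0..h} t * (\<psi> x * \<gamma> (x + t *\<^sub>R ?e)))"
      by (rule integrable_pair_shift[OF _ _ \<psi> \<gamma>]) auto
    have "(\<integral>x. \<psi> x * (u (x + h *\<^sub>R ?e) - u x) \<partial>lborel)
      = (\<integral>x. \<psi> x * (\<integral>t. indicator {0..h} t * \<gamma> (x + t *\<^sub>R ?e) \<partial>lborel) \<partial>lborel)"
      by (intro integral_cong_AE, measurable, use weak_deriv_increment[OF assms(1-5) less_imp_le[OF h(1)]] in eventually_elim) simp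
    also have "\<dots> = (\<integral>x. (\<integral>t. indicator {0..h} t * (\<psi> x * \<gamma> (x + t *\<^sub>R ?e)) \<partial>lborel) \<partial>lborel)"
      by (intro Bochner_Integration.integral_cong refl, subst integral_mult_right_zero[symmetric]) (simp add: ac_simps)
    also have "\<dots> = (\<integral>t. indicator {0..h} t * \<kappa> t \<partial>lborel)"
      using lborel_pair.Fubini_integral[OF I] by (simp add: \<kappa>_def)
    finally have S: "(\<integral>x. \<psi> x * (u (x + h *\<^sub>R ?e) - u x) \<partial>lborel) = (\<integral>t. indicator {0..h} t * \<kappa> t \<partial>lborel)" .
    have i\<kappa>h: "integrable lborel (\<lambda>t. indicator {0..h} t * \<kappa> t)"
      using lborel_pair.integrable_fst[OF I] by (simp add: \<kappa>_def)
    have ih: "integrable lborel (\<lambda>t::real. indicator {0..h} t * c :: real)" for c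
      by (intro integrable_mult_left integrable_real_indicator) (auto simp: emeasure_lborel_Icc_eq)
    have vh: "(\<integral>t. indicator {0..h} t * c \<partial>(lborel :: real measure)) = h * c" for c :: real
      using h by (simp add: measure_def)
    have "\<bar>(\<integral>t. indicator {0..h} t * \<kappa> t \<partial>lborel) - h * \<kappa> 0\<bar>
      = \<bar>\<integral>t. indicator {0..h} t * \<kappa> t - indicator {0..h} t * \<kappa> 0 \<partial>lborel\<bar>"
      using i\<kappa>h ih[of "\<kappa> 0"] by (simp only: Bochner_Integration.integral_diff vh)
    also have "\<dots> \<le> (\<integral>t. \<bar>indicator {0..h} t * \<kappa> t - indicator {0..h} t * \<kappa> 0\<bar> \<partial>lborel)"
      by (rule integral_abs_bound)
    also have "\<dots> \<le> (\<integral>t. indicator {0..h} t * (K * h) \<partial>lborel)"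
    proof (intro integral_mono integrable_abs Bochner_Integration.integrable_diff i\<kappa>h ih)
      fix t :: real
      have "\<bar>\<kappa> t - \<kappa> 0\<bar> \<le> K * h" if "0 \<le> t" "t \<le> h"
      proof (cases "t = 0")
        case False
        then have "\<bar>\<kappa> t - \<kappa> 0\<bar> \<le> K * t" using that h by (intro \<kappa>) auto
        also have "\<dots> \<le> K * h" using that K0 by (intro mult_left_mono) auto
        finally show ?thesis .
      qed (use K0 h in simp)
      then show "\<bar>indicator {0..h} t * \<kappa> t - indicator {0..h} t * \<kappa> 0\<bar> \<le> indicator {0..h} t * (K * h)"
        by (auto simp: indicator_def)
    qed
    also have "\<dots> = K * h\<^sup>2" by (simp only: vh) (simp add: power2_eq_square)
    finally show "\<bar>(\<integral>x. \<phi> x * u x * (u (x + h *\<^sub>R ?e) - u x) \<partial>lborel) - h * (\<integral>x. \<phi> x * u x * \<gamma> x \<partial>lborel)\<bar> \<le> K * h\<^sup>2"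
      using S by (simp add: \<psi>_def \<kappa>_def)
  qed
qed

section \<open>Tangentiality of weak derivatives\<close>

lemma integrable_test_fun_mult_bounded:
  assumes T: "test_fun \<phi>" and [measurable]: "f \<in> borel_measurable borel" and f: "\<And>x. \<bar>f x\<bar> \<le> B"
  shows "integrable lborel (\<lambda>x. \<phi> x * f x :: real)"
proof -
  note [measurable] = test_fun_measurable[OF T]
  obtain R M where R: "\<And>x. \<bar>\<phi> x\<bar> \<le> M * indicator (cball 0 R) x"
    using test_fun_bounds[OF T] by metis
  show ?thesis
  proof (rule Bochner_Integration.integrable_bound[OF integrable_indicator_cball[of "M * B" R]])
    show "AE x in lborel. norm (\<phi> x * f x) \<le> norm (M * B * indicator (cball 0 R) x)"
    proof (rule AE_I2)
      fix x
      have "\<bar>\<phi> x * f x\<bar> \<le> (M * indicator (cball 0 R) x) * B"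
        unfolding abs_mult by (intro mult_mono R f) (use R[of x] in auto)
      then show "norm (\<phi> x * f x) \<le> norm (M * B * indicator (cball 0 R) x)"
        by (simp add: mult_ac)
    qed
  qed simp
qed

lemma borel_measurable_vec_nth[measurable (raw)]:
  fixes f :: "'a \<Rightarrow> real^'n"
  assumes "f \<in> borel_measurable M"
  shows "(\<lambda>x. f x $ j) \<in> borel_measurable M"
  using assms by (rule measurable_compose) (intro borel_measurable_continuous_onI continuous_intros)

lemma energy_spaceD:
  assumes "energy_space n Dn"
  shows "n \<in> borel_measurable borel" "Dn i \<in> borel_measurable borel" "norm (n x) = 1"
    and "integrable lborel (\<lambda>x. (norm (Dn i x))\<^sup>2)" "integrable lborel (\<lambda>x. (Dn i x $ j)\<^sup>2)"
    and "integrable lborel (\<lambda>x. (1 - n x $ 3)\<^sup>2)"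
proof -
  show [measurable]: "n \<in> borel_measurable borel" and m[measurable]: "Dn i \<in> borel_measurable borel" for i
    using assms by (auto simp: energy_space_def weak_pderiv_def)
  show "norm (n x) = 1" "integrable lborel (\<lambda>x. (1 - n x $ 3)\<^sup>2)"
    using assms by (auto simp: energy_space_def)
  have i: "integrable lborel (\<lambda>x. \<Sum>i\<in>UNIV. (norm (Dn i x))\<^sup>2)"
    using assms by (auto simp: energy_space_def)
  show 2: "integrable lborel (\<lambda>x. (norm (Dn i x))\<^sup>2)"
    by (rule Bochner_Integration.integrable_bound[OF i])
      (use exhaust_2[of i] in \<open>auto simp: sum_2 intro!: AE_I2\<close>)
  show "integrable lborel (\<lambda>x. (Dn i x $ j)\<^sup>2)"
  proof (rule Bochner_Integration.integrable_bound[OF 2])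
    show "AE x in lborel. norm ((Dn i x $ j)\<^sup>2) \<le> norm ((norm (Dn i x))\<^sup>2)"
      using component_le_norm_cart[of "Dn i x" j for x] by (auto intro!: AE_I2 simp: abs_le_square_iff[symmetric])
  qed measurable
qed

text \<open>Integrability lets components and sums be taken out of the vector-valued integrals in
  \<open>weak_pderiv\<close>.\<close>

lemma energy_space_integrable_test:
  assumes "energy_space n Dn" and T: "test_fun \<phi>"
  shows "integrable lborel (\<lambda>x. \<phi> x *\<^sub>R Dn i x)" "integrable lborel (\<lambda>x. pderiv2 \<phi> i x *\<^sub>R n x)"
proof -
  note [measurable] = energy_spaceD(1,2)[OF assms(1)] test_fun_measurable[OF T]
  obtain R M where R: "\<And>x. \<bar>\<phi> x\<bar> \<le> M * indicator (cball 0 R) x"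
    "\<And>i x. \<bar>pderiv2 \<phi> i x\<bar> \<le> M * indicator (cball 0 R) x"
    using test_fun_bounds[OF T] by metis
  show "integrable lborel (\<lambda>x. \<phi> x *\<^sub>R Dn i x)"
  proof (rule Bochner_Integration.integrable_bound)
    show "integrable lborel (\<lambda>x. \<phi> x * norm (Dn i x))"
      by (rule integrable_compact_mult_L2(1)[OF _ _ R(1) energy_spaceD(4)[OF assms(1)]]) measurable
  qed auto
  show "integrable lborel (\<lambda>x. pderiv2 \<phi> i x *\<^sub>R n x)"
  proof (rule Bochner_Integration.integrable_bound[OF integrable_indicator_cball[of M R]])
    show "AE x in lborel. norm (pderiv2 \<phi> i x *\<^sub>R n x) \<le> norm (M * indicator (cball 0 R) x)"
      using R(2) energy_spaceD(3)[OF assms(1)] by (auto intro!: AE_I2 order_trans[OF R(2) abs_ge_self] simp del: abs_mult)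
  qed measurable
qed

lemma energy_space_weak_deriv:
  assumes "energy_space n Dn"
  shows "weak_deriv (\<lambda>x. n x $ j) i (\<lambda>x. Dn i x $ j)"
  unfolding weak_deriv_def
proof (intro allI impI)
  fix \<phi> assume T: "test_fun \<phi>"
  note i = energy_space_integrable_test[OF assms T]
  have "(\<integral>x. pderiv2 \<phi> i x *\<^sub>R n x \<partial>lborel) $ j = - (\<integral>x. \<phi> x *\<^sub>R Dn i x \<partial>lborel) $ j"
    using assms T by (simp add: energy_space_def weak_pderiv_def)
  then show "(\<integral>x. pderiv2 \<phi> i x * n x $ j \<partial>lborel) = - (\<integral>x. \<phi> x * Dn i x $ j \<partial>lborel)"
    using integral_bounded_linear[OF bounded_linear_vec_nth[of j] i(1)[of i]]
      integral_bounded_linear[OF bounded_linear_vec_nth[of j] i(2)[of i]] by simp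
qed

text \<open>By the fundamental lemma it is enough that, for each test function, the first-order
  coefficients \<open>c j\<close> of the three components add up to 0.\<close>

lemma energy_space_tangent:
  assumes E: "energy_space n Dn"
  shows "AE x in lborel. n x \<bullet> Dn i x = 0"
proof -
  note [measurable] = energy_spaceD(1,2)[OF E]
  have u: "\<bar>n x $ j\<bar> \<le> 1" for x j
    using component_le_norm_cart[of "n x" j] energy_spaceD(3)[OF E, of x] by simp
  have mu[measurable]: "(\<lambda>x. n x $ j) \<in> borel_measurable borel" "(\<lambda>x. Dn i x $ j) \<in> borel_measurable borel" for j
    by measurable
  have one: "(\<Sum>j\<in>UNIV. (n x $ j)\<^sup>2) = 1" for x
    using energy_spaceD(3)[OF E, of x] by (simp add: norm_vec_def L2_set_def)
  show ?thesis
  proof (rule AE_eq_0_if_test_integrals)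
    show "(\<lambda>x. n x \<bullet> Dn i x) \<in> borel_measurable borel" by measurable
    fix R :: real
    have "integrable lborel (\<lambda>x. \<Sum>j\<in>UNIV. (indicator (cball 0 R) x * n x $ j) * Dn i x $ j)"
      by (intro Bochner_Integration.integrable_sum integrable_compact_mult_L2(1)[where C = 1 and R = R] energy_spaceD(5)[OF E])
        (use u in \<open>auto simp: indicator_def\<close>)
    then show "integrable lborel (\<lambda>x. indicator (cball 0 R) x * (n x \<bullet> Dn i x))"
      by (simp add: inner_vec_def sum_distrib_left mult.assoc)
  next
    fix \<phi> assume T: "test_fun \<phi>"
    note [measurable] = test_fun_measurable[OF T]
    obtain R M where R: "0 \<le> M" "\<And>x. \<bar>\<phi> x\<bar> \<le> M * indicator (cball 0 R) x"
      using test_fun_bounds[OF T] by metis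
    have M: "\<bar>\<phi> x\<bar> \<le> M" for x
      using R(1) R(2)[of x] by (cases "norm x \<le> R") simp_all
    let ?v = "\<lambda>h j x. n (x + h *\<^sub>R axis i 1) $ j"
    define c where "c j = (\<integral>x. \<phi> x * n x $ j * Dn i x $ j \<partial>lborel)" for j
    have "\<exists>K. 0 \<le> K \<and> (\<forall>h. 0 < h \<longrightarrow> h \<le> 1 \<longrightarrow>
        \<bar>(\<integral>x. \<phi> x * n x $ j * (?v h j x - n x $ j) \<partial>lborel) - h * c j\<bar> \<le> K * h\<^sup>2)" for j
    proof (rule weak_deriv_first_order[OF mu u energy_spaceD(5)[OF E] energy_space_weak_deriv[OF E] T])
      fix K :: real
      assume "0 \<le> K" "\<And>h. 0 < h \<Longrightarrow> h \<le> 1 \<Longrightarrow>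
        \<bar>(\<integral>x. \<phi> x * n x $ j * (?v h j x - n x $ j) \<partial>lborel) - h * (\<integral>x. \<phi> x * n x $ j * Dn i x $ j \<partial>lborel)\<bar> \<le> K * h\<^sup>2"
      then show ?thesis unfolding c_def by blast
    qed
    then have "\<exists>K. \<forall>j. 0 \<le> K j \<and> (\<forall>h. 0 < h \<longrightarrow> h \<le> 1 \<longrightarrow>
        \<bar>(\<integral>x. \<phi> x * n x $ j * (?v h j x - n x $ j) \<partial>lborel) - h * c j\<bar> \<le> K j * h\<^sup>2)"
      by (intro choice allI)
    then obtain K where K: "\<And>j h. 0 < h \<Longrightarrow> h \<le> 1 \<Longrightarrow>
        \<bar>(\<integral>x. \<phi> x * n x $ j * (?v h j x - n x $ j) \<partial>lborel) - h * c j\<bar> \<le> K j * h\<^sup>2"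
      by blast
    define g where "g j = (\<integral>x. (Dn i x $ j)\<^sup>2 \<partial>lborel)" for j
    \<comment> \<open>The first summand collects the expansion errors, the second the halved squared
      increments of n; both come with a factor h^2.\<close>
    define B where "B = (\<Sum>j\<in>UNIV. K j) + M / 2 * (\<Sum>j\<in>UNIV. g j)"
    have main: "\<bar>\<Sum>j\<in>UNIV. c j\<bar> \<le> B * h" if h: "0 < h" "h \<le> 1" for h
    proof -
      note d = weak_deriv_increment_L2[OF mu u energy_spaceD(5)[OF E] energy_space_weak_deriv[OF E] h(1)]
      let ?S = "\<lambda>j. \<integral>x. \<phi> x * n x $ j * (?v h j x - n x $ j) \<partial>lborel"
      have iS: "integrable lborel (\<lambda>x. \<phi> x * (n x $ j * (?v h j x - n x $ j)))" for j
      proof (rule integrable_test_fun_mult_bounded[OF T])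
        show "\<bar>n x $ j * (?v h j x - n x $ j)\<bar> \<le> 1 * 2" for x
          unfolding abs_mult using u[of x j] u[of "x + h *\<^sub>R axis i 1" j] by (intro mult_mono) auto
      qed measurable
      have id: "integrable lborel (\<lambda>x. M * (?v h j x - n x $ j)\<^sup>2)" for j
        by (intro integrable_mult_right d)
      have id': "integrable lborel (\<lambda>x. \<phi> x * (?v h j x - n x $ j)\<^sup>2)" for j
        by (rule Bochner_Integration.integrable_bound[OF id])
          (auto simp: abs_mult intro!: AE_I2 mult_right_mono order_trans[OF M abs_ge_self])
      have "(\<Sum>j\<in>UNIV. ?S j) = (\<integral>x. (\<Sum>j\<in>UNIV. \<phi> x * (n x $ j * (?v h j x - n x $ j))) \<partial>lborel)"
        by (subst Bochner_Integration.integral_sum[OF iS]) (simp add: mult.assoc)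
      also have "\<dots> = (\<integral>x. (\<Sum>j\<in>UNIV. - (1/2) * (\<phi> x * (?v h j x - n x $ j)\<^sup>2)) \<partial>lborel)"
      proof (intro Bochner_Integration.integral_cong refl)
        fix x
        \<comment> \<open>Polarization: summed over j, the first two squares cancel because n has
          norm 1 at both points.\<close>
        have "n x $ j * (?v h j x - n x $ j) = (1/2) * (?v h j x)\<^sup>2 - (1/2) * (n x $ j)\<^sup>2 - (1/2) * (?v h j x - n x $ j)\<^sup>2" for j
          by (simp add: power2_eq_square field_simps)
        then have "(\<Sum>j\<in>UNIV. n x $ j * (?v h j x - n x $ j))
          = (1/2) * (\<Sum>j\<in>UNIV. (?v h j x)\<^sup>2) - (1/2) * (\<Sum>j\<in>UNIV. (n x $ j)\<^sup>2) - (1/2) * (\<Sum>j\<in>UNIV. (?v h j x - n x $ j)\<^sup>2)"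
          by (simp only: sum_subtractf sum_distrib_left)
        also have "\<dots> = - (1/2) * (\<Sum>j\<in>UNIV. (?v h j x - n x $ j)\<^sup>2)"
          unfolding one by simp
        finally have "\<phi> x * (\<Sum>j\<in>UNIV. n x $ j * (?v h j x - n x $ j)) = \<phi> x * (- (1/2) * (\<Sum>j\<in>UNIV. (?v h j x - n x $ j)\<^sup>2))"
          by simp
        then show "(\<Sum>j\<in>UNIV. \<phi> x * (n x $ j * (?v h j x - n x $ j))) = (\<Sum>j\<in>UNIV. - (1/2) * (\<phi> x * (?v h j x - n x $ j)\<^sup>2))"
          by (simp add: sum_distrib_left)
      qed
      also have "\<dots> = (\<Sum>j\<in>UNIV. - (1/2) * (\<integral>x. \<phi> x * (?v h j x - n x $ j)\<^sup>2 \<partial>lborel))"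
        by (subst Bochner_Integration.integral_sum) (intro integrable_mult_right id', simp)
      finally have S: "(\<Sum>j\<in>UNIV. ?S j) = (\<Sum>j\<in>UNIV. - (1/2) * (\<integral>x. \<phi> x * (?v h j x - n x $ j)\<^sup>2 \<partial>lborel))" .
      have T1: "\<bar>\<integral>x. \<phi> x * (?v h j x - n x $ j)\<^sup>2 \<partial>lborel\<bar> \<le> M * (h\<^sup>2 * g j)" for j
      proof -
        have "\<bar>\<integral>x. \<phi> x * (?v h j x - n x $ j)\<^sup>2 \<partial>lborel\<bar> \<le> (\<integral>x. \<bar>\<phi> x * (?v h j x - n x $ j)\<^sup>2\<bar> \<partial>lborel)"
          by (rule integral_abs_bound)
        also have "\<dots> \<le> (\<integral>x. M * (?v h j x - n x $ j)\<^sup>2 \<partial>lborel)"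
          by (intro integral_mono integrable_abs id id') (auto simp: abs_mult intro!: mult_right_mono M)
        also have "\<dots> = M * (\<integral>x. (?v h j x - n x $ j)\<^sup>2 \<partial>lborel)" by simp
        also have "\<dots> \<le> M * (h\<^sup>2 * g j)"
          unfolding g_def by (intro mult_left_mono d R(1))
        finally show ?thesis .
      qed
      have "\<bar>\<Sum>j\<in>UNIV. ?S j\<bar> \<le> (\<Sum>j\<in>UNIV. (1/2) * (M * (h\<^sup>2 * g j)))"
        unfolding S by (rule order_trans[OF sum_abs]) (intro sum_mono, use T1 in \<open>simp add: abs_mult\<close>)
      also have "\<dots> = M / 2 * (\<Sum>j\<in>UNIV. g j) * h\<^sup>2"
        by (simp add: sum_distrib_left sum_distrib_right mult_ac)
      finally have S1: "\<bar>\<Sum>j\<in>UNIV. ?S j\<bar> \<le> M / 2 * (\<Sum>j\<in>UNIV. g j) * h\<^sup>2" .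
      have "\<bar>(\<Sum>j\<in>UNIV. ?S j) - h * (\<Sum>j\<in>UNIV. c j)\<bar> = \<bar>\<Sum>j\<in>UNIV. ?S j - h * c j\<bar>"
        by (simp add: sum_subtractf sum_distrib_left)
      also have "\<dots> \<le> (\<Sum>j\<in>UNIV. K j * h\<^sup>2)"
        by (rule order_trans[OF sum_abs]) (intro sum_mono K h)
      also have "\<dots> = (\<Sum>j\<in>UNIV. K j) * h\<^sup>2" by (simp add: sum_distrib_right)
      finally have "\<bar>h * (\<Sum>j\<in>UNIV. c j)\<bar> \<le> (\<Sum>j\<in>UNIV. K j) * h\<^sup>2 + M / 2 * (\<Sum>j\<in>UNIV. g j) * h\<^sup>2"
        using S1 by linarith
      also have "\<dots> = h * (B * h)" by (simp add: B_def power2_eq_square algebra_simps)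
      \<comment> \<open>Only the term linear in h is not of order h^2; dividing by h bounds the
        fixed sum by B h for all small h.\<close>
      finally have "h * \<bar>\<Sum>j\<in>UNIV. c j\<bar> \<le> h * (B * h)" using h by (simp add: abs_mult)
      then show ?thesis using h(1) by (rule mult_left_le_imp_le)
    qed
    have "(\<Sum>j\<in>UNIV. c j) = 0"
    proof -
      have "((\<lambda>h. B * h) \<longlongrightarrow> B * 0) (at_right 0)" by (intro tendsto_intros)
      moreover have "\<forall>\<^sub>F h in at_right 0. \<bar>\<Sum>j\<in>UNIV. c j\<bar> \<le> B * h"
        using eventually_at_right[of 0 "1::real"] main by (auto intro!: exI[of _ 1])
      ultimately have "\<bar>\<Sum>j\<in>UNIV. c j\<bar> \<le> B * 0"
        by (intro tendsto_lowerbound[of "\<lambda>h. B * h" _ "at_right (0::real)"]) auto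
      then show ?thesis by simp
    qed
    moreover have "(\<integral>x. \<phi> x * (n x \<bullet> Dn i x) \<partial>lborel) = (\<Sum>j\<in>UNIV. c j)"
    proof -
      have ic: "integrable lborel (\<lambda>x. (\<phi> x * n x $ j) * Dn i x $ j)" for j
      proof (rule integrable_compact_mult_L2(1)[OF _ _ _ energy_spaceD(5)[OF E]])
        show "\<bar>\<phi> x * n x $ j\<bar> \<le> M * indicator (cball 0 R) x" for x
          using mult_mono[OF R(2)[of x] u[of x j]] order_trans[OF abs_ge_zero R(2)[of x]] by (simp add: abs_mult)
      qed measurable
      show ?thesis
        unfolding c_def by (subst Bochner_Integration.integral_sum[OF ic, symmetric])
          (simp add: inner_vec_def sum_distrib_left mult.assoc)
    qed
    ultimately show "(\<integral>x. \<phi> x * (n x \<bullet> Dn i x) \<partial>lborel) = 0" by simp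
  qed
qed

section \<open>Lower bound for the energy\<close>

text \<open>Expand |p - q x n|^2 + (q . n)^2 \<ge> 0. The second square compensates |q x n|^2 =
  |q|^2 |n|^2 - (q . n)^2, so p and q may be arbitrary vectors.\<close>

lemma triple_product_le_coords:
  fixes n1 n2 n3 p1 p2 p3 q1 q2 q3 :: real
  assumes "n1\<^sup>2 + n2\<^sup>2 + n3\<^sup>2 = 1"
  shows "2 * (n1 * (p2*q3 - p3*q2) + n2 * (p3*q1 - p1*q3) + n3 * (p1*q2 - p2*q1))
    \<le> (p1\<^sup>2 + p2\<^sup>2 + p3\<^sup>2) + (q1\<^sup>2 + q2\<^sup>2 + q3\<^sup>2)"
proof -
  have "0 \<le> (p1 - (q2*n3 - q3*n2))\<^sup>2 + (p2 - (q3*n1 - q1*n3))\<^sup>2 + (p3 - (q1*n2 - q2*n1))\<^sup>2 + (q1*n1 + q2*n2 + q3*n3)\<^sup>2"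
    by simp
  also have "\<dots> = (p1\<^sup>2 + p2\<^sup>2 + p3\<^sup>2) + (q1\<^sup>2 + q2\<^sup>2 + q3\<^sup>2) * (n1\<^sup>2 + n2\<^sup>2 + n3\<^sup>2)
      - 2 * (n1 * (p2*q3 - p3*q2) + n2 * (p3*q1 - p1*q3) + n3 * (p1*q2 - p2*q1))"
    by algebra
  finally show ?thesis using assms by simp
qed

lemma norm_3_power2: "(norm v)\<^sup>2 = (v$1)\<^sup>2 + (v$2)\<^sup>2 + (v$3)\<^sup>2" for v :: "real^3"
  unfolding power2_norm_eq_inner by (simp add: inner_vec_def sum_3 power2_eq_square)

lemma cross3_components:
  "(cross3 p q) $ 1 = p$2 * q$3 - p$3 * q$2"
  "(cross3 p q) $ 2 = p$3 * q$1 - p$1 * q$3"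
  "(cross3 p q) $ 3 = p$1 * q$2 - p$2 * q$1"
  by (simp_all add: cross3_def)

lemma curl_components:
  "curl Dn x $ 1 = Dn 2 x $ 3" "curl Dn x $ 2 = - (Dn 1 x $ 3)" "curl Dn x $ 3 = Dn 1 x $ 2 - Dn 2 x $ 1"
  by (simp_all add: curl_def)

lemma e3_components: "e3 $ 1 = 0" "e3 $ 2 = 0" "e3 $ 3 = 1"
  by (simp_all add: e3_def)

lemma triple_product_le:
  fixes n p q :: "real^3"
  assumes "norm n = 1"
  shows "\<bar>n \<bullet> (cross3 p q)\<bar> \<le> ((norm p)\<^sup>2 + (norm q)\<^sup>2) / 2"
proof -
  have n: "(n$1)\<^sup>2 + (n$2)\<^sup>2 + (n$3)\<^sup>2 = 1"
    using norm_3_power2[of n] assms by simp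
  have "2 * (n \<bullet> cross3 p q) \<le> (norm p)\<^sup>2 + (norm q)\<^sup>2"
    \<comment> \<open>The instances follow the order in which the variables occur in the
      conclusion.\<close>
    using triple_product_le_coords[OF n, of "p$2" "q$3" "p$3" "q$2" "q$1" "p$1"]
    by (simp add: inner_vec_def sum_3 cross3_components norm_3_power2)
  moreover have "2 * (n \<bullet> cross3 q p) \<le> (norm q)\<^sup>2 + (norm p)\<^sup>2"
    using triple_product_le_coords[OF n, of "q$2" "p$3" "q$3" "p$2" "p$1" "q$1"]
    by (simp add: inner_vec_def sum_3 cross3_components norm_3_power2)
  moreover have "n \<bullet> cross3 q p = - (n \<bullet> cross3 p q)"
    by (subst cross_skew) simp
  ultimately show ?thesis by (simp add: abs_le_iff)
qed

text \<open>The sum of squares behind this inequality is obtained by replacing each partial derivative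
  of n with the helical derivative r Dn_i - e_i \<open>\<times>\<close> n.\<close>

lemma Bogomolny_coords:
  fixes n1 n2 n3 p1 p2 p3 q1 q2 q3 r :: real
  assumes n: "n1\<^sup>2 + n2\<^sup>2 + n3\<^sup>2 = 1"
    and p: "n1*p1 + n2*p2 + n3*p3 = 0" and q: "n1*q1 + n2*q2 + n3*q3 = 0"
  shows "2 * r\<^sup>2 * (n1 * (p2*q3 - p3*q2) + n2 * (p3*q1 - p1*q3) + n3 * (p1*q2 - p2*q1))
    \<le> r\<^sup>2 * ((p1\<^sup>2 + p2\<^sup>2 + p3\<^sup>2) + (q1\<^sup>2 + q2\<^sup>2 + q3\<^sup>2))
      + 2 * r * (n1*q3 - n2*p3 + (n3 - 1) * (p2 - q1)) + (1 - n3)\<^sup>2"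
proof -
  \<comment> \<open>The helical derivatives in coordinates: -e_1 x n = (0, n3, -n2) and -e_2 x n =
    (-n3, 0, n1).\<close>
  define P1 P2 P3 Q1 Q2 Q3 where "P1 = r*p1" and "P2 = r*p2 + n3" and "P3 = r*p3 - n2"
    and "Q1 = r*q1 - n3" and "Q2 = r*q2" and "Q3 = r*q3 + n1"
  note PQ = this
  have "2 * (n1 * (P2*Q3 - P3*Q2) + n2 * (P3*Q1 - P1*Q3) + n3 * (P1*Q2 - P2*Q1))
    \<le> (P1\<^sup>2 + P2\<^sup>2 + P3\<^sup>2) + (Q1\<^sup>2 + Q2\<^sup>2 + Q3\<^sup>2)"
    by (rule triple_product_le_coords[OF n])
  \<comment> \<open>Tangentiality enters here: it reduces the mixed terms to r (p2 - q1). The last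
    term is n . ((e_1 x n) x (e_2 x n)) = n3.\<close>
  moreover have "n1 * (P2*Q3 - P3*Q2) + n2 * (P3*Q1 - P1*Q3) + n3 * (P1*Q2 - P2*Q1)
    = r\<^sup>2 * (n1 * (p2*q3 - p3*q2) + n2 * (p3*q1 - p1*q3) + n3 * (p1*q2 - p2*q1)) + r * (p2 - q1) + n3"
    using n p q unfolding PQ by algebra
  moreover have "(P1\<^sup>2 + P2\<^sup>2 + P3\<^sup>2) + (Q1\<^sup>2 + Q2\<^sup>2 + Q3\<^sup>2)
    = r\<^sup>2 * ((p1\<^sup>2 + p2\<^sup>2 + p3\<^sup>2) + (q1\<^sup>2 + q2\<^sup>2 + q3\<^sup>2))
      + 2 * r * (n1*q3 - n2*p3 + n3 * (p2 - q1)) + 1 + n3\<^sup>2"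
    using n unfolding PQ by algebra
  \<comment> \<open>Moving 2 n3 and 2 r (p2 - q1) to the right completes the square (1 - n3)^2 and
    turns the factor n3 into n3 - 1.\<close>
  ultimately show ?thesis by (simp add: power2_eq_square algebra_simps)
qed

lemma Bogomolny_density:
  assumes "norm (n x) = 1" "n x \<bullet> Dn 1 x = 0" "n x \<bullet> Dn 2 x = 0"
  shows "2 * r\<^sup>2 * (n x \<bullet> (cross3 (Dn 1 x) (Dn 2 x)))
    \<le> r\<^sup>2 * (\<Sum>i\<in>UNIV. (norm (Dn i x))\<^sup>2) + 2 * r * ((n x - e3) \<bullet> curl Dn x) + (1 - n x $ 3)\<^sup>2"
proof -
  have n: "(n x$1)\<^sup>2 + (n x$2)\<^sup>2 + (n x$3)\<^sup>2 = 1"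
    using norm_3_power2[of "n x"] assms by simp
  have d: "n x$1 * Dn i x$1 + n x$2 * Dn i x$2 + n x$3 * Dn i x$3 = n x \<bullet> Dn i x" for i
    by (simp add: inner_vec_def sum_3)
  show ?thesis
    using Bogomolny_coords[OF n, of "Dn 1 x$1" "Dn 1 x$2" "Dn 1 x$3" "Dn 2 x$1" "Dn 2 x$2" "Dn 2 x$3" r]
    unfolding d using assms(2,3)
    by (simp add: sum_2 inner_vec_def sum_3 cross3_components curl_components e3_components norm_3_power2)
qed

lemma measurable_cross3[measurable]:
  fixes f g :: "'a \<Rightarrow> real^3"
  assumes [measurable]: "f \<in> borel_measurable M" "g \<in> borel_measurable M"
  shows "(\<lambda>x. cross3 (f x) (g x)) \<in> borel_measurable M"
proof -
  have "(\<lambda>x. \<Sum>j\<in>UNIV. (cross3 (f x) (g x)) $ j *\<^sub>R axis j (1::real)) \<in> borel_measurable M"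
    unfolding sum_3 cross3_components
    by (intro borel_measurable_add borel_measurable_scaleR borel_measurable_diff borel_measurable_times
        borel_measurable_vec_nth borel_measurable_const assms)
  moreover have "(\<Sum>j\<in>UNIV. v $ j *\<^sub>R axis j 1) = v" for v :: "real^3"
    by (simp add: vec_eq_iff axis_def sum_3 forall_3)
  ultimately show ?thesis by simp
qed

section \<open>Integrated lower bounds on the energy space\<close>

lemma energy_space_integrable_Dir:
  "energy_space n Dn \<Longrightarrow> integrable lborel (\<lambda>x. \<Sum>i\<in>UNIV. (norm (Dn i x))\<^sup>2)"
  by (simp add: energy_space_def)

lemma energy_space_integrable_degree:
  assumes E: "energy_space n Dn"
  shows "integrable lborel (\<lambda>x. n x \<bullet> (cross3 (Dn 1 x) (Dn 2 x)))"
proof -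
  note [measurable] = energy_spaceD(1,2)[OF E]
  show ?thesis
    by (rule Bochner_Integration.integrable_bound[OF energy_space_integrable_Dir[OF E]], measurable)
      (intro AE_I2 order_trans[OF _ abs_ge_self] order_trans[OF triple_product_le[OF energy_spaceD(3)[OF E], unfolded real_norm_def[symmetric]]]
        , simp add: sum_2 real_norm_def)
qed

lemma Dir_ge_degree:
  assumes E: "energy_space n Dn"
  shows "4 * pi * \<bar>degree n Dn\<bar> \<le> Dir Dn"
proof -
  let ?q = "\<lambda>x. n x \<bullet> (cross3 (Dn 1 x) (Dn 2 x))"
  have "4 * pi * \<bar>degree n Dn\<bar> = \<bar>\<integral>x. ?q x \<partial>lborel\<bar>"
    by (simp add: degree_def abs_mult)
  also have "\<dots> \<le> (\<integral>x. \<bar>?q x\<bar> \<partial>lborel)" by (rule integral_abs_bound)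
  also have "\<dots> \<le> (\<integral>x. (1/2) * (\<Sum>i\<in>UNIV. (norm (Dn i x))\<^sup>2) \<partial>lborel)"
    by (intro integral_mono integrable_abs energy_space_integrable_degree E integrable_mult_right energy_space_integrable_Dir[OF E])
      (simp_all add: E sum_2 triple_product_le[OF energy_spaceD(3)[OF E], simplified])
  also have "\<dots> = Dir Dn" by (simp add: Dir_def)
  finally show ?thesis .
qed

lemma Energy_lower_bound:
  assumes E: "energy_space n Dn" and r: "0 < r" "r \<le> 1"
  shows "4 * pi * (\<bar>degree n Dn\<bar> * (1 - r\<^sup>2) + r\<^sup>2 * degree n Dn) \<le> Energy r n Dn"
proof -
  let ?d = "\<lambda>x. \<Sum>i\<in>UNIV. (norm (Dn i x))\<^sup>2" and ?h = "\<lambda>x. (n x - e3) \<bullet> curl Dn x"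
    and ?v = "\<lambda>x. (1 - n x $ 3)\<^sup>2" and ?q = "\<lambda>x. n x \<bullet> (cross3 (Dn 1 x) (Dn 2 x))"
  note i = energy_space_integrable_Dir[OF E] energy_space_integrable_degree[OF E] energy_spaceD(6)[OF E]
  have r2: "0 \<le> 1 - r\<^sup>2" using r by (simp add: power_le_one)
  have D: "(1 - r\<^sup>2) * (4 * pi * \<bar>degree n Dn\<bar>) \<le> (1 - r\<^sup>2) * Dir Dn"
    by (intro mult_left_mono Dir_ge_degree E r2)
  have "4 * pi * degree n Dn * r\<^sup>2 \<le> r\<^sup>2 * Dir Dn + r * Helic n Dn + Pot n"
  proof (cases "integrable lborel ?h")
    case True
    have "(\<integral>x. 2 * r\<^sup>2 * ?q x \<partial>lborel) \<le> (\<integral>x. r\<^sup>2 * ?d x + 2 * r * ?h x + ?v x \<partial>lborel)"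
    proof (rule integral_mono_AE)
      show "AE x in lborel. 2 * r\<^sup>2 * ?q x \<le> r\<^sup>2 * ?d x + 2 * r * ?h x + ?v x"
        using energy_space_tangent[OF E, of 1] energy_space_tangent[OF E, of 2]
        by eventually_elim (rule Bogomolny_density[OF energy_spaceD(3)[OF E]])
    qed (intro Bochner_Integration.integrable_add integrable_mult_right i True)+
    also have "\<dots> = r\<^sup>2 * (\<integral>x. ?d x \<partial>lborel) + 2 * r * (\<integral>x. ?h x \<partial>lborel) + (\<integral>x. ?v x \<partial>lborel)"
      using i True by simp
    finally show ?thesis by (simp add: degree_def Dir_def Helic_def Pot_def) (simp add: algebra_simps)
  next
    \<comment> \<open>A helicity density that is not integrable has Bochner integral 0 by
      convention; then V \<ge> 0 and r^2 D \<ge> 4 pi r^2 Q give the claim.\<close>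
    case False
    then have H: "Helic n Dn = 0" by (simp add: Helic_def not_integrable_integral_eq)
    have V: "0 \<le> Pot n" by (auto simp: Pot_def intro!: Bochner_Integration.integral_nonneg)
    have "4 * pi * degree n Dn \<le> Dir Dn"
      using Dir_ge_degree[OF E] abs_ge_self[of "degree n Dn"]
      by (intro order_trans[OF _ Dir_ge_degree[OF E]] mult_left_mono) auto
    then have "r\<^sup>2 * (4 * pi * degree n Dn) \<le> r\<^sup>2 * Dir Dn" by (intro mult_left_mono) auto
    then show ?thesis using H V by (simp add: mult_ac)
  qed
  then show ?thesis using D by (simp add: Energy_def algebra_simps)
qed

section \<open>Radial integrals and the truncated Belavin-Polyakov profile\<close>

text \<open>The disc |x|^2 \<le> t has area pi t, so both measures agree on the half-lines
  \<open>{..t}\<close>, an intersection-stable generator of the Borel sets.\<close>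

lemma distr_inner_self:
  "distr lborel borel (\<lambda>x::real^2. x \<bullet> x) = density lborel (\<lambda>s. ennreal (pi * indicator {0..} s))"
proof (rule measure_eqI_generator_eq[where E = "range atMost" and A = "\<lambda>n. {..real n}" and \<Omega> = UNIV])
  show "Int_stable (range (atMost :: real \<Rightarrow> real set))"
    by (auto simp: Int_stable_def)
  show "sets (distr lborel borel (\<lambda>x::real^2. x \<bullet> x)) = sigma_sets UNIV (range atMost)"
    "sets (density lborel (\<lambda>s::real. ennreal (pi * indicator {0..} s))) = sigma_sets UNIV (range atMost)"
    using borel_eq_atMost[where 'a = real, THEN arg_cong[where f = sets]] by simp_all
  have ball: "emeasure (distr lborel borel (\<lambda>x::real^2. x \<bullet> x)) {..t} = ennreal (pi * max 0 t)" for t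
  proof -
    have "(\<lambda>x::real^2. x \<bullet> x) -` {..t} = (if 0 \<le> t then cball 0 (sqrt t) else {})"
    proof -
      have "x \<bullet> x \<le> t \<longleftrightarrow> norm x \<le> sqrt t" if "0 \<le> t" for x :: "real^2"
        using that by (simp add: norm_eq_sqrt_inner)
      moreover have "\<not> x \<bullet> x \<le> t" if "\<not> 0 \<le> t" for x :: "real^2"
        using that inner_ge_zero[of x] by linarith
      ultimately show ?thesis by auto
    qed
    then show ?thesis
      by (subst emeasure_distr) (auto simp: emeasure_cball unit_ball_vol_2 max_def)
  qed
  show "emeasure (distr lborel borel (\<lambda>x::real^2. x \<bullet> x)) X
      = emeasure (density lborel (\<lambda>s. ennreal (pi * indicator {0..} s))) X" if "X \<in> range atMost" for X
  proof -
    obtain t where X: "X = {..t}" using \<open>X \<in> range atMost\<close> by auto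
    have "emeasure (density lborel (\<lambda>s. ennreal (pi * indicator {0..} s))) X
      = (\<integral>\<^sup>+s. ennreal pi * indicator {0..t} s \<partial>lborel)"
      unfolding X by (subst emeasure_density) (auto intro!: nn_integral_cong simp: indicator_def)
    also have "\<dots> = ennreal pi * ennreal (max 0 t)"
      by (subst nn_integral_cmult_indicator) (auto simp: emeasure_lborel_Icc_eq max_def)
    finally show ?thesis unfolding X ball by (simp add: ennreal_mult)
  qed
  show "emeasure (distr lborel borel (\<lambda>x::real^2. x \<bullet> x)) {..real n} \<noteq> \<infinity>" for n
    unfolding ball by simp
  show "(\<Union>n. {..real n}) = (UNIV :: real set)"
    using real_arch_simple by auto
qed auto

text \<open>In the variable s = |x|^2, polar integration has the constant weight pi and no Jacobian
  factor.\<close>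

lemma integral_radial:
  fixes f :: "real \<Rightarrow> real"
  assumes [measurable]: "f \<in> borel_measurable borel" and supp: "\<And>s. L < s \<Longrightarrow> f s = 0"
  shows "(\<integral>x. f ((x::real^2) \<bullet> x) \<partial>lborel) = pi * (\<integral>s. f s * indicator {0..L} s \<partial>lborel)"
proof -
  have "(\<integral>x. f ((x::real^2) \<bullet> x) \<partial>lborel) = (\<integral>s. f s \<partial>distr lborel borel (\<lambda>x::real^2. x \<bullet> x))"
    by (rule integral_distr[symmetric]) auto
  also have "\<dots> = (\<integral>s. (pi * indicator {0..} s) *\<^sub>R f s \<partial>lborel)"
    unfolding distr_inner_self by (rule integral_density) auto
  also have "\<dots> = (\<integral>s. pi * (f s * indicator {0..L} s) \<partial>lborel)"
    by (intro Bochner_Integration.integral_cong refl) (use supp in \<open>auto simp: indicator_def\<close>)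
  finally show ?thesis by simp
qed

text \<open>With s = |x|^2, the polar angle \<open>\<theta>\<close> of the bubble at x satisfies tan (\<open>\<theta>\<close> / 2) = b s / |x|.
  The Belavin-Polyakov profile of size a is b = a; the factor (1 - s/L)^2 cuts it off at s = L
  while keeping it continuously differentiable.\<close>

locale bubble_profile =
  fixes a L :: real
  assumes a: "0 < a" and L: "0 < L"
begin

definition b :: "real \<Rightarrow> real" where "b s = a * (max 0 (1 - s / L))\<^sup>2"
definition b' :: "real \<Rightarrow> real" where "b' s = - (2 * a / L) * max 0 (1 - s / L)"
definition w :: "real \<Rightarrow> real" where "w s = inverse (s + (b s)\<^sup>2)"
text \<open>In terms of the polar angle, sin \<theta> = |x| \<alpha>(s) and cos \<theta> =
  \<beta>(s). With |x| divided out of the sine, both are C^1 in s up to s = 0, so the field has no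
  singularity at the origin. Primes denote derivatives in s.\<close>

definition \<alpha> :: "real \<Rightarrow> real" where "\<alpha> s = 2 * b s * w s"
definition \<beta> :: "real \<Rightarrow> real" where "\<beta> s = 1 - 2 * (b s)\<^sup>2 * w s"
definition \<alpha>' :: "real \<Rightarrow> real" where "\<alpha>' s = 2 * b' s * w s - 2 * b s * (1 + 2 * b s * b' s) * (w s)\<^sup>2"
definition \<beta>' :: "real \<Rightarrow> real" where
  "\<beta>' s = - 4 * b s * b' s * w s + 2 * (b s)\<^sup>2 * (1 + 2 * b s * b' s) * (w s)\<^sup>2"

lemma b_nonneg: "0 \<le> b s" using a by (simp add: b_def)

lemma denom_pos: "0 \<le> s \<Longrightarrow> 0 < s + (b s)\<^sup>2"
  using a by (cases "s = 0") (auto simp: b_def add_pos_nonneg)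

lemma w_denom: "0 \<le> s \<Longrightarrow> w s * (s + (b s)\<^sup>2) = 1"
  using denom_pos[of s] by (simp add: w_def)

lemma w_pos: "0 \<le> s \<Longrightarrow> 0 < w s" using denom_pos[of s] by (simp add: w_def)

lemma outside: "L \<le> s \<Longrightarrow> b s = 0" "L \<le> s \<Longrightarrow> b' s = 0"
  using L by (auto simp: b_def b'_def field_simps max_def)

lemma outside_profile:
  assumes "L \<le> s"
  shows "\<alpha> s = 0" "\<beta> s = 1" "\<alpha>' s = 0" "\<beta>' s = 0"
  using outside[OF assms] by (simp_all add: \<alpha>_def \<beta>_def \<alpha>'_def \<beta>'_def)

lemma measurable_profile[measurable]:
  "\<alpha> \<in> borel_measurable borel" "\<beta> \<in> borel_measurable borel"
  "\<alpha>' \<in> borel_measurable borel" "\<beta>' \<in> borel_measurable borel"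
  "b \<in> borel_measurable borel" "b' \<in> borel_measurable borel" "w \<in> borel_measurable borel"
  unfolding \<alpha>_def \<beta>_def \<alpha>'_def \<beta>'_def w_def b_def b'_def by measurable

lemma DERIV_b: "(b has_real_derivative b' s) (at s)"
proof -
  have "((\<lambda>s. 1 - s / L) has_real_derivative - (1 / L)) (at s)"
    using L by (auto intro!: derivative_eq_intros)
  from DERIV_chain2[OF DERIV_pos_part_power2 this]
  have "((\<lambda>s. (max 0 (1 - s / L))\<^sup>2) has_real_derivative 2 * max 0 (1 - s / L) * - (1 / L)) (at s)" .
  from DERIV_cmult[OF this, of a] show ?thesis
    unfolding b_def b'_def by (rule DERIV_cong) (simp add: field_simps)
qed

lemma DERIV_w: "0 \<le> s \<Longrightarrow> (w has_real_derivative - (1 + 2 * b s * b' s) * (w s)\<^sup>2) (at s)"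
  unfolding w_def[abs_def] using denom_pos[of s]
  by (auto intro!: derivative_eq_intros DERIV_b simp: power2_eq_square algebra_simps)

lemma DERIV_\<alpha>: "0 \<le> s \<Longrightarrow> (\<alpha> has_real_derivative \<alpha>' s) (at s)"
  unfolding \<alpha>_def[abs_def] \<alpha>'_def
  by (auto intro!: derivative_eq_intros DERIV_b DERIV_w simp: algebra_simps)

lemma DERIV_\<beta>: "0 \<le> s \<Longrightarrow> (\<beta> has_real_derivative \<beta>' s) (at s)"
  unfolding \<beta>_def[abs_def] \<beta>'_def
  by (auto intro!: derivative_eq_intros DERIV_b DERIV_w simp: algebra_simps)

lemma continuous_b: "isCont b s" using DERIV_b DERIV_isCont by blast

lemma continuous_b': "isCont b' s" unfolding b'_def by (intro continuous_intros) (use L in auto)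

lemma continuous_profile:
  assumes "0 \<le> s"
  shows "isCont \<alpha> s" "isCont \<beta> s" "isCont \<alpha>' s" "isCont \<beta>' s" "isCont w s"
proof -
  show "isCont \<alpha> s" "isCont \<beta> s" and w: "isCont w s"
    using DERIV_\<alpha> DERIV_\<beta> DERIV_w DERIV_isCont assms by blast+
  show "isCont \<alpha>' s" "isCont \<beta>' s"
    unfolding \<alpha>'_def[abs_def] \<beta>'_def[abs_def] by (intro continuous_intros w continuous_b continuous_b')+
qed

lemma sphere: "0 \<le> s \<Longrightarrow> s * (\<alpha> s)\<^sup>2 + (\<beta> s)\<^sup>2 = 1"
  using w_denom[of s] unfolding \<alpha>_def \<beta>_def by algebra

lemma sphere_deriv: "0 \<le> s \<Longrightarrow> (\<alpha> s)\<^sup>2 + 2 * s * \<alpha> s * \<alpha>' s + 2 * \<beta> s * \<beta>' s = 0"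
  using w_denom[of s] unfolding \<alpha>_def \<beta>_def \<alpha>'_def \<beta>'_def by algebra

text \<open>Up to sign, 2 \<beta>' is the degree density, so the last term is the exact excess over
  the topological bound. It vanishes where b is constant, that is for the untruncated
  profile.\<close>

lemma Dirichlet_density_profile:
  "0 \<le> s \<Longrightarrow> 2 * (\<alpha>' s)\<^sup>2 * s\<^sup>2 + 2 * \<alpha> s * \<alpha>' s * s + (\<alpha> s)\<^sup>2 + 2 * (\<beta>' s)\<^sup>2 * s
     = 2 * \<beta>' s + 8 * (b' s)\<^sup>2 * s\<^sup>2 * (w s)\<^sup>2"
  using w_denom[of s] unfolding \<alpha>_def \<alpha>'_def \<beta>'_def by algebra

text \<open>This form shows the sign: b' \<le> 0 gives \<beta>' \<ge> 2 b^2 w^2.\<close>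

lemma \<beta>'_eq: "0 \<le> s \<Longrightarrow> \<beta>' s = (2 * (b s)\<^sup>2 - 4 * b s * b' s * s) * (w s)\<^sup>2"
  using w_denom[of s] unfolding \<beta>'_def by algebra

text \<open>\<beta> runs from -1 at the centre to 1 at the rim. This total variation fixes both the
  degree and the leading Dirichlet energy 4 pi.\<close>

lemma integral_\<beta>': "(\<integral>s. \<beta>' s * indicator {0..L} s \<partial>lborel) = 2"
proof -
  have "(\<integral>s. \<beta>' s * indicator {0..L} s \<partial>lborel) = \<beta> L - \<beta> 0"
    using L by (intro integral_FTC_Icc_real DERIV_\<beta> continuous_profile) auto
  also have "\<beta> L = 1" by (rule outside_profile) simp
  also have "\<beta> 0 = -1" using a by (simp add: \<beta>_def w_def b_def)
  finally show ?thesis by simp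
qed

lemma b_le: "0 \<le> s \<Longrightarrow> b s \<le> a"
proof -
  assume "0 \<le> s"
  then have "max 0 (1 - s / L) \<le> 1" using L by simp
  then have "(max 0 (1 - s / L))\<^sup>2 \<le> 1" by (simp add: power_le_one)
  then show ?thesis unfolding b_def using a mult_left_le by fastforce
qed

lemma b'_nonpos: "b' s \<le> 0" using a L by (simp add: b'_def)

lemma b'_power2_le: "0 \<le> s \<Longrightarrow> (b' s)\<^sup>2 \<le> 4 * a\<^sup>2 / L\<^sup>2"
proof -
  assume "0 \<le> s"
  then have "max 0 (1 - s / L) \<le> 1" using L by simp
  then have "(max 0 (1 - s / L))\<^sup>2 \<le> 1" by (simp add: power_le_one)
  then have "(2 * a / L)\<^sup>2 * (max 0 (1 - s / L))\<^sup>2 \<le> (2 * a / L)\<^sup>2 * 1"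
    by (intro mult_left_mono) auto
  then show ?thesis by (simp add: b'_def power_mult_distrib power_divide)
qed

end

section \<open>The bubble fields on the plane\<close>

lemma C1_deriv_inner_self: "C1_deriv (\<lambda>x. x \<bullet> x) (\<lambda>i x. 2 * x $ i)"
  unfolding C1_deriv_def
proof (intro conjI allI)
  fix x :: "real^2"
  show "((\<lambda>x. x \<bullet> x) has_derivative (\<lambda>h. 2 * x $ 1 * h $ 1 + 2 * x $ 2 * h $ 2)) (at x)"
    by (rule has_derivative_eq_rhs[OF has_derivative_inner[OF has_derivative_ident has_derivative_ident]])
      (simp add: fun_eq_iff inner_vec_def sum_2)
qed (intro continuous_intros)

text \<open>The horizontal part of the field is \<alpha> (\<sigma> x_2, \<tau> x_1). The choice
  \<sigma> = -1, \<tau> = 1 circulates around the centre (a Bloch skyrmion, degree -1); \<sigma> =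
  \<tau> gives the antiskyrmions of degree 1.\<close>

locale bubble = bubble_profile +
  fixes \<sigma> \<tau> :: real
  assumes signs: "\<sigma>\<^sup>2 = 1" "\<tau>\<^sup>2 = 1"
begin

definition m :: "real^2 \<Rightarrow> real^3" where
  "m x = vector [\<sigma> * (\<alpha> (x \<bullet> x) * x $ 2), \<tau> * (\<alpha> (x \<bullet> x) * x $ 1), \<beta> (x \<bullet> x)]"

definition Dm :: "2 \<Rightarrow> real^2 \<Rightarrow> real^3" where
  "Dm i x = vector [
     \<sigma> * (\<alpha> (x \<bullet> x) * (if i = 2 then 1 else 0) + \<alpha>' (x \<bullet> x) * (2 * x $ i) * x $ 2),
     \<tau> * (\<alpha> (x \<bullet> x) * (if i = 1 then 1 else 0) + \<alpha>' (x \<bullet> x) * (2 * x $ i) * x $ 1),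
     \<beta>' (x \<bullet> x) * (2 * x $ i)]"

lemma m_components:
  "m x $ 1 = \<sigma> * (\<alpha> (x \<bullet> x) * x $ 2)" "m x $ 2 = \<tau> * (\<alpha> (x \<bullet> x) * x $ 1)" "m x $ 3 = \<beta> (x \<bullet> x)"
  by (simp_all add: m_def)

lemma Dm_components:
  "Dm 1 x $ 1 = \<sigma> * (\<alpha>' (x \<bullet> x) * (2 * x $ 1) * x $ 2)"
  "Dm 2 x $ 1 = \<sigma> * (\<alpha> (x \<bullet> x) + \<alpha>' (x \<bullet> x) * (2 * x $ 2) * x $ 2)"
  "Dm 1 x $ 2 = \<tau> * (\<alpha> (x \<bullet> x) + \<alpha>' (x \<bullet> x) * (2 * x $ 1) * x $ 1)"
  "Dm 2 x $ 2 = \<tau> * (\<alpha>' (x \<bullet> x) * (2 * x $ 2) * x $ 1)"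
  "Dm i x $ 3 = \<beta>' (x \<bullet> x) * (2 * x $ i)"
  by (simp_all add: Dm_def)

lemma C1_deriv_profile:
  "C1_deriv (\<lambda>x. \<alpha> (x \<bullet> x)) (\<lambda>i x. \<alpha>' (x \<bullet> x) * (2 * x $ i))"
  "C1_deriv (\<lambda>x. \<beta> (x \<bullet> x)) (\<lambda>i x. \<beta>' (x \<bullet> x) * (2 * x $ i))"
proof -
  have c: "continuous_on UNIV (\<lambda>x::real^2. f (x \<bullet> x))" if "\<And>s. 0 \<le> s \<Longrightarrow> isCont f s" for f :: "real \<Rightarrow> real"
    by (rule continuous_on_compose2[OF continuous_at_imp_continuous_on[of "{0..}"]])
      (use that in \<open>auto intro!: continuous_intros\<close>)
  show "C1_deriv (\<lambda>x. \<alpha> (x \<bullet> x)) (\<lambda>i x. \<alpha>' (x \<bullet> x) * (2 * x $ i))"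
    by (rule C1_deriv_compose[OF C1_deriv_inner_self]) (simp_all add: DERIV_\<alpha> c continuous_profile)
  show "C1_deriv (\<lambda>x. \<beta> (x \<bullet> x)) (\<lambda>i x. \<beta>' (x \<bullet> x) * (2 * x $ i))"
    by (rule C1_deriv_compose[OF C1_deriv_inner_self]) (simp_all add: DERIV_\<beta> c continuous_profile)
qed

lemma C1_deriv_m: "C1_deriv (\<lambda>x. m x $ j) (\<lambda>i x. Dm i x $ j)"
proof -
  have c: "C1_deriv (\<lambda>x. c * (\<alpha> (x \<bullet> x) * x $ k))
      (\<lambda>i x. c * (\<alpha> (x \<bullet> x) * (if i = k then 1 else 0) + \<alpha>' (x \<bullet> x) * (2 * x $ i) * x $ k))" for c k
    using C1_deriv_mult[OF C1_deriv_const[of c] C1_deriv_mult[OF C1_deriv_profile(1) C1_deriv_coord]] by simp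
  show ?thesis
    using exhaust_3[of j] c[of \<sigma> 2] c[of \<tau> 1] C1_deriv_profile(2) by (auto simp: m_def Dm_def)
qed

lemma weak_pderiv_m: "weak_pderiv m i (Dm i)"
  by (rule weak_pderiv_C1[OF C1_deriv_m])

lemma inner_self_2: "x \<bullet> x = (x $ 1)\<^sup>2 + (x $ 2)\<^sup>2" for x :: "real^2"
  by (simp add: inner_vec_def sum_2 power2_eq_square)

lemma norm_m: "norm (m x) = 1"
proof -
  have "(norm (m x))\<^sup>2 = 1"
    using sphere[of "x \<bullet> x"] inner_self_2[of x] signs
    unfolding norm_3_power2 m_def vector_3 by simp algebra
  then show ?thesis using norm_ge_zero[of "m x"] by (simp add: power2_eq_1_iff)
qed

lemma m_outside:
  assumes "L \<le> x \<bullet> x"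
  shows "m x = e3" "Dm i x = 0"
  using outside_profile[OF assms]
  by (simp_all add: m_def Dm_def vec_eq_iff forall_3 e3_components)

lemma Dirichlet_density_m:
  "(\<Sum>i\<in>UNIV. (norm (Dm i x))\<^sup>2) = 4 * \<beta>' (x \<bullet> x) + 16 * (b' (x \<bullet> x))\<^sup>2 * (x \<bullet> x)\<^sup>2 * (w (x \<bullet> x))\<^sup>2"
proof -
  let ?s = "x \<bullet> x"
  have "(\<Sum>i\<in>UNIV. (norm (Dm i x))\<^sup>2)
    = 2 * (2 * (\<alpha>' ?s)\<^sup>2 * ?s\<^sup>2 + 2 * \<alpha> ?s * \<alpha>' ?s * ?s + (\<alpha> ?s)\<^sup>2 + 2 * (\<beta>' ?s)\<^sup>2 * ?s)"
    using inner_self_2[of x] signs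
    unfolding sum_2 norm_3_power2 Dm_def vector_3 by simp algebra
  then show ?thesis unfolding Dirichlet_density_profile[OF inner_ge_zero] by simp
qed

text \<open>The area element of the sphere is, up to sign, d\<beta> times the azimuth element, and
  dx is ds times half the azimuth element; hence the factor 2. The orientation is fixed by \<sigma>
  \<tau>, which is minus the determinant of x -> (\<sigma> x_2, \<tau> x_1).\<close>

lemma degree_density_m: "m x \<bullet> cross3 (Dm 1 x) (Dm 2 x) = 2 * \<sigma> * \<tau> * \<beta>' (x \<bullet> x)"
  unfolding inner_vec_def[of "m x"] sum_3 cross3_components m_components Dm_components inner_real_def
  using inner_self_2[of x] signs sphere[OF inner_ge_zero, of x] sphere_deriv[OF inner_ge_zero, of x]
  by algebra

lemma helicity_density_m:
  "(m x - e3) \<bullet> curl Dm x = 2 * \<alpha> (x \<bullet> x) * \<beta>' (x \<bullet> x) * (\<sigma> * (x $ 2)\<^sup>2 - \<tau> * (x $ 1)\<^sup>2)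
    - (1 - \<beta> (x \<bullet> x)) * (\<tau> * (\<alpha> (x \<bullet> x) + 2 * \<alpha>' (x \<bullet> x) * (x $ 1)\<^sup>2)
        - \<sigma> * (\<alpha> (x \<bullet> x) + 2 * \<alpha>' (x \<bullet> x) * (x $ 2)\<^sup>2))"
  unfolding inner_vec_def[of "m x - e3"] sum_3 curl_components vector_minus_component e3_components
    m_components Dm_components inner_real_def
  by algebra

lemma continuous_m: "continuous_on UNIV m" "continuous_on UNIV (Dm i)"
  by (auto simp: continuous_on_componentwise[where f = m] continuous_on_componentwise[where f = "Dm i"]
       Basis_vec_def inner_axis intro!: C1_deriv_continuous[OF C1_deriv_m] C1_deriv_continuous_deriv[OF C1_deriv_m])

lemma integrable_continuous_outside:
  fixes f :: "real^2 \<Rightarrow> real"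
  assumes "continuous_on UNIV f" "\<And>x. L \<le> x \<bullet> x \<Longrightarrow> f x = 0"
  shows "integrable lborel f"
proof -
  have "integrable lborel (\<lambda>x. indicator (cball 0 (sqrt L)) x *\<^sub>R f x)"
    by (intro borel_integrable_compact continuous_on_subset[OF assms(1)]) auto
  also have "(\<lambda>x. indicator (cball 0 (sqrt L)) x *\<^sub>R f x) = f"
    using assms(2) by (auto simp: indicator_def fun_eq_iff norm_eq_sqrt_inner)
  finally show ?thesis .
qed

lemma continuous_curl_m: "continuous_on UNIV (\<lambda>x. (m x - e3) \<bullet> curl Dm x)"
  unfolding inner_vec_def[of "m _ - e3"] sum_3 curl_components vector_minus_component
  by (intro continuous_intros C1_deriv_continuous[OF C1_deriv_m] C1_deriv_continuous_deriv[OF C1_deriv_m])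

lemma integrable_helicity_m: "integrable lborel (\<lambda>x. (m x - e3) \<bullet> curl Dm x)"
  by (rule integrable_continuous_outside[OF continuous_curl_m]) (simp add: m_outside)

lemma energy_space_m: "energy_space m Dm"
  unfolding energy_space_def
proof (intro conjI allI)
  show "m \<in> borel_measurable lborel"
    using continuous_m by (simp add: borel_measurable_continuous_onI)
  show "integrable lborel (\<lambda>x. \<Sum>i\<in>UNIV. (norm (Dm i x))\<^sup>2)"
    by (intro integrable_continuous_outside continuous_intros continuous_m) (simp add: m_outside)
  show "integrable lborel (\<lambda>x. (1 - m x $ 3)\<^sup>2)"
    by (intro integrable_continuous_outside continuous_intros C1_deriv_continuous[OF C1_deriv_m])
      (simp add: m_outside e3_components)
qed (rule norm_m weak_pderiv_m)+

lemma degree_m: "degree m Dm = \<sigma> * \<tau>"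
proof -
  have "(\<integral>x. m x \<bullet> cross3 (Dm 1 x) (Dm 2 x) \<partial>lborel) = 2 * \<sigma> * \<tau> * (\<integral>x. \<beta>' ((x::real^2) \<bullet> x) \<partial>lborel)"
    by (simp add: degree_density_m)
  also have "\<dots> = 2 * \<sigma> * \<tau> * (pi * 2)"
    by (subst integral_radial[where L = L]) (auto simp: outside_profile integral_\<beta>')
  finally show ?thesis by (simp add: degree_def)
qed

text \<open>The \<beta>' part integrates exactly to 4 pi. The excess is controlled by |b'| \<le> 2 a
  / L and s w \<le> 1 on an interval of length L, hence is of order 1 / L.\<close>

lemma Dir_m: "Dir Dm \<le> 4 * pi + 32 * pi * a\<^sup>2 / L"
proof -
  let ?f = "\<lambda>s. 4 * \<beta>' s + 16 * (b' s)\<^sup>2 * s\<^sup>2 * (w s)\<^sup>2"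
  have i1: "integrable lborel (\<lambda>s. \<beta>' s * indicator {0..L} s)"
    using borel_integrable_atLeastAtMost[of 0 L \<beta>'] continuous_profile by simp
  have i2: "integrable lborel (\<lambda>s. (16 * (b' s)\<^sup>2 * s\<^sup>2 * (w s)\<^sup>2) * indicator {0..L} s)"
    by (rule borel_integrable_atLeastAtMost) (intro continuous_intros continuous_b' continuous_profile, auto)
  have "Dir Dm = (1/2) * (\<integral>x. ?f ((x::real^2) \<bullet> x) \<partial>lborel)"
    by (simp add: Dir_def Dirichlet_density_m)
  also have "\<dots> = (1/2) * (pi * (\<integral>s. ?f s * indicator {0..L} s \<partial>lborel))"
    by (subst integral_radial[where L = L]) (auto simp: outside_profile outside)
  also have "(\<integral>s. ?f s * indicator {0..L} s \<partial>lborel)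
    = (\<integral>s. 4 * (\<beta>' s * indicator {0..L} s) + (16 * (b' s)\<^sup>2 * s\<^sup>2 * (w s)\<^sup>2) * indicator {0..L} s \<partial>lborel)"
    by (intro Bochner_Integration.integral_cong) (auto simp: algebra_simps)
  also have "\<dots> = 8 + (\<integral>s. (16 * (b' s)\<^sup>2 * s\<^sup>2 * (w s)\<^sup>2) * indicator {0..L} s \<partial>lborel)"
    using i1 i2 by (simp add: integral_\<beta>')
  also have "(\<integral>s. (16 * (b' s)\<^sup>2 * s\<^sup>2 * (w s)\<^sup>2) * indicator {0..L} s \<partial>lborel)
    \<le> (\<integral>s. (64 * a\<^sup>2 / L\<^sup>2) * indicator {0..L} s \<partial>lborel)"
  proof (intro integral_mono i2)
    show "integrable lborel (\<lambda>s. (64 * a\<^sup>2 / L\<^sup>2) * indicator {0..L} s)"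
      by (intro integrable_mult_right integrable_real_indicator) (auto simp: emeasure_lborel_Icc_eq)
    fix s
    have "16 * (b' s)\<^sup>2 * s\<^sup>2 * (w s)\<^sup>2 \<le> 64 * a\<^sup>2 / L\<^sup>2" if s: "0 \<le> s"
    proof -
      have "s * w s \<le> 1"
        using w_denom[OF s] w_pos[OF s] by (simp add: algebra_simps) (smt (verit) mult_nonneg_nonneg zero_le_power2)
      then have "(s * w s)\<^sup>2 \<le> 1" using s w_pos[OF s] by (simp add: power_le_one)
      then have "16 * (b' s)\<^sup>2 * (s * w s)\<^sup>2 \<le> 16 * (4 * a\<^sup>2 / L\<^sup>2) * 1"
        using b'_power2_le[OF s] by (intro mult_mono) auto
      then show ?thesis by (simp add: power_mult_distrib mult.assoc)
    qed
    then show "(16 * (b' s)\<^sup>2 * s\<^sup>2 * (w s)\<^sup>2) * indicator {0..L} s \<le> (64 * a\<^sup>2 / L\<^sup>2) * indicator {0..L} s"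
      by (auto simp: indicator_def)
  qed
  also have "(\<integral>s. (64 * a\<^sup>2 / L\<^sup>2) * indicator {0..L} s \<partial>lborel) = 64 * a\<^sup>2 / L"
    using L by (simp add: power2_eq_square field_simps)
  finally show ?thesis by (simp add: algebra_simps)
qed

text \<open>1 - \<beta> = 2 b^2 / (s + b^2) increases with b, so b \<le> a bounds it by the
  untruncated profile, whose potential energy is 2 pi a^2.\<close>

lemma Pot_m: "Pot m \<le> 2 * pi * a\<^sup>2"
proof -
  have le: "(1 - \<beta> s)\<^sup>2 \<le> 4 * a^4 / (s + a\<^sup>2)\<^sup>2" if s: "0 \<le> s" for s
  proof -
    have ps: "0 < s + a\<^sup>2" using a s by (simp add: add_nonneg_pos)
    have "(b s)\<^sup>2 \<le> a\<^sup>2" using b_le[OF s] b_nonneg[of s] by (simp add: power_mono)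
    then have "(b s)\<^sup>2 / (s + (b s)\<^sup>2) \<le> a\<^sup>2 / (s + a\<^sup>2)"
      using ps denom_pos[OF s] s by (simp add: divide_le_eq field_simps mult_left_mono)
    then have "1 - \<beta> s \<le> 2 * a\<^sup>2 / (s + a\<^sup>2)" by (simp add: \<beta>_def w_def field_simps)
    moreover have "0 \<le> 1 - \<beta> s" using w_pos[OF s] by (simp add: \<beta>_def)
    ultimately have "(1 - \<beta> s)\<^sup>2 \<le> (2 * a\<^sup>2 / (s + a\<^sup>2))\<^sup>2" by (intro power_mono)
    also have "\<dots> = 4 * a^4 / (s + a\<^sup>2)\<^sup>2" by (simp add: power_divide power_mult_distrib flip: power_mult)
    finally show ?thesis .
  qed
  have pos: "s + a\<^sup>2 \<noteq> 0" if "0 \<le> s" for s using a that by (smt (verit) zero_less_power)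
  have FTC: "has_bochner_integral lborel (\<lambda>s. (4 * a^4 / (s + a\<^sup>2)\<^sup>2) * indicator {0..L} s)
     (- 4 * a^4 / (L + a\<^sup>2) - (- 4 * a^4 / (0 + a\<^sup>2)))"
    using L by (intro has_bochner_integral_FTC_Icc_real)
      (auto intro!: derivative_eq_intros continuous_intros simp: pos pos[unfolded power2_eq_square] power2_eq_square)
  have "Pot m = (1/2) * (\<integral>x. (1 - \<beta> ((x::real^2) \<bullet> x))\<^sup>2 \<partial>lborel)"
    by (simp add: Pot_def m_def)
  also have "\<dots> = (1/2) * (pi * (\<integral>s. (1 - \<beta> s)\<^sup>2 * indicator {0..L} s \<partial>lborel))"
    by (subst integral_radial[where L = L]) (auto simp: outside_profile)
  also have "(\<integral>s. (1 - \<beta> s)\<^sup>2 * indicator {0..L} s \<partial>lborel) \<le> (\<integral>s. (4 * a^4 / (s + a\<^sup>2)\<^sup>2) * indicator {0..L} s \<partial>lborel)"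
  proof (intro integral_mono)
    show "integrable lborel (\<lambda>s. (1 - \<beta> s)\<^sup>2 * indicator {0..L} s)"
      by (rule borel_integrable_atLeastAtMost) (intro continuous_intros continuous_profile, auto)
    show "integrable lborel (\<lambda>s. (4 * a^4 / (s + a\<^sup>2)\<^sup>2) * indicator {0..L} s)"
      using FTC by (simp add: has_bochner_integral_iff)
  qed (use le in \<open>auto simp: indicator_def\<close>)
  also have "\<dots> = - 4 * a^4 / (L + a\<^sup>2) - (- 4 * a^4 / (0 + a\<^sup>2))"
    using FTC by (simp only: has_bochner_integral_iff)
  also have "\<dots> \<le> 4 * a\<^sup>2"
    using a L by (simp add: power4_eq_xxxx power2_eq_square)
  finally show ?thesis by simp
qed

end

section \<open>Energies of localized fields\<close>

context bubble
begin

text \<open>The bound tends to -8 pi a as M grows. Two scales are used: the cutoff acts at s = L =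
  M^2, but the integral is estimated only over s \<le> M, where b is still close to a.\<close>

lemma Helic_m_Bloch:
  assumes st: "\<sigma> = -1" "\<tau> = 1" and M: "1 \<le> M" "L = M\<^sup>2"
  shows "Helic m Dm \<le> - 8 * pi * a * (1 - 1 / M)^6 * (M / (M + a\<^sup>2))\<^sup>2"
proof -
  \<comment> \<open>\<open>?g\<close> vanishes at 0 and at L, so its derivative integrates to 0 and
    leaves -4 \<open>?k\<close>, which has a definite sign.\<close>
  let ?g = "\<lambda>s. s * \<alpha> s * (1 - \<beta> s)"
  let ?g' = "\<lambda>s. (\<alpha> s + s * \<alpha>' s) * (1 - \<beta> s) - s * \<alpha> s * \<beta>' s"
  let ?k = "\<lambda>s. s * \<alpha> s * \<beta>' s"
  let ?f = "\<lambda>s. -2 * ?g' s - 4 * ?k s"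
  define q where "q = 1 - 1 / M"
  have q: "0 \<le> q" using M by (simp add: q_def)
  have M_le_L: "M \<le> L" using M by (simp add: power2_eq_square)
  have "(m x - e3) \<bullet> curl Dm x = ?f (x \<bullet> x)" for x
    using helicity_density_m[of x] inner_self_2[of x] st by algebra
  then have "Helic m Dm = (\<integral>x. ?f ((x::real^2) \<bullet> x) \<partial>lborel)"
    by (simp add: Helic_def)
  also have "\<dots> = pi * (\<integral>s. ?f s * indicator {0..L} s \<partial>lborel)"
    by (rule integral_radial) (auto simp: outside_profile)
  also have "(\<integral>s. ?f s * indicator {0..L} s \<partial>lborel)
     = (\<integral>s. -2 * (?g' s * indicator {0..L} s) - 4 * (?k s * indicator {0..L} s) \<partial>lborel)"
    by (intro Bochner_Integration.integral_cong) (auto simp: algebra_simps)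
  also have "\<dots> = - 4 * (\<integral>s. ?k s * indicator {0..L} s \<partial>lborel)"
  proof -
    have "has_bochner_integral lborel (\<lambda>s. ?g' s * indicator {0..L} s) (?g L - ?g 0)"
    proof (rule has_bochner_integral_FTC_Icc_real)
      fix s assume s: "0 \<le> s" "s \<le> L"
      show "(?g has_real_derivative ?g' s) (at s)"
        using s by (auto intro!: derivative_eq_intros DERIV_\<alpha> DERIV_\<beta> simp: algebra_simps)
      show "isCont ?g' s" using s by (intro continuous_intros continuous_profile) auto
    qed (use L in auto)
    then have g: "integrable lborel (\<lambda>s. ?g' s * indicator {0..L} s)" "(\<integral>s. ?g' s * indicator {0..L} s \<partial>lborel) = 0"
      using outside_profile(1)[of L] by (auto simp: has_bochner_integral_iff)
    have k: "integrable lborel (\<lambda>s. ?k s * indicator {0..L} s)"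
      by (rule borel_integrable_atLeastAtMost) (intro continuous_intros continuous_profile, auto)
    show ?thesis using g k by simp
  qed
  finally have H: "Helic m Dm = - 4 * pi * (\<integral>s. ?k s * indicator {0..L} s \<partial>lborel)" by simp
  have k0: "4 * (b s)^3 * s * (w s)^3 \<le> ?k s" if s: "0 \<le> s" for s
  proof -
    have "b s * b' s * s \<le> 0"
      using mult_nonneg_nonpos[OF mult_nonneg_nonneg[OF b_nonneg s] b'_nonpos, of s s] by (simp add: mult_ac)
    then have "2 * (b s)\<^sup>2 * (w s)\<^sup>2 \<le> \<beta>' s"
      unfolding \<beta>'_eq[OF s] by (intro mult_right_mono) (auto simp: mult_ac)
    then have "s * \<alpha> s * (2 * (b s)\<^sup>2 * (w s)\<^sup>2) \<le> ?k s"
      using s b_nonneg[of s] w_pos[OF s] by (intro mult_left_mono) (auto simp: \<alpha>_def)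
    then show ?thesis by (simp add: \<alpha>_def power2_eq_square power3_eq_cube mult_ac)
  qed
  have pos: "0 < s + a\<^sup>2" if "0 \<le> s" for s using a that by (simp add: add_nonneg_pos)
  \<comment> \<open>For s \<le> M the cutoff factor 1 - s / L is at least q, so b \<ge> a q^2; b
    enters cubed, whence q^6.\<close>
  have k1: "4 * a^3 * q^6 * (s / (s + a\<^sup>2)^3) \<le> ?k s" if s: "0 \<le> s" "s \<le> M" for s
  proof -
    have "s / L \<le> 1 / M"
      using s M by (simp add: power2_eq_square field_simps)
    then have "q \<le> max 0 (1 - s / L)" by (simp add: q_def)
    then have "a * q\<^sup>2 \<le> b s"
      unfolding b_def using a q by (intro mult_left_mono power_mono) auto
    then have "(a * q\<^sup>2)^3 \<le> (b s)^3" using a q by (intro power_mono) auto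
    moreover have "inverse (s + a\<^sup>2) \<le> w s"
      unfolding w_def using denom_pos[OF s(1)] power_mono[OF b_le[OF s(1)] b_nonneg, of 2]
      by (intro le_imp_inverse_le) auto
    then have "(inverse (s + a\<^sup>2))^3 \<le> (w s)^3" using pos[OF s(1)] by (intro power_mono) auto
    ultimately have "(a * q\<^sup>2)^3 * (inverse (s + a\<^sup>2))^3 \<le> (b s)^3 * (w s)^3"
      using a q b_nonneg[of s] pos[OF s(1)] by (intro mult_mono) auto
    then have "4 * s * ((a * q\<^sup>2)^3 * (inverse (s + a\<^sup>2))^3) \<le> 4 * s * ((b s)^3 * (w s)^3)"
      using s by (intro mult_left_mono) auto
    also have "\<dots> \<le> ?k s" using k0[OF s(1)] by (simp add: mult_ac)
    finally show ?thesis
      by (simp add: power_mult_distrib divide_inverse power_inverse mult_ac flip: power_mult)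
  qed
  \<comment> \<open>The value tends to 1 / (2 a^2) as M grows, which turns the prefactor 4 pi * 4
    a^3 into 8 pi a.\<close>
  have FTC: "has_bochner_integral lborel (\<lambda>s. (s / (s + a\<^sup>2)^3) * indicator {0..M} s)
     (M\<^sup>2 / (2 * a\<^sup>2 * (M + a\<^sup>2)\<^sup>2) - 0\<^sup>2 / (2 * a\<^sup>2 * (0 + a\<^sup>2)\<^sup>2))"
  proof (rule has_bochner_integral_FTC_Icc_real)
    fix s assume s: "0 \<le> s" "s \<le> M"
    have nz: "s + a\<^sup>2 \<noteq> 0" "a \<noteq> 0" using pos[OF s(1)] a by auto
    have "((\<lambda>s. s\<^sup>2 / (2 * a\<^sup>2 * (s + a\<^sup>2)\<^sup>2)) has_real_derivative
      (2 * s * (2 * a\<^sup>2 * (s + a\<^sup>2)\<^sup>2) - s\<^sup>2 * (2 * a\<^sup>2 * (2 * (s + a\<^sup>2)))) / ((2 * a\<^sup>2 * (s + a\<^sup>2)\<^sup>2) * (2 * a\<^sup>2 * (s + a\<^sup>2)\<^sup>2))) (at s)"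
      using nz by (auto intro!: derivative_eq_intros)
    also have "(2 * s * (2 * a\<^sup>2 * (s + a\<^sup>2)\<^sup>2) - s\<^sup>2 * (2 * a\<^sup>2 * (2 * (s + a\<^sup>2)))) / ((2 * a\<^sup>2 * (s + a\<^sup>2)\<^sup>2) * (2 * a\<^sup>2 * (s + a\<^sup>2)\<^sup>2))
      = s / (s + a\<^sup>2)^3"
      using nz by (subst frac_eq_eq) (auto, algebra)
    finally show "((\<lambda>s. s\<^sup>2 / (2 * a\<^sup>2 * (s + a\<^sup>2)\<^sup>2)) has_real_derivative s / (s + a\<^sup>2)^3) (at s)" .
    show "isCont (\<lambda>s. s / (s + a\<^sup>2)^3) s" using nz by (intro continuous_intros) auto
  qed (use M in auto)
  have "4 * a^3 * q^6 * (M\<^sup>2 / (2 * a\<^sup>2 * (M + a\<^sup>2)\<^sup>2))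
    = (\<integral>s. 4 * a^3 * q^6 * ((s / (s + a\<^sup>2)^3) * indicator {0..M} s) \<partial>lborel)"
    by (subst integral_mult_right_zero, subst has_bochner_integral_integral_eq[OF FTC]) simp
  also have "\<dots> \<le> (\<integral>s. ?k s * indicator {0..L} s \<partial>lborel)"
  proof (rule integral_mono)
    show "integrable lborel (\<lambda>s. 4 * a^3 * q^6 * ((s / (s + a\<^sup>2)^3) * indicator {0..M} s))"
      using FTC by (intro integrable_mult_right) (simp only: has_bochner_integral_iff)
    show "integrable lborel (\<lambda>s. ?k s * indicator {0..L} s)"
      by (rule borel_integrable_atLeastAtMost) (intro continuous_intros continuous_profile, auto)
    fix s :: real
    have "0 \<le> ?k s" if "0 \<le> s"
      using that b_nonneg[of s] w_pos[OF that] by (intro order_trans[OF _ k0[OF that]]) auto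
    then show "4 * a^3 * q^6 * ((s / (s + a\<^sup>2)^3) * indicator {0..M} s) \<le> ?k s * indicator {0..L} s"
      using k1[of s] M_le_L by (auto simp: indicator_def)
  qed
  finally have "4 * pi * (4 * a^3 * q^6 * (M\<^sup>2 / (2 * a\<^sup>2 * (M + a\<^sup>2)\<^sup>2))) \<le> 4 * pi * (\<integral>s. ?k s * indicator {0..L} s \<partial>lborel)"
    by (intro mult_left_mono) auto
  moreover have "4 * pi * (4 * a^3 * q^6 * (M\<^sup>2 / (2 * a\<^sup>2 * (M + a\<^sup>2)\<^sup>2))) = 8 * pi * a * q^6 * (M / (M + a\<^sup>2))\<^sup>2"
    using a by (simp add: power_divide power2_eq_square power3_eq_cube)
  ultimately show ?thesis unfolding H q_def by simp
qed

end

text \<open>Integrability of the helicity density is part of the notion because additivity of the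
  Bochner integral under gluing relies on it.\<close>

definition localized_field :: "(real^2 \<Rightarrow> real^3) \<Rightarrow> (2 \<Rightarrow> real^2 \<Rightarrow> real^3) \<Rightarrow> real \<Rightarrow> bool" where
  "localized_field n Dn R \<longleftrightarrow> energy_space n Dn \<and> integrable lborel (\<lambda>x. (n x - e3) \<bullet> curl Dn x)
     \<and> (\<forall>x. R \<le> norm x \<longrightarrow> n x = e3 \<and> (\<forall>i. Dn i x = 0))"

lemma (in bubble) localized_field_m: "localized_field m Dm (sqrt L)"
proof -
  have "L \<le> x \<bullet> x" if "sqrt L \<le> norm x" for x :: "real^2"
    using that by (simp add: norm_eq_sqrt_inner)
  then show ?thesis
    unfolding localized_field_def using energy_space_m integrable_helicity_m m_outside by blast
qed

lemma localized_skyrmion: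
  assumes r: "0 < r" and \<epsilon>: "0 < \<epsilon>"
  obtains n Dn R where "localized_field n Dn R" "degree n Dn = -1" "Energy r n Dn \<le> 4 * pi * (1 - 2 * r\<^sup>2) + \<epsilon>"
proof -
  define a where "a = 2 * r"
  have a: "0 < a" using r by (simp add: a_def)
  \<comment> \<open>The sum of the three energy bounds as a function of i = 1 / M; at i = 0 it is 4
    pi - 8 pi r a + 2 pi a^2.\<close>
  let ?F = "\<lambda>i. 4 * pi + 32 * pi * a\<^sup>2 * i\<^sup>2 + r * (- 8 * pi * a * (1 - i)^6 * (1 / (1 + a\<^sup>2 * i))\<^sup>2) + 2 * pi * a\<^sup>2"
  have "(\<lambda>k. ?F (inverse (real (Suc k)))) \<longlonglongrightarrow> ?F 0"
    by (intro tendsto_intros LIMSEQ_inverse_real_of_nat) auto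
  moreover have "?F 0 < 4 * pi * (1 - 2 * r\<^sup>2) + \<epsilon>"
    using \<epsilon> by (simp add: a_def power2_eq_square algebra_simps)
  ultimately have "\<forall>\<^sub>F k in sequentially. ?F (inverse (real (Suc k))) < 4 * pi * (1 - 2 * r\<^sup>2) + \<epsilon>"
    by (rule order_tendstoD)
  then obtain k where k: "?F (inverse (real (Suc k))) < 4 * pi * (1 - 2 * r\<^sup>2) + \<epsilon>"
    using eventually_happens by fastforce
  define M where "M = real (Suc k)"
  have M: "1 \<le> M" by (simp add: M_def)
  interpret bubble a "M\<^sup>2" "-1" 1
    by unfold_locales (use a M in auto)
  have "Energy r m Dm \<le> (4 * pi + 32 * pi * a\<^sup>2 / M\<^sup>2) + r * (- 8 * pi * a * (1 - 1 / M)^6 * (M / (M + a\<^sup>2))\<^sup>2) + 2 * pi * a\<^sup>2"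
    unfolding Energy_def using r
    by (intro add_mono Dir_m Pot_m mult_left_mono Helic_m_Bloch M) auto
  also have "\<dots> = ?F (inverse M)"
  proof -
    have "M / (M + a\<^sup>2) = 1 / (1 + a\<^sup>2 * inverse M)"
      using M by (simp add: field_simps)
    then show ?thesis by (simp add: divide_inverse power_inverse)
  qed
  also have "\<dots> < 4 * pi * (1 - 2 * r\<^sup>2) + \<epsilon>" using k by (simp only: M_def)
  finally show ?thesis
    using that[OF localized_field_m] degree_m by simp
qed

text \<open>The fields with \<sigma> = \<tau> = 1 and \<sigma> = \<tau> = -1 have opposite
  helicities, so one of them has H \<le> 0. With the cutoff fixed, the bounds on D and V tend to 4
  pi and 0 as a shrinks.\<close>

lemma localized_antiskyrmion:
  assumes r: "0 < r" and \<epsilon>: "0 < \<epsilon>"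
  obtains n Dn R where "localized_field n Dn R" "degree n Dn = 1" "Energy r n Dn \<le> 4 * pi + \<epsilon>"
proof -
  \<comment> \<open>The divisor 1 is the cutoff L, and \<open>r * 0\<close> bounds the helicity
    term.\<close>
  let ?F = "\<lambda>a. 4 * pi + 32 * pi * a\<^sup>2 / 1 + r * 0 + 2 * pi * a\<^sup>2"
  have "(\<lambda>k. ?F (inverse (real (Suc k)))) \<longlonglongrightarrow> ?F 0"
    by (intro tendsto_intros LIMSEQ_inverse_real_of_nat) auto
  moreover have "?F 0 < 4 * pi + \<epsilon>" using \<epsilon> by simp
  ultimately have "\<forall>\<^sub>F k in sequentially. ?F (inverse (real (Suc k))) < 4 * pi + \<epsilon>"
    by (rule order_tendstoD)
  then obtain k where k: "?F (inverse (real (Suc k))) < 4 * pi + \<epsilon>"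
    using eventually_happens by fastforce
  define a where "a = inverse (real (Suc k))"
  interpret P: bubble a 1 1 1 by unfold_locales (auto simp: a_def)
  interpret N: bubble a 1 "-1" "-1" by unfold_locales (auto simp: a_def)
  have "Helic N.m N.Dm = - Helic P.m P.Dm"
    unfolding Helic_def P.helicity_density_m N.helicity_density_m
    by (subst Bochner_Integration.integral_minus[symmetric]) (intro Bochner_Integration.integral_cong, auto simp: algebra_simps)
  then consider "Helic P.m P.Dm \<le> 0" | "Helic N.m N.Dm \<le> 0" by linarith
  then show ?thesis
  proof cases
    case 1
    have "Energy r P.m P.Dm \<le> ?F a"
      unfolding Energy_def using r 1 by (intro add_mono P.Dir_m P.Pot_m mult_left_mono) auto
    then show ?thesis using k that[OF P.localized_field_m] P.degree_m unfolding a_def by simp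
  next
    case 2
    have "Energy r N.m N.Dm \<le> ?F a"
      unfolding Energy_def using r 2 by (intro add_mono N.Dir_m N.Pot_m mult_left_mono) auto
    then show ?thesis using k that[OF N.localized_field_m] N.degree_m unfolding a_def by simp
  qed
qed

section \<open>Superposition of distant fields\<close>

lemma curl_shift: "curl (\<lambda>i x. Dn i (x + c)) x = curl Dn (x + c)"
  by (simp add: curl_def)

lemma measurable_curl[measurable]:
  assumes [measurable]: "\<And>i. Dn i \<in> borel_measurable borel"
  shows "curl Dn \<in> borel_measurable borel"
proof -
  have "(\<lambda>x. \<Sum>j\<in>UNIV. curl Dn x $ j *\<^sub>R axis j (1::real)) \<in> borel_measurable borel"
    unfolding sum_3 curl_components by measurable
  moreover have "(\<Sum>j\<in>UNIV. v $ j *\<^sub>R axis j 1) = v" for v :: "real^3"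
    by (simp add: vec_eq_iff axis_def sum_3 forall_3)
  ultimately show ?thesis by simp
qed

text \<open>Weak derivatives of the translated map are tested by translating the test function the
  opposite way.\<close>

lemma energy_space_shift:
  assumes E: "energy_space n Dn"
  shows "energy_space (\<lambda>x. n (x + c)) (\<lambda>i x. Dn i (x + c))"
  unfolding energy_space_def
proof (intro conjI allI)
  note [measurable] = energy_spaceD(1,2)[OF E]
  show "(\<lambda>x. n (x + c)) \<in> borel_measurable lborel" by simp
  show "norm (n (x + c)) = 1" for x by (rule energy_spaceD(3)[OF E])
  show "integrable lborel (\<lambda>x. \<Sum>i\<in>UNIV. (norm (Dn i (x + c)))\<^sup>2)"
    by (rule integrable_shift[OF energy_space_integrable_Dir[OF E]])
  show "integrable lborel (\<lambda>x. (1 - n (x + c) $ 3)\<^sup>2)"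
    by (rule integrable_shift[OF energy_spaceD(6)[OF E]])
  fix i
  show "weak_pderiv (\<lambda>x. n (x + c)) i (\<lambda>x. Dn i (x + c))"
    unfolding weak_pderiv_def
  proof (intro conjI allI impI)
    show "(\<lambda>x. Dn i (x + c)) \<in> borel_measurable lborel" by simp
    fix \<phi> assume T: "test_fun \<phi>"
    note [measurable] = test_fun_measurable[OF T]
    let ?\<psi> = "\<lambda>x. \<phi> (x + (- c))"
    have C: "C1_deriv ?\<psi> (\<lambda>i x. pderiv2 \<phi> i (x + (- c)))"
      by (rule C1_deriv_shift[OF test_fun_C1_deriv[OF T]])
    have "{x. ?\<psi> x \<noteq> 0} = (\<lambda>x. x + c) ` {x. \<phi> x \<noteq> 0}"
      by (auto intro!: image_eqI[where x = "y - c" for y])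
    then have B: "bounded {x. ?\<psi> x \<noteq> 0}"
      using T bounded_translation[of "{x. \<phi> x \<noteq> 0}" c] by (simp add: test_fun_def add.commute)
    note P = C1_deriv_test_fun[OF C B]
    have "(\<integral>x. pderiv2 \<phi> i x *\<^sub>R n (x + c) \<partial>lborel) = (\<integral>x. pderiv2 ?\<psi> i x *\<^sub>R n x \<partial>lborel)"
      unfolding P(2) using integral_shift[of "\<lambda>x. pderiv2 \<phi> i x *\<^sub>R n (x + c)" "- c"] by simp
    also have "\<dots> = - (\<integral>x. ?\<psi> x *\<^sub>R Dn i x \<partial>lborel)"
      using E P(1) by (simp add: energy_space_def weak_pderiv_def)
    also have "(\<integral>x. ?\<psi> x *\<^sub>R Dn i x \<partial>lborel) = (\<integral>x. \<phi> x *\<^sub>R Dn i (x + c) \<partial>lborel)"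
      using integral_shift[of "\<lambda>x. \<phi> x *\<^sub>R Dn i (x + c)" "- c"] by simp
    finally show "(\<integral>x. pderiv2 \<phi> i x *\<^sub>R n (x + c) \<partial>lborel) = - (\<integral>x. \<phi> x *\<^sub>R Dn i (x + c) \<partial>lborel)" .
  qed
qed

lemma energy_space_e3: "energy_space (\<lambda>x. e3) (\<lambda>i x. 0)"
proof -
  have "weak_pderiv (\<lambda>x. e3) i ((\<lambda>i x. 0) i)" for i
    by (rule weak_pderiv_C1) (use C1_deriv_const in simp)
  moreover have "norm e3 = 1"
    using norm_3_power2[of e3] norm_ge_zero[of e3] by (simp add: e3_components power2_eq_1_iff)
  ultimately show ?thesis by (simp add: energy_space_def e3_components)
qed

text \<open>At every point one of the maps is e3 with zero derivatives, so the combined map equals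
  the other one there: it stays on the sphere, and all four densities add. Being a linear
  combination, it inherits its weak derivatives directly.\<close>

lemma superposition:
  fixes n\<^sub>1 n\<^sub>2 :: "real^2 \<Rightarrow> real^3" and D\<^sub>1 D\<^sub>2 :: "2 \<Rightarrow> real^2 \<Rightarrow> real^3"
  assumes E: "energy_space n\<^sub>1 D\<^sub>1" "energy_space n\<^sub>2 D\<^sub>2"
    and H: "integrable lborel (\<lambda>x. (n\<^sub>1 x - e3) \<bullet> curl D\<^sub>1 x)" "integrable lborel (\<lambda>x. (n\<^sub>2 x - e3) \<bullet> curl D\<^sub>2 x)"
    and sep: "\<And>x. (n\<^sub>1 x = e3 \<and> (\<forall>i. D\<^sub>1 i x = 0)) \<or> (n\<^sub>2 x = e3 \<and> (\<forall>i. D\<^sub>2 i x = 0))"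
  defines "n \<equiv> \<lambda>x. n\<^sub>1 x + n\<^sub>2 x - e3" and "D \<equiv> \<lambda>i x. D\<^sub>1 i x + D\<^sub>2 i x"
  shows "energy_space n D" "integrable lborel (\<lambda>x. (n x - e3) \<bullet> curl D x)"
    and "degree n D = degree n\<^sub>1 D\<^sub>1 + degree n\<^sub>2 D\<^sub>2"
    and "Energy r n D = Energy r n\<^sub>1 D\<^sub>1 + Energy r n\<^sub>2 D\<^sub>2"
proof -
  note i1 = energy_space_integrable_Dir[OF E(1)] energy_spaceD(6)[OF E(1)] energy_space_integrable_degree[OF E(1)] H(1)
  note i2 = energy_space_integrable_Dir[OF E(2)] energy_spaceD(6)[OF E(2)] energy_space_integrable_degree[OF E(2)] H(2)
  have cases: "(n x = n\<^sub>1 x \<and> (\<forall>i. D i x = D\<^sub>1 i x) \<and> n\<^sub>2 x = e3 \<and> (\<forall>i. D\<^sub>2 i x = 0))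
      \<or> (n x = n\<^sub>2 x \<and> (\<forall>i. D i x = D\<^sub>2 i x) \<and> n\<^sub>1 x = e3 \<and> (\<forall>i. D\<^sub>1 i x = 0))" for x
    using sep[of x] by (auto simp: n_def D_def)
  have curl: "curl D x = curl D' x" if "\<forall>i. D i x = D' i x" for D' and x :: "real^2"
    using that by (simp add: curl_def)
  have curl0: "curl D' x = 0" if "\<forall>i. D' i x = 0" for D' and x :: "real^2"
    using that by (simp add: curl_def vec_eq_iff forall_3)
  have dens:
    "(\<Sum>i\<in>UNIV. (norm (D i x))\<^sup>2) = (\<Sum>i\<in>UNIV. (norm (D\<^sub>1 i x))\<^sup>2) + (\<Sum>i\<in>UNIV. (norm (D\<^sub>2 i x))\<^sup>2)"
    "(1 - n x $ 3)\<^sup>2 = (1 - n\<^sub>1 x $ 3)\<^sup>2 + (1 - n\<^sub>2 x $ 3)\<^sup>2"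
    "n x \<bullet> cross3 (D 1 x) (D 2 x) = n\<^sub>1 x \<bullet> cross3 (D\<^sub>1 1 x) (D\<^sub>1 2 x) + n\<^sub>2 x \<bullet> cross3 (D\<^sub>2 1 x) (D\<^sub>2 2 x)"
    "(n x - e3) \<bullet> curl D x = (n\<^sub>1 x - e3) \<bullet> curl D\<^sub>1 x + (n\<^sub>2 x - e3) \<bullet> curl D\<^sub>2 x" for x
    using cases[of x] curl[of x D\<^sub>1] curl[of x D\<^sub>2] curl0[of D\<^sub>1 x] curl0[of D\<^sub>2 x] by (auto simp: e3_components)
  show "integrable lborel (\<lambda>x. (n x - e3) \<bullet> curl D x)"
    unfolding dens by (intro Bochner_Integration.integrable_add i1 i2)
  show "degree n D = degree n\<^sub>1 D\<^sub>1 + degree n\<^sub>2 D\<^sub>2"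
    unfolding degree_def dens using i1 i2 by (simp add: distrib_left)
  show "Energy r n D = Energy r n\<^sub>1 D\<^sub>1 + Energy r n\<^sub>2 D\<^sub>2"
    unfolding Energy_def Dir_def Helic_def Pot_def dens using i1 i2 by (simp add: distrib_left)
  show "energy_space n D"
    unfolding energy_space_def
  proof (intro conjI allI)
    note [measurable] = energy_spaceD(1,2)[OF E(1)] energy_spaceD(1,2)[OF E(2)]
    show "n \<in> borel_measurable lborel" by (simp add: n_def)
    show "norm (n x) = 1" for x
      using cases[of x] energy_spaceD(3)[OF E(1)] energy_spaceD(3)[OF E(2)] by auto
    show "integrable lborel (\<lambda>x. \<Sum>i\<in>UNIV. (norm (D i x))\<^sup>2)" "integrable lborel (\<lambda>x. (1 - n x $ 3)\<^sup>2)"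
      unfolding dens by (intro Bochner_Integration.integrable_add i1 i2)+
    fix i
    show "weak_pderiv n i (D i)"
      unfolding weak_pderiv_def
    proof (intro conjI allI impI)
      show "D i \<in> borel_measurable lborel" by (simp add: D_def)
      fix \<phi> assume T: "test_fun \<phi>"
      note t1 = energy_space_integrable_test[OF E(1) T] and t2 = energy_space_integrable_test[OF E(2) T]
        and t3 = energy_space_integrable_test[OF energy_space_e3 T]
      have w: "(\<integral>x. pderiv2 \<phi> i x *\<^sub>R n' x \<partial>lborel) = - (\<integral>x. \<phi> x *\<^sub>R D' i x \<partial>lborel)"
        if "energy_space n' D'" for n' D'
        using that T by (simp add: energy_space_def weak_pderiv_def)
      have "(\<integral>x. pderiv2 \<phi> i x *\<^sub>R n x \<partial>lborel)
        = (\<integral>x. pderiv2 \<phi> i x *\<^sub>R n\<^sub>1 x + pderiv2 \<phi> i x *\<^sub>R n\<^sub>2 x - pderiv2 \<phi> i x *\<^sub>R e3 \<partial>lborel)"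
        by (simp add: n_def algebra_simps)
      also have "\<dots> = (\<integral>x. pderiv2 \<phi> i x *\<^sub>R n\<^sub>1 x \<partial>lborel) + (\<integral>x. pderiv2 \<phi> i x *\<^sub>R n\<^sub>2 x \<partial>lborel)
          - (\<integral>x. pderiv2 \<phi> i x *\<^sub>R e3 \<partial>lborel)"
        using t1(2)[of i] t2(2)[of i] t3(2)[of i] by simp
      also have "\<dots> = - ((\<integral>x. \<phi> x *\<^sub>R D\<^sub>1 i x \<partial>lborel) + (\<integral>x. \<phi> x *\<^sub>R D\<^sub>2 i x \<partial>lborel))"
        unfolding w[OF E(1)] w[OF E(2)] w[OF energy_space_e3] by simp
      also have "(\<integral>x. \<phi> x *\<^sub>R D\<^sub>1 i x \<partial>lborel) + (\<integral>x. \<phi> x *\<^sub>R D\<^sub>2 i x \<partial>lborel) = (\<integral>x. \<phi> x *\<^sub>R D i x \<partial>lborel)"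
        unfolding D_def scaleR_add_right using t1(1)[of i] t2(1)[of i] by simp
      finally show "(\<integral>x. pderiv2 \<phi> i x *\<^sub>R n x \<partial>lborel) = - (\<integral>x. \<phi> x *\<^sub>R D i x \<partial>lborel)" .
    qed
  qed
qed

lemma shift_invariance:
  assumes E: "energy_space n Dn"
  shows "degree (\<lambda>x. n (x + c)) (\<lambda>i x. Dn i (x + c)) = degree n Dn"
    and "Energy r (\<lambda>x. n (x + c)) (\<lambda>i x. Dn i (x + c)) = Energy r n Dn"
proof -
  note [measurable] = energy_spaceD(1,2)[OF E]
  show "degree (\<lambda>x. n (x + c)) (\<lambda>i x. Dn i (x + c)) = degree n Dn"
    unfolding degree_def by (subst integral_shift[where f = "\<lambda>x. n x \<bullet> cross3 (Dn 1 x) (Dn 2 x)"]) simp_all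
  have "Dir (\<lambda>i x. Dn i (x + c)) = Dir Dn"
    unfolding Dir_def by (subst integral_shift[where f = "\<lambda>x. \<Sum>i\<in>UNIV. (norm (Dn i x))\<^sup>2"]) simp_all
  moreover have "Helic (\<lambda>x. n (x + c)) (\<lambda>i x. Dn i (x + c)) = Helic n Dn"
    unfolding Helic_def curl_shift by (subst integral_shift[where f = "\<lambda>x. (n x - e3) \<bullet> curl Dn x"]) simp_all
  moreover have "Pot (\<lambda>x. n (x + c)) = Pot n"
    unfolding Pot_def by (subst integral_shift[where f = "\<lambda>x. (1 - n x $ 3)\<^sup>2"]) simp_all
  ultimately show "Energy r (\<lambda>x. n (x + c)) (\<lambda>i x. Dn i (x + c)) = Energy r n Dn"
    by (simp add: Energy_def)
qed

lemma localized_field_glue: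
  assumes 1: "localized_field n\<^sub>1 D\<^sub>1 R\<^sub>1" and 2: "localized_field n\<^sub>2 D\<^sub>2 R\<^sub>2"
  obtains n Dn R where "localized_field n Dn R" "degree n Dn = degree n\<^sub>1 D\<^sub>1 + degree n\<^sub>2 D\<^sub>2"
    "Energy r n Dn = Energy r n\<^sub>1 D\<^sub>1 + Energy r n\<^sub>2 D\<^sub>2"
proof -
  \<comment> \<open>Where |x| < \<open>R\<^sub>1\<close>, the shifted point has norm at least \<rho>
    - |x| \<ge> \<open>R\<^sub>2\<close>, so the two varying regions are disjoint. Absolute values
    cover radii of either sign.\<close>
  define \<rho> where "\<rho> = \<bar>R\<^sub>1\<bar> + \<bar>R\<^sub>2\<bar>"
  define c :: "real^2" where "c = \<rho> *\<^sub>R axis 1 1"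
  have c: "norm c = \<rho>" by (simp add: c_def \<rho>_def norm_axis_1)
  define n\<^sub>2' where "n\<^sub>2' x = n\<^sub>2 (x + c)" for x
  define D\<^sub>2' where "D\<^sub>2' i x = D\<^sub>2 i (x + c)" for i x
  have e: "n\<^sub>2' = (\<lambda>x. n\<^sub>2 (x + c))" "D\<^sub>2' = (\<lambda>i x. D\<^sub>2 i (x + c))"
    by (simp_all add: fun_eq_iff n\<^sub>2'_def D\<^sub>2'_def)
  have E: "energy_space n\<^sub>1 D\<^sub>1" "energy_space n\<^sub>2 D\<^sub>2" "energy_space n\<^sub>2' D\<^sub>2'"
    using 1 2 energy_space_shift unfolding localized_field_def e by blast+
  have H: "integrable lborel (\<lambda>x. (n\<^sub>1 x - e3) \<bullet> curl D\<^sub>1 x)" "integrable lborel (\<lambda>x. (n\<^sub>2' x - e3) \<bullet> curl D\<^sub>2' x)"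
    using 1 2 integrable_shift[of "\<lambda>x. (n\<^sub>2 x - e3) \<bullet> curl D\<^sub>2 x" c] unfolding localized_field_def e curl_shift by blast+
  have sep: "(n\<^sub>1 x = e3 \<and> (\<forall>i. D\<^sub>1 i x = 0)) \<or> (n\<^sub>2' x = e3 \<and> (\<forall>i. D\<^sub>2' i x = 0))" for x
  proof (cases "R\<^sub>1 \<le> norm x")
    case True then show ?thesis using 1 by (auto simp: localized_field_def)
  next
    case False
    have "R\<^sub>2 \<le> norm (x + c)"
      using norm_diff_ineq[of c x] c False by (simp add: \<rho>_def add.commute)
    then show ?thesis using 2 by (auto simp: localized_field_def e)
  qed
  note s = superposition[OF E(1,3) H sep]
  show ?thesis
  proof (rule that)
    show "localized_field (\<lambda>x. n\<^sub>1 x + n\<^sub>2' x - e3) (\<lambda>i x. D\<^sub>1 i x + D\<^sub>2' i x) (\<bar>R\<^sub>1\<bar> + \<bar>R\<^sub>2\<bar> + \<rho>)"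
      unfolding localized_field_def
    proof (intro conjI s allI impI)
      fix x :: "real^2" assume x: "\<bar>R\<^sub>1\<bar> + \<bar>R\<^sub>2\<bar> + \<rho> \<le> norm x"
      have "R\<^sub>1 \<le> norm x" "R\<^sub>2 \<le> norm (x + c)"
        using norm_diff_ineq[of x c] c x by (auto simp: \<rho>_def)
      then show "n\<^sub>1 x + n\<^sub>2' x - e3 = e3" "D\<^sub>1 i x + D\<^sub>2' i x = 0" for i
        using 1 2 by (auto simp: localized_field_def e)
    qed
  qed (use s(3,4) shift_invariance[OF E(2)] in \<open>simp_all add: e\<close>)
qed

lemma localized_field_e3: "localized_field (\<lambda>x. e3) (\<lambda>i x. 0) 0"
  by (simp add: localized_field_def energy_space_e3)

lemma localized_cluster:
  fixes p q :: nat
  assumes r: "0 < r" and \<epsilon>: "0 < \<epsilon>"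
  shows "\<exists>n Dn R. localized_field n Dn R \<and> degree n Dn = real p - real q
     \<and> Energy r n Dn \<le> real p * (4 * pi + \<epsilon>) + real q * (4 * pi * (1 - 2 * r\<^sup>2) + \<epsilon>)"
proof (induction p)
  case 0
  show ?case
  proof (induction q)
    case 0
    have "degree (\<lambda>x. e3) (\<lambda>i x. 0) = 0" "Energy r (\<lambda>x. e3) (\<lambda>i x. 0) = 0"
      by (simp_all add: degree_def Energy_def Dir_def Helic_def Pot_def e3_components)
    then show ?case using localized_field_e3 by (intro exI[of _ "\<lambda>x. e3"] exI[of _ "\<lambda>i x. 0"] exI[of _ 0]) simp
  next
    case (Suc q)
    then obtain n D R where 1: "localized_field n D R" "degree n D = real 0 - real q"
      "Energy r n D \<le> real 0 * (4 * pi + \<epsilon>) + real q * (4 * pi * (1 - 2 * r\<^sup>2) + \<epsilon>)" by blast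
    obtain n' D' R' where 2: "localized_field n' D' R'" "degree n' D' = -1" "Energy r n' D' \<le> 4 * pi * (1 - 2 * r\<^sup>2) + \<epsilon>"
      using localized_skyrmion[OF r \<epsilon>] by blast
    obtain n'' D'' R'' where "localized_field n'' D'' R''" "degree n'' D'' = degree n D + degree n' D'"
      "Energy r n'' D'' = Energy r n D + Energy r n' D'"
      using localized_field_glue[OF 1(1) 2(1)] by blast
    then show ?case using 1 2 by (intro exI[of _ n''] exI[of _ D''] exI[of _ R'']) (simp add: algebra_simps)
  qed
next
  case (Suc p)
  then obtain n D R where 1: "localized_field n D R" "degree n D = real p - real q"
    "Energy r n D \<le> real p * (4 * pi + \<epsilon>) + real q * (4 * pi * (1 - 2 * r\<^sup>2) + \<epsilon>)" by blast
  obtain n' D' R' where 2: "localized_field n' D' R'" "degree n' D' = 1" "Energy r n' D' \<le> 4 * pi + \<epsilon>"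
    using localized_antiskyrmion[OF r \<epsilon>] by blast
  obtain n'' D'' R'' where "localized_field n'' D'' R''" "degree n'' D'' = degree n D + degree n' D'"
    "Energy r n'' D'' = Energy r n D + Energy r n' D'"
    using localized_field_glue[OF 1(1) 2(1)] by blast
  then show ?case using 1 2 by (intro exI[of _ n''] exI[of _ D''] exI[of _ R'']) (simp add: algebra_simps)
qed

section \<open>Bounds for the infimum\<close>

lemma inf_energy_upper:
  fixes p q :: nat
  assumes r: "0 < r" and k: "k = int p - int q"
  shows "inf_energy r k \<le> ereal (real p * (4 * pi) + real q * (4 * pi * (1 - 2 * r\<^sup>2)))"
proof (rule ereal_le_epsilon2)
  fix \<epsilon> :: real assume \<epsilon>: "0 < \<epsilon>"
  \<comment> \<open>Each of the p + q bubbles may exceed its limiting energy by \<delta>; the added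
    1 keeps the divisor positive when p = q = 0.\<close>
  define \<delta> where "\<delta> = \<epsilon> / (real p + real q + 1)"
  have \<delta>: "0 < \<delta>" using \<epsilon> by (simp add: \<delta>_def add_nonneg_pos)
  have le: "(real p + real q) * \<delta> \<le> \<epsilon>"
    using \<epsilon> by (simp add: \<delta>_def field_simps)
  obtain n Dn R where n: "localized_field n Dn R" "degree n Dn = real p - real q"
     "Energy r n Dn \<le> real p * (4 * pi + \<delta>) + real q * (4 * pi * (1 - 2 * r\<^sup>2) + \<delta>)"
    using localized_cluster[OF r \<delta>, of p q] by blast
  have "inf_energy r k \<le> ereal (Energy r n Dn)"
    unfolding inf_energy_def by (rule INF_lower2[of "(n, Dn)"]) (use n k in \<open>auto simp: localized_field_def\<close>)
  also have "\<dots> \<le> ereal (real p * (4 * pi) + real q * (4 * pi * (1 - 2 * r\<^sup>2)) + \<epsilon>)"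
    using n(3) le by (simp add: algebra_simps)
  finally show "inf_energy r k \<le> ereal (real p * (4 * pi) + real q * (4 * pi * (1 - 2 * r\<^sup>2))) + ereal \<epsilon>"
    by simp
qed

lemma inf_energy_lower:
  assumes "0 < r" "r \<le> 1"
  shows "ereal (4 * pi * (\<bar>real_of_int k\<bar> * (1 - r\<^sup>2) + r\<^sup>2 * real_of_int k)) \<le> inf_energy r k"
  unfolding inf_energy_def
proof (rule INF_greatest, clarify)
  fix n Dn assume "energy_space n Dn" "degree n Dn = real_of_int k"
  then show "ereal (4 * pi * (\<bar>real_of_int k\<bar> * (1 - r\<^sup>2) + r\<^sup>2 * real_of_int k)) \<le> ereal (Energy r n Dn)"
    using Energy_lower_bound[OF _ assms, of n Dn] by simp
qed

theorem theorem1p1: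
  fixes r :: real and k :: int
  assumes "r > 0"
  shows "(r \<le> 1 \<longrightarrow> inf_energy r k =
            (if k < 0 then ereal (4 * pi * \<bar>real_of_int k\<bar> * (1 - 2 * r\<^sup>2))
             else ereal (4 * pi * real_of_int k)))
       \<and> (r > 1 \<longrightarrow> inf_energy r k = - \<infinity>)"
proof (intro conjI impI)
  assume r: "r \<le> 1"
  show "inf_energy r k = (if k < 0 then ereal (4 * pi * \<bar>real_of_int k\<bar> * (1 - 2 * r\<^sup>2))
             else ereal (4 * pi * real_of_int k))"
  proof (cases "k < 0")
    case True
    \<comment> \<open>Negative k is realized by |k| skyrmions alone; in the other case k
      antiskyrmions are used.\<close>
    have "inf_energy r k \<le> ereal (4 * pi * \<bar>real_of_int k\<bar> * (1 - 2 * r\<^sup>2))"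
      using inf_energy_upper[OF assms, of k 0 "nat (- k)"] True by (simp add: mult_ac)
    moreover have "ereal (4 * pi * \<bar>real_of_int k\<bar> * (1 - 2 * r\<^sup>2)) \<le> inf_energy r k"
      using inf_energy_lower[OF assms r, of k] True by (simp add: algebra_simps)
    ultimately show ?thesis using True by simp
  next
    case False
    have "inf_energy r k \<le> ereal (4 * pi * real_of_int k)"
      using inf_energy_upper[OF assms, of k "nat k" 0] False by (simp add: mult_ac)
    moreover have "ereal (4 * pi * real_of_int k) \<le> inf_energy r k"
      using inf_energy_lower[OF assms r, of k] False by (simp add: algebra_simps)
    ultimately show ?thesis using False by simp
  qed
next
  assume r: "r > 1"
  show "inf_energy r k = - \<infinity>"
  proof (rule ereal_bot)
    fix B :: real
    \<comment> \<open>The energy gained per added pair of opposite degree: c = -(4 pi + 4 pi (1 - 2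
      r^2)).\<close>
    define c where "c = 8 * pi * (r\<^sup>2 - 1)"
    \<comment> \<open>The bound without extra pairs; at most one of \<open>nat k\<close> and
      \<open>nat (- k)\<close> is nonzero, and adding N to both leaves the degree unchanged.\<close>
    define A where "A = real (nat k) * (4 * pi) + real (nat (- k)) * (4 * pi * (1 - 2 * r\<^sup>2))"
    have c: "0 < c" using r by (simp add: c_def)
    obtain N :: nat where N: "(A - B) / c < real N" using reals_Archimedean2 by blast
    then have "A - B < real N * c" using c by (simp add: field_simps)
    have "inf_energy r k \<le> ereal (real (nat k + N) * (4 * pi) + real (nat (- k) + N) * (4 * pi * (1 - 2 * r\<^sup>2)))"
      by (rule inf_energy_upper[OF assms]) auto
    also have "\<dots> = ereal (A - real N * c)" by (simp add: A_def c_def algebra_simps)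
    also have "\<dots> \<le> ereal B" using \<open>A - B < real N * c\<close> by simp
    finally show "inf_energy r k \<le> ereal B" .
  qed
qed

end
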